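(* Let $X_t$, $t\in\mathbb{R}^d$, be a real measurable strictly stationary random field with $\mathbb{E}X_t=0$ and $\mathbb{E}|X_t|^k<\infty$ for all $k\ge 2$, which has cumulant spectral densities $f_k\in L_1(\mathbb{R}^{d(k-1)})$ of all orders $k\ge 2$. Let $K\subset\mathbb{R}^d$ be a bounded convex set of positive Lebesgue measure $|K|>0$ containing the origin, and $K_T=TK$. Suppose that: (i) there is $p_*$ with $1\le p_*<2$ such that for every $p>p_*$ $$\left(\int_{\mathbb{R}^d}\left|\int_{K}e^{it\lambda}\,dt\right|^p d\lambda\right)^{1/p}<\infty;$$ (ii) the second-order spectral density $f_2$ is bounded and continuous, and $f_2(0)=\frac{1}{(2\pi)^d}\int_{\mathbb{R}^d}\mathbb{E}[X_tX_0]\,dt\neq 0$; (iii) for every $k\ge 3$, $f_k\in L_{p_k}(\mathbb{R}^{d(k-1)})$, where $p_k=\frac{2(k-1)}{k-2}$; (iv) the functions $$\Phi^{(2)}_{T_1,T_2}(\lambda)=\frac{1}{(2\pi)^d|K|(T_2^d-T_1^d)}\left|\int_{K_{T_2}\setminus K_{T_1}}e^{it\lambda}\,dt\right|^2,\qquad \lambda\in\mathbb{R}^d,\ T_1<T_2,$$ have the kernel properties: $\int_{\mathbb{R}^d}\Phi^{(2)}_{T_1,T_2}(\lambda)\,d\lambda=1$, and for any $\varepsilon>0$, $\int_{\mathbb{R}^d\setminus\varepsilon K}\Phi^{(2)}_{T_1,T_2}(\lambda)\,d\lambda\to 0$ for $T_1<T_2$, $T_1\to\infty$. Let $P_T$ be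 the probability measure induced in $C[0,1]$ by the process $$Y_T(u)=\frac{1}{T^{d/2}}\int_{u^{1/d}K_T}X_t\,dt,\qquad u\in[0,1],$$ and let $P$ be the probability measure induced in $C[0,1]$ by the Gaussian process $$L_K(u)=\left((2\pi)^d f_2(0)\right)^{1/2}\int_{u^{1/d}K}db(t),\qquad u\in[0,1],$$ which has zero mean and covariance $\mathbb{E}L_K(u_1)L_K(u_2)=(2\pi)^d f_2(0)\left|u_1^{1/d}K\cap u_2^{1/d}K\right|$. Then $P_T$ converges weakly to $P$ in $C[0,1]$ as $T\to\infty$.
   Context: For $k\ge2$, $c_k(t_1,\dots,t_k)$ denotes the joint cumulant of $(X_{t_1},\dots,X_{t_k})$; by stationarity $c_k(t_1,\dots,t_k)=c_k(t_1-t_k,\dots,t_{k-1}-t_k,0)$. Saying that $X$ has cumulant spectral densities $f_k\in L_1(\mathbb{R}^{d(k-1)})$ of all orders means that for every $k\ge 2$ and all $t_1,\dots,t_k\in\mathbb{R}^d$ $$c_k(t_1,\dots,t_k)=\int_{\mathbb{R}^{d(k-1)}}e^{i\sum_{j=1}^{k-1}\lambda_j(t_j-t_k)}f_k(\lambda_1,\dots,\lambda_{k-1})\,d\lambda_1\cdots d\lambda_{k-1},$$ with $\lambda_j\in\mathbb{R}^d$; the $f_k$ are symmetric and may be complex valued. For $t,\lambda\in\mathbb{R}^d$, $t\lambda$ is the Euclidean inner product and $|\cdot|$ of a set is Lebesgue measure. $C[0,1]$ is the space of continuous functions with the uniform topology; it is a standing assumption that $L_K$ induces a probability measure on $C[0,1]$.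 Here $b(t)$, $t\in\mathbb{R}^d$, is multiparameter Brownian motion of Chentsov type: the zero-mean Gaussian field with $b(t)=0$ if some coordinate of $t$ is $0$, and $\mathbb{E}b(t_1)b(t_2)=\prod_{j=1}^d\min\{t_1^{(j)},t_2^{(j)}\}$ for $t_l=(t_l^{(1)},\dots,t_l^{(d)})$; $\int_A db(t)$ is integration against the associated Gaussian white noise, with covariance $|A\cap A'|$ for sets $A,A'$. *)

theory Defs
  imports "HOL-Probability.Probability"
begin

definition C01 :: "(real \<Rightarrow> real) metric" where
  "C01 = cfunspace (top_of_set {0..1}) euclidean_metric"

definition borel_top :: "'a topology \<Rightarrow> 'a measure" where
  "borel_top X = sigma (topspace X) {U. openin X U}"

definition weakly_converges ::
    "'a topology \<Rightarrow> ('i \<Rightarrow> 'a measure) \<Rightarrow> 'a measure \<Rightarrow> 'i filter \<Rightarrow> bool" where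
  "weakly_converges X Q P F \<longleftrightarrow>
     (\<forall>g. continuous_map X euclideanreal g \<and> bounded (g ` topspace X) \<longrightarrow>
        ((\<lambda>i. \<integral>x. g x \<partial>Q i) \<longlongrightarrow> (\<integral>x. g x \<partial>P)) F)"

text \<open>
  The elements of the space \<^const>\<open>C01\<close> are extensional on the unit interval, hence the restriction.
  A process whose paths are almost surely continuous induces a measure on it: the exceptional paths
  are replaced by \<open>0\<close>, and the completion makes this replacement measurable even if the
  exceptional set is only contained in a measurable null set.
\<close>

definition path_C01 :: "(real \<Rightarrow> 'w \<Rightarrow> real) \<Rightarrow> 'w \<Rightarrow> real \<Rightarrow> real" where
  "path_C01 Y \<omega> =
     (if continuous_on {0..1} (\<lambda>u. Y u \<omega>) then (\<lambda>u\<in>{0..1}. Y u \<omega>) else (\<lambda>u\<in>{0..1}. 0))"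

definition law_C01 :: "'w measure \<Rightarrow> (real \<Rightarrow> 'w \<Rightarrow> real) \<Rightarrow> (real \<Rightarrow> real) measure" where
  "law_C01 M Y = distr (completion M) (borel_top (mtopology_of C01)) (path_C01 Y)"

definition strictly_stationary ::
    "'w measure \<Rightarrow> ('a::ab_group_add \<Rightarrow> 'w \<Rightarrow> real) \<Rightarrow> bool" where
  "strictly_stationary M X \<longleftrightarrow>
     (\<forall>J h. finite J \<longrightarrow>
        distr M (\<Pi>\<^sub>M t\<in>J. borel) (\<lambda>\<omega>. \<lambda>t\<in>J. X (t + h) \<omega>) =
        distr M (\<Pi>\<^sub>M t\<in>J. borel) (\<lambda>\<omega>. \<lambda>t\<in>J. X t \<omega>))"

text \<open>The moment formula of Leonov and Shiryaev, which sums over all partitions of the index set.\<close>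

definition joint_cumulant :: "'w measure \<Rightarrow> ('i \<Rightarrow> 'w \<Rightarrow> real) \<Rightarrow> 'i set \<Rightarrow> real" where
  "joint_cumulant M Z I =
     (\<Sum>\<pi> | partition_on I \<pi>.
        (- 1) ^ (card \<pi> - 1) * fact (card \<pi> - 1) * (\<Prod>B\<in>\<pi>. \<integral>\<omega>. (\<Prod>i\<in>B. Z i \<omega>) \<partial>M))"

definition in_Lp :: "real \<Rightarrow> 'a measure \<Rightarrow> ('a \<Rightarrow> complex) \<Rightarrow> bool" where
  "in_Lp p M g \<longleftrightarrow> g \<in> borel_measurable M \<and> integrable M (\<lambda>x. norm (g x) powr p)"

text \<open>
  Lebesgue measure on $\mathbb{R}^{d(k-1)}$; the points are the families
  $(\lambda_1,\dots,\lambda_{k-1})$ of vectors in $\mathbb{R}^d$, indexed by \<open>{1..<k}\<close>.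
\<close>

definition freq_space :: "nat \<Rightarrow> (nat \<Rightarrow> real ^ 'd) measure" where
  "freq_space k = (\<Pi>\<^sub>M j\<in>{1..<k}. lborel)"

definition cumulant_spectral_densities ::
    "'w measure \<Rightarrow> (real ^ 'd \<Rightarrow> 'w \<Rightarrow> real) \<Rightarrow> (nat \<Rightarrow> (nat \<Rightarrow> real ^ 'd) \<Rightarrow> complex) \<Rightarrow> bool" where
  "cumulant_spectral_densities M X f \<longleftrightarrow>
     (\<forall>k\<ge>2.
        integrable (freq_space k) (f k) \<and>
        (\<forall>\<sigma>. \<sigma> permutes {1..<k} \<longrightarrow> (AE l in freq_space k. f k (l \<circ> \<sigma>) = f k l)) \<and>
        (\<forall>t. complex_of_real (joint_cumulant M (\<lambda>j. X (t j)) {1..k}) =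
           (\<integral>l. cis (\<Sum>j\<in>{1..<k}. l j \<bullet> (t j - t k)) * f k l \<partial>freq_space k)))"

text \<open>The second-order density as a function on $\mathbb{R}^d$ rather than on one-element families.\<close>

definition second_order :: "(nat \<Rightarrow> (nat \<Rightarrow> real ^ 'd) \<Rightarrow> complex) \<Rightarrow> real ^ 'd \<Rightarrow> complex" where
  "second_order f l = f 2 (\<lambda>j\<in>{1..<2}. l)"

text \<open>
  Integrals over subsets of $\mathbb{R}^d$ are taken with respect to \<^const>\<open>lebesgue\<close>, because a
  convex set is Lebesgue measurable but need not be Borel.
\<close>

definition dilate :: "real \<Rightarrow> (real ^ 'd) set \<Rightarrow> (real ^ 'd) set" where
  "dilate c A = (\<lambda>x. c *\<^sub>R x) ` A"

definition fourier_set :: "(real ^ 'd) set \<Rightarrow> real ^ 'd \<Rightarrow> complex" where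
  "fourier_set A l = (LINT t:A|lebesgue. cis (t \<bullet> l))"

definition Phi2 :: "(real ^ 'd) set \<Rightarrow> real \<Rightarrow> real \<Rightarrow> real ^ 'd \<Rightarrow> real" where
  "Phi2 K T1 T2 l =
     (norm (fourier_set (dilate T2 K - dilate T1 K) l))\<^sup>2 /
     ((2 * pi) ^ CARD('d) * measure lebesgue K * (T2 ^ CARD('d) - T1 ^ CARD('d)))"

text \<open>
  In the second kernel property \<open>T1\<close> tends to infinity with the ratio \<open>T2 / T1 = c > 1\<close> kept
  fixed, which is the regime of the increments of the process between two levels \<open>u\<close>.
  A limit uniform in all \<open>T2 > T1\<close> is never attained: the integral of the kernel over
  \<open>dilate \<epsilon> K\<close> is at most a constant times \<open>T2 ^ d - T1 ^ d\<close>, so that for \<open>T2\<close> close to \<open>T1\<close>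
  almost all of the mass lies outside.
\<close>

definition kernel_properties :: "(real ^ 'd) set \<Rightarrow> bool" where
  "kernel_properties K \<longleftrightarrow>
     (\<forall>T1 T2. 0 < T1 \<and> T1 < T2 \<longrightarrow>
        integrable lebesgue (Phi2 K T1 T2) \<and> (\<integral>l. Phi2 K T1 T2 l \<partial>lebesgue) = 1) \<and>
     (\<forall>\<epsilon>>0. \<forall>c>1.
        ((\<lambda>T1. LINT l:(- dilate \<epsilon> K)|lebesgue. Phi2 K T1 (c * T1) l) \<longlongrightarrow> 0) at_top)"

definition Y_process ::
    "(real ^ 'd \<Rightarrow> 'w \<Rightarrow> real) \<Rightarrow> (real ^ 'd) set \<Rightarrow> real \<Rightarrow> real \<Rightarrow> 'w \<Rightarrow> real" where
  "Y_process X K T u \<omega> =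
     1 / T powr (real CARD('d) / 2) *
     (LINT t:dilate (root CARD('d) u) (dilate T K)|lebesgue. X t \<omega>)"

definition gaussian_rv :: "'v measure \<Rightarrow> ('v \<Rightarrow> real) \<Rightarrow> bool" where
  "gaussian_rv N Z \<longleftrightarrow> Z \<in> borel_measurable N \<and>
     ((\<exists>\<mu> \<sigma>. 0 < \<sigma> \<and> distributed N lborel Z (normal_density \<mu> \<sigma>)) \<or>
      (\<exists>\<mu>. AE \<omega> in N. Z \<omega> = \<mu>))"

definition centred_gaussian_family :: "'v measure \<Rightarrow> 'i set \<Rightarrow> ('i \<Rightarrow> 'v \<Rightarrow> real) \<Rightarrow> bool" where
  "centred_gaussian_family N I G \<longleftrightarrow>
     (\<forall>J a. finite J \<and> J \<subseteq> I \<longrightarrow> gaussian_rv N (\<lambda>\<omega>. \<Sum>i\<in>J. a i * G i \<omega>)) \<and>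
     (\<forall>i\<in>I. (\<integral>\<omega>. G i \<omega> \<partial>N) = 0)"

text \<open>
  The covariance formula with minima is not positive semidefinite outside the closed positive
  orthant, so it is required there only.  On the remaining orthants the field is determined by
  its white noise through \<open>noise_of\<close> below.
\<close>

definition chentsov_bm :: "'v measure \<Rightarrow> (real ^ 'd \<Rightarrow> 'v \<Rightarrow> real) \<Rightarrow> bool" where
  "chentsov_bm N b \<longleftrightarrow>
     centred_gaussian_family N UNIV b \<and>
     (\<forall>t. (\<exists>i. t $ i = 0) \<longrightarrow> (\<forall>\<omega>\<in>space N. b t \<omega> = 0)) \<and>
     (\<forall>s t. (\<forall>i. 0 \<le> s $ i \<and> 0 \<le> t $ i) \<longrightarrow>
        (\<integral>\<omega>. b s \<omega> * b t \<omega> \<partial>N) = (\<Prod>i\<in>UNIV. min (s $ i) (t $ i)))"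

text \<open>
  \<open>W A\<close> is the integral of the indicator of \<open>A\<close> against \<open>db\<close>.  The link with \<open>b\<close> is
  that \<open>b t\<close> is the signed noise of the box spanned by the origin and \<open>t\<close>.
\<close>

definition gaussian_white_noise :: "'v measure \<Rightarrow> ((real ^ 'd) set \<Rightarrow> 'v \<Rightarrow> real) \<Rightarrow> bool" where
  "gaussian_white_noise N W \<longleftrightarrow>
     centred_gaussian_family N lmeasurable W \<and>
     (\<forall>A\<in>lmeasurable. \<forall>A'\<in>lmeasurable.
        (\<integral>\<omega>. W A \<omega> * W A' \<omega> \<partial>N) = measure lebesgue (A \<inter> A'))"

definition noise_of ::
    "'v measure \<Rightarrow> (real ^ 'd \<Rightarrow> 'v \<Rightarrow> real) \<Rightarrow> ((real ^ 'd) set \<Rightarrow> 'v \<Rightarrow> real) \<Rightarrow> bool" where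
  "noise_of N b W \<longleftrightarrow>
     gaussian_white_noise N W \<and>
     (\<forall>t. AE \<omega> in N. b t \<omega> =
        (\<Prod>i\<in>UNIV. sgn (t $ i)) * W (cbox (\<chi> i. min 0 (t $ i)) (\<chi> i. max 0 (t $ i))) \<omega>)"

text \<open>
  \<open>f2_0\<close> is meant to be the real part of $f_2(0)$; a continuous second-order spectral density
  of a real field is real and nonnegative, so nothing is lost.
\<close>

definition L_process ::
    "((real ^ 'd) set \<Rightarrow> 'v \<Rightarrow> real) \<Rightarrow> real \<Rightarrow> (real ^ 'd) set \<Rightarrow> real \<Rightarrow> 'v \<Rightarrow> real" where
  "L_process W f2_0 K u \<omega> =
     sqrt ((2 * pi) ^ CARD('d) * f2_0) * W (dilate (root CARD('d) u) K) \<omega>"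

end

theory Submission
  imports Defs "HOL-Computational_Algebra.Formal_Power_Series"
begin

text \<open>
  The increments of the process \<open>Y_T\<close>, and all linear combinations of its values, are linear functionals
  \<open>\<integral> \<psi>(t) X(t) dt\<close> of the field, where \<open>\<psi>(t)\<close> is \<open>\<Psi>(t/T)\<close> divided by \<open>T powr (d/2)\<close>, for
  a combination \<open>\<Psi>\<close> of indicators of dilates of \<open>K\<close>. Convergence of the finite-dimensional distributions is shown
  by the method of moments and tightness by a fourth-moment bound; both rest on an estimate of cumulants.

  \<^bold>\<open>Cumulants.\<close> By Fubini's theorem the \<open>k\<close>-th cumulant of a linear functional is the integral of the
  spectral density \<open>f\<^sub>k\<close> against \<open>\<Prod>\<^sub>j \<psi>^(\<lambda>\<^sub>j)\<close> over \<open>k\<close> frequencies with sum zero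
  (\<open>partition_cumulant_spectral\<close>). As any \<open>k - 1\<close> of these frequencies are free coordinates, the
  inequality of arithmetic and geometric means bounds the integral of
  \<open>\<Prod>\<^sub>j |\<psi>^(\<lambda>\<^sub>j)|\<close> raised to the power \<open>s (k - 1) / k\<close> by the \<open>(k - 1)\<close>-th power of \<open>\<integral> |\<psi>^|\<^sup>s\<close>
  (\<open>nn_integral_freq_prod_le\<close>). For \<open>s = 2\<close> the power is conjugate to the exponent of integrability of
  \<open>f\<^sub>k\<close>, and \<open>\<integral> |\<psi>^|\<^sup>2\<close> does not depend on \<open>T\<close>, so the cumulants stay bounded. For \<open>s < 2\<close> close to 2 the integral
  \<open>\<integral> |\<psi>^|\<^sup>s\<close> is finite by the assumption on the Fourier transform of \<open>K\<close> and decays as a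
  negative power of \<open>T\<close>. Splitting \<open>f\<^sub>k\<close> into its large and its bounded values combines the two cases: all
  cumulants of order at least 3 tend to 0 (\<open>partition_cumulant_tendsto_0\<close>).

  \<^bold>\<open>Finite-dimensional distributions.\<close> The second moment is computed in the time domain and converges to
  \<open>\<integral> \<Psi>\<^sup>2\<close> times the integral of the covariance function (\<open>moment_2_tendsto\<close>). As moments are polynomials in
  the cumulants, all moments converge to those of a normal variable (\<open>moment_tendsto\<close>), and a Taylor
  expansion gives convergence of the characteristic functions (\<open>char_tendsto\<close>). For the white noise the
  variance of the same combination is \<open>\<integral> \<Psi>\<^sup>2\<close> times \<open>(2\<pi>)\<^sup>d f\<^sub>2(0)\<close>, which is the same number.

  \<^bold>\<open>Tightness.\<close> The normalisation of the kernels says that the Fourier transform of the indicator of a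
  difference of two dilates of \<open>K\<close> has a squared norm proportional to its volume. With the bound
  for \<open>k = 4\<close>, \<open>s = 2\<close> this gives a fourth moment of \<open>Y_T(u) - Y_T(v)\<close> of at most \<open>B (u - v)\<^sup>2\<close>
  (\<open>Y_fourth_moment\<close>). Chaining over dyadic points puts the paths, up to a small probability, into a set
  of functions with a common Hoelder-type modulus of continuity (\<open>dyadic_tightness\<close>). This set is compact for
  pointwise convergence, and on it every functional that is continuous for uniform convergence is also
  continuous for pointwise convergence; by the Stone-Weierstrass theorem such a functional is approximated there by
  trigonometric polynomials in finitely many values of the path, whose expectations are
  obtained from characteristic functions. This yields weak convergence directly, without extracting subsequences
  (\<open>weak_convergence_C01\<close>).
\<close>

section \<open>Partitions, moments and cumulants\<close>

text \<open>A partition of \<open>insert x A\<close> is given by the block of \<open>x\<close>, written \<open>insert x C\<close>, and a partition of the rest.\<close>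
lemma sum_partitions_insert:
  fixes g :: "'a set \<Rightarrow> 'b::comm_semiring_1"
  assumes "finite A" "x \<notin> A"
  shows "(\<Sum>\<pi> | partition_on (insert x A) \<pi> \<and> card \<pi> = Suc j. \<Prod>B\<in>\<pi>. g B) =
    (\<Sum>C\<in>Pow A. g (insert x C) * (\<Sum>\<pi> | partition_on (A - C) \<pi> \<and> card \<pi> = j. \<Prod>B\<in>\<pi>. g B))"
proof -
  let ?P = "\<lambda>A j. {\<pi>. partition_on A \<pi> \<and> card \<pi> = j}"
  let ?blk = "\<lambda>\<pi>. THE B. B \<in> \<pi> \<and> x \<in> B"
  have fin: "finite (?P B j)" if "finite B" for B :: "'a set" and j
    using finitely_many_partition_on[OF that] by (rule rev_finite_subset) auto
  have blk: "\<exists>B. B \<in> \<pi> \<and> x \<in> B \<and> ?blk \<pi> = B \<and> partition_on (insert x A - B) (\<pi> - {B}) \<and> B \<subseteq> insert x A"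
    if p: "partition_on (insert x A) \<pi>" for \<pi>
  proof -
    obtain B where B: "B \<in> \<pi>" "x \<in> B"
      using partition_onD1[OF p] by auto
    have uq: "C = B" if "C \<in> \<pi>" "x \<in> C" for C
      using partition_onD2[OF p] B that by (auto simp: disjoint_def)
    have e: "?blk \<pi> = B" by (rule the_equality) (use B uq in blast)+
    have dj: "disjnt B (\<Union>(\<pi> - {B}))"
      using partition_onD2[OF p] B by (auto simp: disjoint_def disjnt_def)
    have "insert B (\<pi> - {B}) = \<pi>" using B by auto
    then have "partition_on (insert x A - B) (\<pi> - {B}) \<and> B \<subseteq> insert x A"
      using p partition_on_insert[OF dj, of "insert x A"] by simp
    with B e show ?thesis by (intro exI[of _ B] conjI) simp_all
  qed
  have ins: "partition_on (insert x A) (insert (insert x C) \<pi>) \<and> insert x C \<notin> \<pi> \<and> x \<notin> \<Union>\<pi>"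
    if "C \<subseteq> A" "partition_on (A - C) \<pi>" for C \<pi>
  proof -
    have U: "\<Union>\<pi> = A - C" using partition_onD1[OF that(2)] by simp
    have xn: "x \<notin> \<Union>\<pi>" using U assms by auto
    have "disjnt (insert x C) (\<Union>\<pi>)" using U assms by (auto simp: disjnt_def)
    from partition_on_insert[OF this, of "insert x A"] show ?thesis
      using that assms xn by auto
  qed
  have "(\<Sum>C\<in>Pow A. g (insert x C) * (\<Sum>\<pi>\<in>?P (A - C) j. \<Prod>B\<in>\<pi>. g B)) =
      (\<Sum>(C,\<pi>)\<in>Sigma (Pow A) (\<lambda>C. ?P (A - C) j). g (insert x C) * (\<Prod>B\<in>\<pi>. g B))"
    using assms by (simp add: sum_distrib_left sum.Sigma fin)
  also have "\<dots> = (\<Sum>\<pi>\<in>?P (insert x A) (Suc j). \<Prod>B\<in>\<pi>. g B)"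
  proof (rule sum.reindex_bij_witness[where j = "\<lambda>(C,\<pi>). insert (insert x C) \<pi>"
        and i = "\<lambda>\<pi>. (?blk \<pi> - {x}, \<pi> - {?blk \<pi>})"], goal_cases)
    case (1 a)
    then obtain C \<pi> where a: "a = (C,\<pi>)" "C \<subseteq> A" "partition_on (A - C) \<pi>" by auto
    have "(THE B. B \<in> insert (insert x C) \<pi> \<and> x \<in> B) = insert x C"
      using ins[OF a(2,3)] by (intro the_equality) auto
    then show ?case using a ins[OF a(2,3)] assms by auto
  next
    case (2 a)
    then obtain C \<pi> where a: "a = (C,\<pi>)" "C \<subseteq> A" "partition_on (A - C) \<pi>" "card \<pi> = j" by auto
    have "finite \<pi>" using finite_elements[OF _ a(3)] assms by auto
    then show ?case using a ins[OF a(2,3)] by auto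
  next
    case (3 \<pi>)
    then obtain B where B: "B \<in> \<pi>" "x \<in> B" "?blk \<pi> = B" using blk[of \<pi>] by auto
    then have "insert x B = B" by auto
    then show ?case using B by (auto simp: insert_absorb)
  next
    case (4 \<pi>)
    then obtain B where B: "B \<in> \<pi>" "x \<in> B" "?blk \<pi> = B" "partition_on (insert x A - B) (\<pi> - {B})"
      "B \<subseteq> insert x A" using blk[of \<pi>] by auto
    have "finite \<pi>" using finite_elements[of "insert x A" \<pi>] assms 4 by auto
    have "insert x A - B = A - (B - {x})" using B assms by auto
    then show ?case using B 4 assms \<open>finite \<pi>\<close> by auto
  next
    case (5 a)
    then obtain C \<pi> where a: "a = (C,\<pi>)" "C \<subseteq> A" "partition_on (A - C) \<pi>" "card \<pi> = j" by auto
    have "finite \<pi>" using finite_elements[OF _ a(3)] assms by auto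
    then show ?case using a ins[OF a(2,3)] by auto
  qed
  finally show ?thesis by simp
qed

text \<open>The exponential generating function of a moment sequence, without its constant term.\<close>
definition moment_fps :: "(nat \<Rightarrow> real) \<Rightarrow> real fps" where
  "moment_fps m = Abs_fps (\<lambda>n. if n = 0 then 0 else m n / fact n)"

lemma moment_fps_nth [simp]: "fps_nth (moment_fps m) n = (if n = 0 then 0 else m n / fact n)"
  by (simp add: moment_fps_def)

lemma sum_Pow_card:
  fixes h :: "nat \<Rightarrow> 'b::comm_semiring_1"
  assumes "finite A"
  shows "(\<Sum>C\<in>Pow A. h (card C)) = (\<Sum>i\<le>card A. of_nat (card A choose i) * h i)"
proof -
  have "(\<Sum>C\<in>Pow A. h (card C)) = (\<Sum>i\<le>card A. \<Sum>C | C \<in> Pow A \<and> card C = i. h (card C))"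
    using assms by (intro sum.group[symmetric]) (auto simp: card_mono)
  also have "\<dots> = (\<Sum>i\<le>card A. of_nat (card A choose i) * h i)"
    using assms by (intro sum.cong) (auto simp: n_subsets)
  finally show ?thesis .
qed

text \<open>
  The exponential formula. Splitting off the block of one element turns into the derivative of
  \<open>F ^ j\<close> on the side of power series.
\<close>
lemma sum_partitions_eq_fps_nth:
  fixes m :: "nat \<Rightarrow> real"
  assumes "finite A"
  shows "(\<Sum>\<pi> | partition_on A \<pi> \<and> card \<pi> = j. \<Prod>B\<in>\<pi>. m (card B)) =
    fact (card A) * fps_nth (moment_fps m ^ j) (card A) / fact j"
  using assms
proof (induction "card A" arbitrary: A j rule: less_induct)
  case less
  let ?F = "moment_fps m"
  show ?case
  proof (cases "A = {}")
    case True
    have "{\<pi>. partition_on A \<pi> \<and> card \<pi> = j} = (if j = 0 then {{}} else {})"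
      by (auto simp: partition_on_empty True)
    then show ?thesis using True by (simp add: fps_nth_power_0)
  next
    case False
    then obtain x A' where A: "A = insert x A'" "x \<notin> A'" by (meson mk_disjoint_insert ex_in_conv)
    have fin: "finite A'" using less A by simp
    let ?n = "card A'"
    have cA: "card A = Suc ?n" using A fin by simp
    show ?thesis
    proof (cases j)
      case 0
      have "{\<pi>. partition_on A \<pi> \<and> card \<pi> = 0} = {}"
        using False finite_elements[OF less(2)] by (auto simp: partition_on_def)
      then have "(\<Sum>\<pi> | partition_on A \<pi> \<and> card \<pi> = 0. \<Prod>B\<in>\<pi>. m (card B)) = 0" by (simp only: sum.empty)
      then show ?thesis using 0 cA by simp
    next
      case (Suc i)
      have "(\<Sum>\<pi> | partition_on A \<pi> \<and> card \<pi> = j. \<Prod>B\<in>\<pi>. m (card B)) =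
          (\<Sum>C\<in>Pow A'. m (card (insert x C)) * (\<Sum>\<pi> | partition_on (A' - C) \<pi> \<and> card \<pi> = i. \<Prod>B\<in>\<pi>. m (card B)))"
        unfolding A Suc by (rule sum_partitions_insert) (use fin A in auto)
      also have "\<dots> = (\<Sum>C\<in>Pow A'. m (Suc (card C)) * (fact (?n - card C) * fps_nth (?F ^ i) (?n - card C) / fact i))"
      proof (rule sum.cong[OF refl])
        fix C assume C: "C \<in> Pow A'"
        then have "finite C" "x \<notin> C" using A fin by (auto intro: finite_subset)
        moreover have "card (A' - C) = ?n - card C" using C fin by (simp add: card_Diff_subset calculation(1))
        moreover have "card (A' - C) < card A" using cA fin by (simp add: card_Diff_subset_Int less_Suc_eq_le)
        ultimately show "m (card (insert x C)) * (\<Sum>\<pi> | partition_on (A' - C) \<pi> \<and> card \<pi> = i. \<Prod>B\<in>\<pi>. m (card B)) =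
          m (Suc (card C)) * (fact (?n - card C) * fps_nth (?F ^ i) (?n - card C) / fact i)"
          using less(1)[of "A' - C" i] fin by simp
      qed
      also have "\<dots> = (\<Sum>k\<le>?n. of_nat (?n choose k) * (m (Suc k) * (fact (?n - k) * fps_nth (?F ^ i) (?n - k) / fact i)))"
        using sum_Pow_card[OF fin, of "\<lambda>k. m (Suc k) * (fact (?n - k) * fps_nth (?F ^ i) (?n - k) / fact i)"] .
      also have "\<dots> = (fact ?n / fact i) * (\<Sum>k\<le>?n. fps_nth (fps_deriv ?F) k * fps_nth (?F ^ i) (?n - k))"
        unfolding sum_distrib_left
      proof (rule sum.cong[OF refl], goal_cases)
        case (1 k)
        then have c: "of_nat (?n choose k) = (fact ?n :: real) / (fact k * fact (?n - k))"
          by (simp add: binomial_fact)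
        have d: "fps_nth (fps_deriv ?F) k = m (Suc k) / fact k"
          by (simp add: divide_simps del: of_nat_Suc)
        show ?case
          unfolding c d by simp
      qed
      also have "(\<Sum>k\<le>?n. fps_nth (fps_deriv ?F) k * fps_nth (?F ^ i) (?n - k)) = fps_nth (fps_deriv ?F * ?F ^ i) ?n"
        by (simp only: fps_mult_nth atLeast0AtMost)
      also have "\<dots> = real (Suc ?n) * fps_nth (?F ^ Suc i) (Suc ?n) / real (Suc i)"
      proof -
        have "fps_deriv (?F ^ Suc i) = fps_const (real (Suc i)) * (fps_deriv ?F * ?F ^ i)"
          by (simp only: fps_deriv_power diff_Suc_1 fps_of_nat mult.assoc)
        then have "fps_nth (fps_deriv (?F ^ Suc i)) ?n = real (Suc i) * fps_nth (fps_deriv ?F * ?F ^ i) ?n"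
          by (simp only: fps_mult_left_const_nth)
        moreover have "fps_nth (fps_deriv (?F ^ Suc i)) ?n = real (Suc ?n) * fps_nth (?F ^ Suc i) (Suc ?n)"
          by (simp only: fps_deriv_nth Suc_eq_plus1)
        ultimately show ?thesis
          by (simp only: nonzero_mult_div_cancel_left of_nat_eq_0_iff nat.simps(3) not_False_eq_True)
      qed
      also have "fact ?n / fact i * \<dots> = fact (card A) * fps_nth (?F ^ j) (card A) / fact j"
        unfolding cA Suc fact_Suc of_nat_mult by (simp only: times_divide_times_eq mult_ac)
      finally show ?thesis .
    qed
  qed
qed

text \<open>
  The cumulant of order \<open>n\<close> that belongs to a moment sequence \<open>m\<close>. This is the joint cumulant of \<open>n\<close> copies of
  one random variable with moments \<open>m\<close>.
\<close>
definition partition_cumulant :: "(nat \<Rightarrow> real) \<Rightarrow> nat \<Rightarrow> real" where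
  "partition_cumulant m n =
     (\<Sum>\<pi> | partition_on {1..n} \<pi>. (- 1) ^ (card \<pi> - 1) * fact (card \<pi> - 1) * (\<Prod>B\<in>\<pi>. m (card B)))"

text \<open>
  Cumulants are the coefficients of \<open>log (1 + F)\<close>. Truncating the logarithm at any order \<open>N \<ge> n\<close> does not
  affect the coefficient, as \<open>F\<close> has no constant term.
\<close>
lemma partition_cumulant_eq_fps:
  assumes "n \<ge> 1" "n \<le> N"
  shows "partition_cumulant m n =
    fact n * fps_nth (\<Sum>j=1..N. fps_const ((-1) ^ (j - 1) / real j) * moment_fps m ^ j) n"
proof -
  let ?P = "{\<pi>. partition_on {1..n} \<pi>}"
  have cardP: "card \<pi> \<in> {1..n}" if p: "partition_on {1..n} \<pi>" for \<pi>
  proof -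
    have f: "finite \<pi>" using finite_elements[OF _ p] by simp
    have "\<pi> \<noteq> {}" using p assms by (auto simp: partition_on_def)
    moreover have "card \<pi> \<le> n"
    proof -
      have "n = card (\<Union>\<pi>)" using partition_onD1[OF p] by (metis card_atLeastAtMost diff_Suc_1 )
      also have "\<dots> = (\<Sum>B\<in>\<pi>. card B)"
        using partition_onD1[OF p] partition_onD2[OF p]
        by (intro card_Union_disjoint) (auto simp: disjoint_def pairwise_def disjnt_def intro!: finite_subset[of _ "{Suc 0..n}"])
      also have "\<dots> \<ge> (\<Sum>B\<in>\<pi>. 1)"
      proof (rule sum_mono)
        fix B assume B: "B \<in> \<pi>"
        then have "B \<noteq> {}" using p by (auto simp: partition_on_def)
        have "B \<subseteq> {1..n}" using B partition_onD1[OF p] by auto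
        then have "finite B" by (rule finite_subset) simp
        with \<open>B \<noteq> {}\<close> show "1 \<le> card B" by (simp add: Suc_leI card_gt_0_iff)
      qed
      finally show ?thesis by simp
    qed
    ultimately show ?thesis using f by (simp add: Suc_leI card_gt_0_iff)
  qed
  have "partition_cumulant m n = (\<Sum>j\<in>{1..N}. \<Sum>\<pi> | \<pi> \<in> ?P \<and> card \<pi> = j.
      (- 1) ^ (card \<pi> - 1) * fact (card \<pi> - 1) * (\<Prod>B\<in>\<pi>. m (card B)))"
    unfolding partition_cumulant_def
  proof (rule sum.group[symmetric])
    show "finite ?P" by (rule finitely_many_partition_on) simp
    show "card ` ?P \<subseteq> {1..N}" using cardP assms(2) by fastforce
  qed simp
  also have "\<dots> = (\<Sum>j\<in>{1..N}. (- 1) ^ (j - 1) * fact (j - 1) * (\<Sum>\<pi> | partition_on {1..n} \<pi> \<and> card \<pi> = j. (\<Prod>B\<in>\<pi>. m (card B))))"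
    by (intro sum.cong) (auto simp: sum_distrib_left intro!: sum.cong)
  also have "\<dots> = (\<Sum>j\<in>{1..N}. fact n * ((-1) ^ (j - 1) / real j * fps_nth (moment_fps m ^ j) n))"
  proof (rule sum.cong[OF refl])
    fix j assume "j \<in> {1..N}"
    then have "fact j = (real j * fact (j - 1) :: real)" by (simp add: fact_reduce)
    moreover have "j > 0" using \<open>j \<in> _\<close> by auto
    ultimately show "(- 1) ^ (j - 1) * fact (j - 1) * (\<Sum>\<pi> | partition_on {1..n} \<pi> \<and> card \<pi> = j. (\<Prod>B\<in>\<pi>. m (card B))) = fact n * ((-1) ^ (j - 1) / real j * fps_nth (moment_fps m ^ j) n)"
      by (subst sum_partitions_eq_fps_nth) (auto simp: divide_simps)
  qed
  also have "\<dots> = fact n * fps_nth (\<Sum>j=1..N. fps_const ((-1) ^ (j - 1) / real j) * moment_fps m ^ j) n"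
    by (simp add: sum_distrib_left fps_sum_nth fps_mult_left_const_nth)
  finally show ?thesis .
qed

text \<open>The moments of the normal distribution with mean \<open>0\<close> and variance \<open>v\<close>.\<close>
definition gaussian_moment :: "real \<Rightarrow> nat \<Rightarrow> real" where
  "gaussian_moment v n = (if even n then fact n * (v / 2) ^ (n div 2) / fact (n div 2) else 0)"

lemma gaussian_moment_0 [simp]: "gaussian_moment v 0 = 1"
  by (simp add: gaussian_moment_def)

text \<open>The moment series satisfies \<open>F' = v z (1 + F)\<close>, so that \<open>log (1 + F)\<close> has the derivative \<open>v z\<close>.\<close>
lemma partition_cumulant_gaussian:
  assumes "n \<ge> 1"
  shows "partition_cumulant (gaussian_moment v) n = (if n = 2 then v else 0)"
proof -
  let ?F = "moment_fps (gaussian_moment v)"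
  define C where "C = (\<Sum>j=1..n. fps_const ((-1) ^ (j - 1) / real j) * ?F ^ j)"
  have FX: "fps_deriv ?F = fps_const v * fps_X * (1 + ?F)"
  proof (rule fps_ext)
    fix k
    show "fps_nth (fps_deriv ?F) k = fps_nth (fps_const v * fps_X * (1 + ?F)) k"
    proof (cases k)
      case 0 then show ?thesis by (simp add: gaussian_moment_def mult.assoc)
    next
      case (Suc i)
      have "fps_nth (fps_const v * fps_X * (1 + ?F)) k = v * (gaussian_moment v i / fact i)"
        by (simp add: Suc mult.assoc)
      moreover have "gaussian_moment v (Suc (Suc i)) / fact (Suc i) = v * (gaussian_moment v i / fact i)"
      proof (cases "even i")
        case True
        then obtain l where l: "i = 2 * l" by auto
        have "(fact (Suc (Suc i)) :: real) = real (2 * Suc l) * fact (Suc i)" by (simp add: l)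
        then have "gaussian_moment v (Suc (Suc i)) / fact (Suc i) =
            real (2 * Suc l) * (v / 2) ^ Suc l / fact (Suc l)"
          by (simp add: gaussian_moment_def l del: of_nat_Suc fact_Suc)
        also have "\<dots> = v * ((v / 2) ^ l / fact l)"
          by (simp add: divide_simps)
        also have "\<dots> = v * (gaussian_moment v i / fact i)"
          by (simp add: gaussian_moment_def l)
        finally show ?thesis .
      qed (simp add: gaussian_moment_def)
      moreover have "fps_nth (fps_deriv ?F) k = gaussian_moment v (Suc k) / fact k"
        by (simp add: divide_simps del: of_nat_Suc)
      ultimately show ?thesis by (simp only: Suc)
    qed
  qed
  have dC: "fps_deriv C = fps_deriv ?F * (\<Sum>j<n. (- ?F) ^ j)"
  proof -
    have "fps_deriv C = (\<Sum>j=1..n. fps_const ((-1) ^ (j - 1)) * (fps_deriv ?F * ?F ^ (j - 1)))"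
      unfolding C_def fps_deriv_sum
    proof (rule sum.cong[OF refl])
      fix j assume j: "j \<in> {1..n}"
      have "fps_deriv (fps_const ((-1) ^ (j - 1) / real j) * ?F ^ j) =
        fps_const ((-1) ^ (j - 1) / real j) * (fps_const (real j) * (fps_deriv ?F * ?F ^ (j - 1)))"
        by (simp only: fps_deriv_mult fps_deriv_const fps_deriv_power fps_of_nat mult.assoc mult_zero_left add_0_right)
      also have "\<dots> = fps_const ((-1) ^ (j - 1)) * (fps_deriv ?F * ?F ^ (j - 1))"
        using j by (simp only: mult.assoc[symmetric] fps_const_mult) simp
      finally show "fps_deriv (fps_const ((-1) ^ (j - 1) / real j) * ?F ^ j) = \<dots>" .
    qed
    also have "\<dots> = (\<Sum>j<n. fps_const ((-1) ^ j) * (fps_deriv ?F * ?F ^ j))"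
      by (rule sum.reindex_bij_witness[of _ Suc "\<lambda>j. j - 1"]) auto
    also have "\<dots> = (\<Sum>j<n. fps_deriv ?F * (- ?F) ^ j)"
    proof (rule sum.cong[OF refl])
      fix j
      have "fps_const ((-1::real) ^ j) = (-1) ^ j" by (induction j) (auto simp flip: fps_const_neg)
      then show "fps_const ((-1) ^ j) * (fps_deriv ?F * ?F ^ j) = fps_deriv ?F * (- ?F) ^ j"
        by (simp only: power_minus[of ?F] mult_ac)
    qed
    finally show ?thesis by (simp add: sum_distrib_left)
  qed
  have geo: "(1 + ?F) * (\<Sum>j<n. (- ?F) ^ j) = 1 - (- ?F) ^ n"
    using one_diff_power_eq[of "- ?F" n] by simp
  have dC': "fps_deriv C = fps_const v * fps_X * (1 - (- ?F) ^ n)"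
    unfolding dC FX mult.assoc geo by (simp add: mult.assoc)
  have sub: "fps_nth ((- ?F) ^ n) i = 0" if "i < n" for i
    using that by (intro fps_mult_nth_outside_subdegrees startsby_zero_power_prefix[rule_format]) auto
  have "fps_nth C n = fps_nth (fps_deriv C) (n - 1) / real n"
    using assms by simp
  also have "\<dots> = (if n = 2 then v / 2 else 0)"
    unfolding dC' using assms sub[of "n - 2"] by (auto simp: mult.assoc numeral_2_eq_2)
  finally have "fps_nth C n = (if n = 2 then v / 2 else 0)" .
  moreover have "partition_cumulant (gaussian_moment v) n = fact n * fps_nth C n"
    unfolding C_def by (rule partition_cumulant_eq_fps[OF assms order_refl])
  ultimately show ?thesis by simp
qed

lemma partition_cumulant_1: "partition_cumulant m 1 = m 1"
  by (subst partition_cumulant_eq_fps[of 1 1]) simp_all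

lemma partition_cumulant_2: "partition_cumulant m 2 = m 2 - (m 1)\<^sup>2"
proof -
  let ?F = "moment_fps m"
  have I: "{0..2} = {0,1,2::nat}" and e: "{1..2::nat} = {1,2}" by auto
  have p: "fps_nth (?F ^ 2) 2 = (m 1)\<^sup>2"
    unfolding power2_eq_square fps_mult_nth I by simp
  have "partition_cumulant m 2 = fact 2 *
      fps_nth (\<Sum>j=1..2. fps_const ((-1) ^ (j - 1) / real j) * ?F ^ j) 2"
    by (rule partition_cumulant_eq_fps) auto
  also have "\<dots> = fact 2 * (\<Sum>j\<in>{1,2}. (-1) ^ (j - 1) / real j * fps_nth (?F ^ j) 2)"
    by (simp only: fps_sum_nth e fps_mult_left_const_nth)
  also have "\<dots> = m 2 - (m 1)\<^sup>2"
    using p by simp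
  finally show ?thesis .
qed

lemma partition_cumulant_4:
  assumes "m 1 = 0"
  shows "partition_cumulant m 4 = m 4 - 3 * (m 2)\<^sup>2"
proof -
  let ?F = "moment_fps m"
  have F: "fps_nth ?F 0 = 0" "fps_nth ?F 1 = 0" "fps_nth ?F (Suc 0) = 0" using assms by auto
  have S: "fps_nth (f * g) 4 = fps_nth f 0 * fps_nth g 4 + fps_nth f 1 * fps_nth g 3 + fps_nth f 2 * fps_nth g 2
     + fps_nth f 3 * fps_nth g 1 + fps_nth f 4 * fps_nth g 0"
    "fps_nth (f * g) 2 = fps_nth f 0 * fps_nth g 2 + fps_nth f 1 * fps_nth g 1 + fps_nth f 2 * fps_nth g 0"
    "fps_nth (f * g) 1 = fps_nth f 0 * fps_nth g 1 + fps_nth f 1 * fps_nth g 0"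
    "fps_nth (f * g) 0 = fps_nth f 0 * fps_nth g 0" for f g :: "real fps"
  proof -
    have I: "{0..4} = {0,1,2,3,4::nat}" "{0..2} = {0,1,2::nat}" "{0..1} = {0,1::nat}" by auto
    show "fps_nth (f * g) 4 = fps_nth f 0 * fps_nth g 4 + fps_nth f 1 * fps_nth g 3 + fps_nth f 2 * fps_nth g 2
     + fps_nth f 3 * fps_nth g 1 + fps_nth f 4 * fps_nth g 0"
    "fps_nth (f * g) 2 = fps_nth f 0 * fps_nth g 2 + fps_nth f 1 * fps_nth g 1 + fps_nth f 2 * fps_nth g 0"
    "fps_nth (f * g) 1 = fps_nth f 0 * fps_nth g 1 + fps_nth f 1 * fps_nth g 0"
    "fps_nth (f * g) 0 = fps_nth f 0 * fps_nth g 0"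
      unfolding fps_mult_nth I by simp_all
  qed
  have p: "fps_nth (?F ^ 2) 4 = (m 2 / 2)\<^sup>2" "fps_nth (?F ^ 3) 4 = 0" "fps_nth (?F ^ 4) 4 = 0"
    unfolding power2_eq_square power3_eq_cube power4_eq_xxxx S F by (simp_all add: power2_eq_square)
  have e: "{1..4::nat} = {1,2,3,4}" by auto
  have "partition_cumulant m 4 = fact 4 *
      fps_nth (\<Sum>j=1..4. fps_const ((-1) ^ (j - 1) / real j) * ?F ^ j) 4"
    by (rule partition_cumulant_eq_fps) auto
  also have "\<dots> = fact 4 * (\<Sum>j\<in>{1,2,3,4}. (-1) ^ (j - 1) / real j * fps_nth (?F ^ j) 4)"
    by (simp only: fps_sum_nth e fps_mult_left_const_nth)
  also have "\<dots> = fact 4 * (fps_nth ?F 4 - (m 2 / 2)\<^sup>2 / 2)"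
    using p by simp
  also have "\<dots> = m 4 - 3 * (m 2)\<^sup>2"
    by (simp add: fact_numeral power2_eq_square)
  finally show ?thesis .
qed

section \<open>Products over frequencies with sum zero\<close>

text \<open>A point \<open>l\<close> of \<^term>\<open>freq_space k\<close> extended by a frequency at \<open>k\<close> so that the sum over \<open>{1..k}\<close> is zero.\<close>
definition last_freq :: "nat \<Rightarrow> (nat \<Rightarrow> real ^ 'd) \<Rightarrow> nat \<Rightarrow> real ^ 'd" where
  "last_freq k l j = (if j < k then l j else - (\<Sum>i\<in>{1..<k}. l i))"

interpretation freq: product_sigma_finite "\<lambda>j::nat. lborel :: (real ^ 'd) measure"
  by standard

lemma measurable_freq_component:
  "j \<in> {1..<k} \<Longrightarrow> (\<lambda>l. l j) \<in> borel_measurable (freq_space k :: (nat \<Rightarrow> real ^ 'd) measure)"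
  unfolding freq_space_def using measurable_component_singleton[of j "{1..<k}" "\<lambda>_. lborel :: (real ^ 'd) measure"] by simp

lemma measurable_last_freq:
  "j \<in> {1..k} \<Longrightarrow> (\<lambda>l. last_freq k l j) \<in> borel_measurable (freq_space k :: (nat \<Rightarrow> real ^ 'd) measure)"
  by (cases "j < k") (auto simp: last_freq_def intro!: borel_measurable_sum borel_measurable_uminus measurable_freq_component)

lemma nn_integral_reflect_shift:
  fixes H :: "'a::euclidean_space \<Rightarrow> ennreal"
  assumes [measurable]: "H \<in> borel_measurable borel"
  shows "(\<integral>\<^sup>+y. H (- (y + c)) \<partial>lborel) = (\<integral>\<^sup>+y. H y \<partial>lborel)"
proof -
  have "(lborel :: 'a measure) = distr lborel borel (\<lambda>y. - c + (- 1) *\<^sub>R y)"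
    using lborel_affine[of "- 1" "- c"] by (simp add: density_1)
  then have "(\<integral>\<^sup>+y. H y \<partial>lborel) = (\<integral>\<^sup>+y. H y \<partial>(distr lborel borel (\<lambda>y. - c + (- 1) *\<^sub>R y)))"
    by (rule arg_cong)
  also have "\<dots> = (\<integral>\<^sup>+y. H (- (y + c)) \<partial>lborel)"
    by (subst nn_integral_distr) (auto simp: algebra_simps)
  finally show ?thesis ..
qed

text \<open>
  Any \<open>k - 1\<close> of the \<open>k\<close> frequencies serve as coordinates: exchanging the coordinate \<open>i\<close> for the
  dependent frequency is a reflection followed by a translation.
\<close>
lemma nn_integral_freq_omit:
  fixes H :: "real ^ 'd \<Rightarrow> ennreal"
  assumes [measurable]: "H \<in> borel_measurable borel" and "k \<ge> 1" "i \<in> {1..k}"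
  shows "(\<integral>\<^sup>+l. (\<Prod>j\<in>{1..k} - {i}. H (last_freq k l j)) \<partial>freq_space k) = (\<integral>\<^sup>+x. H x \<partial>lborel) ^ (k - 1)"
proof (cases "i = k")
  case True
  have "{1..k} - {k} = {1..<k}" by auto
  then have "(\<integral>\<^sup>+l. (\<Prod>j\<in>{1..k} - {i}. H (last_freq k l j)) \<partial>freq_space k) =
      (\<integral>\<^sup>+l. (\<Prod>j\<in>{1..<k}. H (l j)) \<partial>freq_space k)"
    using True by (simp add: last_freq_def)
  also have "\<dots> = (\<Prod>j\<in>{1..<k}. \<integral>\<^sup>+x. H x \<partial>lborel)"
    unfolding freq_space_def by (rule freq.product_nn_integral_prod) auto
  finally show ?thesis by simp
next
  case False
  define J where "J = {1..<k} - {i}"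
  have J: "finite J" "i \<notin> J" "insert i J = {1..<k}" "{1..k} - {i} = insert k J" "k \<notin> J" "card J = k - 2"
    using assms False by (auto simp: J_def)
  have m: "(\<lambda>l. \<Prod>j\<in>{1..k} - {i}. H (last_freq k l j)) \<in> borel_measurable (freq_space k)"
    by (intro borel_measurable_prod_ennreal measurable_compose[OF measurable_last_freq assms(1)]) auto
  have "(\<integral>\<^sup>+l. (\<Prod>j\<in>{1..k} - {i}. H (last_freq k l j)) \<partial>freq_space k) =
      (\<integral>\<^sup>+x. (\<integral>\<^sup>+y. (\<Prod>j\<in>{1..k} - {i}. H (last_freq k (x(i := y)) j)) \<partial>lborel) \<partial>(\<Pi>\<^sub>M j\<in>J. lborel))"
    using m freq.product_nn_integral_insert[OF J(1,2), of "\<lambda>l. \<Prod>j\<in>{1..k} - {i}. H (last_freq k l j)"]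
    unfolding freq_space_def J(3) by blast
  also have "\<dots> = (\<integral>\<^sup>+x. (\<Prod>j\<in>J. H (x j)) * (\<integral>\<^sup>+y. H y \<partial>lborel) \<partial>(\<Pi>\<^sub>M j\<in>J. lborel))"
  proof (rule nn_integral_cong)
    fix x :: "nat \<Rightarrow> real ^ 'd"
    have "(\<Prod>j\<in>{1..k} - {i}. H (last_freq k (x(i := y)) j)) = (\<Prod>j\<in>J. H (x j)) * H (- (y + (\<Sum>j\<in>J. x j)))" for y
    proof -
      have "(\<Prod>j\<in>J. H (last_freq k (x(i := y)) j)) = (\<Prod>j\<in>J. H (x j))"
        by (intro prod.cong) (auto simp: J_def last_freq_def)
      moreover have "last_freq k (x(i := y)) k = - (y + (\<Sum>j\<in>J. x j))"
        unfolding last_freq_def J(3)[symmetric] using J(1,2) by (auto intro!: sum.cong)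
      ultimately show ?thesis unfolding J(4) using J by (simp add: mult.commute)
    qed
    moreover have "(\<lambda>y. H (- (y + c))) \<in> borel_measurable lborel" for c by measurable
    ultimately show "(\<integral>\<^sup>+y. (\<Prod>j\<in>{1..k} - {i}. H (last_freq k (x(i := y)) j)) \<partial>lborel) =
        (\<Prod>j\<in>J. H (x j)) * (\<integral>\<^sup>+y. H y \<partial>lborel)"
      by (simp only: nn_integral_cmult nn_integral_reflect_shift[OF assms(1)])
  qed
  also have "\<dots> = (\<integral>\<^sup>+x. (\<Prod>j\<in>J. H (x j)) \<partial>(\<Pi>\<^sub>M j\<in>J. lborel)) * (\<integral>\<^sup>+y. H y \<partial>lborel)"
    by (intro nn_integral_multc borel_measurable_prod_ennreal)
      (auto intro!: measurable_compose[OF measurable_component_singleton])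
  also have "(\<integral>\<^sup>+x. (\<Prod>j\<in>J. H (x j)) \<partial>(\<Pi>\<^sub>M j\<in>J. lborel)) = (\<Prod>j\<in>J. \<integral>\<^sup>+x. H x \<partial>lborel)"
    by (rule freq.product_nn_integral_prod) (auto simp: J)
  also have "\<dots> * (\<integral>\<^sup>+y. H y \<partial>lborel) = (\<integral>\<^sup>+x. H x \<partial>lborel) ^ (k - 1)"
  proof -
    have "k - 1 = Suc (k - 2)" using assms False by auto
    then show ?thesis by (simp add: J mult.commute)
  qed
  finally show ?thesis .
qed

text \<open>
  Each factor \<open>a j\<close> occurs in all but one of the products on the right, so the left-hand side is
  their geometric mean.
\<close>
lemma prod_powr_le_mean:
  fixes a :: "'i \<Rightarrow> real"
  assumes "finite I" "I \<noteq> {}" "\<And>i. i \<in> I \<Longrightarrow> 0 \<le> a i" "s > 0"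
  shows "(\<Prod>i\<in>I. a i) powr (s * (real (card I) - 1) / real (card I)) \<le>
    (\<Sum>i\<in>I. \<Prod>j\<in>I - {i}. a j powr s) / real (card I)"
proof -
  let ?n = "card I"
  have n: "?n > 0" using assms by (simp add: card_gt_0_iff)
  have "(\<Prod>i\<in>I. \<Prod>j\<in>I - {i}. a j powr s) = (\<Prod>i\<in>I. \<Prod>j\<in>{j\<in>I. j \<noteq> i}. a j powr s)"
    by (intro prod.cong) auto
  also have "\<dots> = (\<Prod>j\<in>I. \<Prod>i\<in>{i\<in>I. j \<noteq> i}. a j powr s)"
    using assms by (intro prod.swap_restrict) auto
  also have "\<dots> = (\<Prod>j\<in>I. (a j powr s) ^ (?n - 1))"
  proof (rule prod.cong[OF refl])
    fix j assume "j \<in> I"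
    moreover have "{i\<in>I. j \<noteq> i} = I - {j}" by auto
    ultimately show "(\<Prod>i\<in>{i\<in>I. j \<noteq> i}. a j powr s) = (a j powr s) ^ (?n - 1)" using assms by simp
  qed
  also have "\<dots> = ((\<Prod>j\<in>I. a j) powr s) ^ (?n - 1)"
    using assms by (simp add: prod_power_distrib prod_powr_distrib)
  finally have e: "(\<Prod>i\<in>I. \<Prod>j\<in>I - {i}. a j powr s) = ((\<Prod>j\<in>I. a j) powr s) ^ (?n - 1)" .
  have p0: "(\<Prod>j\<in>I. a j) \<ge> 0" using assms by (simp add: prod_nonneg)
  show ?thesis
  proof (cases "(\<Prod>j\<in>I. a j) = 0")
    case True
    then show ?thesis by (simp only: True powr_zero_eq_one powr_0) (auto intro!: divide_nonneg_nonneg sum_nonneg prod_nonneg)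
  next
    case False
    then have pp: "(\<Prod>j\<in>I. a j) > 0" using p0 by simp
    have "((\<Prod>j\<in>I. a j) powr s) ^ (?n - 1) = (\<Prod>j\<in>I. a j) powr (s * (real ?n - 1))"
      using n pp by (simp add: powr_powr of_nat_diff flip: powr_realpow)
    then have "(\<Prod>i\<in>I. a i) powr (s * (real ?n - 1) / real ?n) =
        (\<Prod>i\<in>I. \<Prod>j\<in>I - {i}. a j powr s) powr (1 / real ?n)"
      using n pp by (simp add: e powr_powr)
    also have "\<dots> \<le> (\<Sum>i\<in>I. (\<Prod>j\<in>I - {i}. a j powr s) / real ?n)"
      by (rule arith_geom_mean) (use assms in \<open>auto intro!: prod_nonneg\<close>)
    finally show ?thesis by (simp add: sum_divide_distrib)
  qed
qed

text \<open>
  An inequality of Brascamp-Lieb type. In this symmetric case it follows from the inequality of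
  arithmetic and geometric means, since each product of \<open>k - 1\<close> factors has a product integral.
\<close>
lemma nn_integral_freq_prod_le:
  fixes h :: "real ^ 'd \<Rightarrow> real"
  assumes [measurable]: "h \<in> borel_measurable borel" and h: "\<And>x. 0 \<le> h x" and "k \<ge> 1" "s > 0"
  shows "(\<integral>\<^sup>+l. ennreal ((\<Prod>j\<in>{1..k}. h (last_freq k l j)) powr (s * (real k - 1) / real k)) \<partial>freq_space k)
    \<le> (\<integral>\<^sup>+x. ennreal (h x powr s) \<partial>lborel) ^ (k - 1)"
proof -
  let ?H = "\<lambda>x. ennreal (h x powr s)"
  have mH: "?H \<in> borel_measurable borel" by measurable
  have "(\<integral>\<^sup>+l. ennreal ((\<Prod>j\<in>{1..k}. h (last_freq k l j)) powr (s * (real k - 1) / real k)) \<partial>freq_space k)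
    \<le> (\<integral>\<^sup>+l. (\<Sum>i\<in>{1..k}. ennreal (1 / real k) * (\<Prod>j\<in>{1..k} - {i}. ?H (last_freq k l j))) \<partial>freq_space k)"
  proof (rule nn_integral_mono)
    fix l :: "nat \<Rightarrow> real ^ 'd"
    have "(\<Prod>j\<in>{1..k}. h (last_freq k l j)) powr (s * (real k - 1) / real k) \<le>
        (\<Sum>i\<in>{1..k}. \<Prod>j\<in>{1..k} - {i}. h (last_freq k l j) powr s) / real k"
      using prod_powr_le_mean[of "{1..k}" "\<lambda>j. h (last_freq k l j)" s] assms by simp
    also have "\<dots> = (\<Sum>i\<in>{1..k}. 1 / real k * (\<Prod>j\<in>{1..k} - {i}. h (last_freq k l j) powr s))"
      by (simp add: sum_divide_distrib)
    finally have "ennreal ((\<Prod>j\<in>{1..k}. h (last_freq k l j)) powr (s * (real k - 1) / real k)) \<le>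
       ennreal (\<Sum>i\<in>{1..k}. 1 / real k * (\<Prod>j\<in>{1..k} - {i}. h (last_freq k l j) powr s))"
      by (rule ennreal_leI)
    then show "ennreal ((\<Prod>j\<in>{1..k}. h (last_freq k l j)) powr (s * (real k - 1) / real k)) \<le>
      (\<Sum>i\<in>{1..k}. ennreal (1 / real k) * (\<Prod>j\<in>{1..k} - {i}. ?H (last_freq k l j)))"
      by (simp add: ennreal_mult'[symmetric] prod_ennreal prod_nonneg sum_nonneg sum_ennreal del: times_divide_eq_left times_divide_eq_right)
  qed
  also have "\<dots> = (\<Sum>i\<in>{1..k}. ennreal (1 / real k) * (\<integral>\<^sup>+l. (\<Prod>j\<in>{1..k} - {i}. ?H (last_freq k l j)) \<partial>freq_space k))"
  proof -
    have m: "(\<lambda>l. \<Prod>j\<in>{1..k} - {i}. ?H (last_freq k l j)) \<in> borel_measurable (freq_space k)" for i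
      by (intro borel_measurable_prod_ennreal measurable_compose[OF measurable_last_freq mH]) auto
    then show ?thesis
      by (subst nn_integral_sum) (simp_all only: nn_integral_cmult m borel_measurable_times_ennreal borel_measurable_const)
  qed
  also have "\<dots> = (\<Sum>i\<in>{1..k}. ennreal (1 / real k) * (\<integral>\<^sup>+x. ?H x \<partial>lborel) ^ (k - 1))"
    by (intro sum.cong refl arg_cong2[where f = "(*)"] nn_integral_freq_omit) (use mH assms in auto)
  also have "\<dots> = (\<integral>\<^sup>+x. ?H x \<partial>lborel) ^ (k - 1)"
  proof -
    have "(\<Sum>i\<in>{1..k}. ennreal (1 / real k)) = 1"
      using \<open>k \<ge> 1\<close> by (subst sum_ennreal) auto
    then show ?thesis by (simp only: sum_distrib_right[symmetric] mult_1)
  qed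
  finally show ?thesis .
qed

lemma mult_le_powr_add:
  fixes a b p q \<eta> :: real
  assumes "p > 1" "q > 1" "1/p + 1/q = 1" "a \<ge> 0" "b \<ge> 0" "\<eta> > 0"
  shows "a * b \<le> \<eta> powr - p * a powr p + \<eta> powr q * b powr q"
proof -
  have "a * b = (a / \<eta>) * (\<eta> * b)" using assms by simp
  also have "\<dots> \<le> (a / \<eta>) powr p / p + (\<eta> * b) powr q / q"
    by (rule Youngs_inequality) (use assms in auto)
  also have "\<dots> \<le> (a / \<eta>) powr p + (\<eta> * b) powr q"
    using divide_left_mono[of 1 p "(a / \<eta>) powr p"] divide_left_mono[of 1 q "(\<eta> * b) powr q"] assms
    by (intro add_mono) simp_all
  also have "(a / \<eta>) powr p = \<eta> powr - p * a powr p"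
    using assms by (simp add: powr_divide powr_minus_divide)
  also have "(\<eta> * b) powr q = \<eta> powr q * b powr q"
    using assms by (simp add: powr_mult)
  finally show ?thesis .
qed

text \<open>Young's inequality with a free scale \<open>\<eta>\<close>.\<close>
lemma nn_integral_mult_bound:
  fixes f g :: "'a \<Rightarrow> real"
  assumes [measurable]: "f \<in> borel_measurable M" "g \<in> borel_measurable M"
    and "\<And>x. 0 \<le> f x" "\<And>x. 0 \<le> g x"
    and pq: "p > 1" "q > 1" "1/p + 1/q = 1" and "\<eta> > 0"
  shows "(\<integral>\<^sup>+x. ennreal (f x * g x) \<partial>M) \<le> ennreal (\<eta> powr - p) * (\<integral>\<^sup>+x. ennreal (f x powr p) \<partial>M)
     + ennreal (\<eta> powr q) * (\<integral>\<^sup>+x. ennreal (g x powr q) \<partial>M)"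
proof -
  have "(\<integral>\<^sup>+x. ennreal (f x * g x) \<partial>M) \<le>
     (\<integral>\<^sup>+x. ennreal (\<eta> powr - p) * ennreal (f x powr p) + ennreal (\<eta> powr q) * ennreal (g x powr q) \<partial>M)"
    using mult_le_powr_add[OF pq assms(3,4) \<open>\<eta> > 0\<close>]
    by (intro nn_integral_mono) (simp add: ennreal_mult'[symmetric] flip: ennreal_plus)
  also have "\<dots> = ennreal (\<eta> powr - p) * (\<integral>\<^sup>+x. ennreal (f x powr p) \<partial>M)
     + ennreal (\<eta> powr q) * (\<integral>\<^sup>+x. ennreal (g x powr q) \<partial>M)"
    by (simp add: nn_integral_add nn_integral_cmult)
  finally show ?thesis .
qed

text \<open>
  If \<open>f\<close> is in \<open>L\<^sup>p\<close>, and \<open>g t\<close> is bounded in the dual space \<open>L\<^sup>q\<close> and tends to \<open>0\<close> in some \<open>L\<^sup>r\<close> with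
  \<open>r < q\<close> (called \<open>q'\<close> below), then the integral of \<open>f g t\<close> tends to \<open>0\<close>. There is no finiteness assumption on
  the measure, hence no inclusion between these spaces: \<open>f\<close> is split into its large values, of small
  \<open>L\<^sup>p\<close> norm, and its bounded values, which lie in \<open>L\<^sup>p\<close> and therefore in every \<open>L\<close> space of
  larger exponent, in particular in the dual of \<open>L\<^sup>r\<close>.
\<close>
lemma nn_integral_mult_tendsto_0:
  fixes f :: "'a \<Rightarrow> real" and g :: "'b \<Rightarrow> 'a \<Rightarrow> real"
  assumes [measurable]: "f \<in> borel_measurable M" "\<And>t. g t \<in> borel_measurable M"
    and f0: "\<And>x. 0 \<le> f x" and g0: "\<And>t x. 0 \<le> g t x"
    and pq: "p > 1" "q > 1" "1/p + 1/q = 1"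
    and pq': "p' > 1" "q' > 1" "1/p' + 1/q' = 1" "q' < q"
    and fp: "integrable M (\<lambda>x. f x powr p)"
    and gq: "eventually (\<lambda>t. (\<integral>\<^sup>+x. ennreal (g t x powr q) \<partial>M) \<le> ennreal B) F"
    and gq': "((\<lambda>t. \<integral>\<^sup>+x. ennreal (g t x powr q') \<partial>M) \<longlongrightarrow> 0) F"
  shows "((\<lambda>t. \<integral>\<^sup>+x. ennreal (f x * g t x) \<partial>M) \<longlongrightarrow> 0) F"
proof (rule order_tendstoI)
  fix e :: ennreal assume "0 < e"
  then obtain \<epsilon> where e: "0 < \<epsilon>" "ennreal \<epsilon> < e"
  proof -
    obtain e' where e': "0 < e'" "e' < e" using dense[OF \<open>0 < e\<close>] by blast
    then have "e' \<noteq> top" by auto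
    then show ?thesis using e' that[of "enn2real e'"] by (cases e') (auto simp: ennreal_less_zero_iff)
  qed
  have pp': "p < p'"
  proof -
    have "1 / p' < 1 / p" using pq(3) pq'(3,4) pq(2) pq'(2) frac_less2[of 1 1 q' q] by simp
    then show ?thesis using pq pq' by (simp add: field_simps)
  qed
  define B' where "B' = max B 0"
  \<comment> \<open>Young scale for the large values: it makes the term with the bounded norms of \<open>g t\<close> small.\<close>
  define \<eta> where "\<eta> = (\<epsilon> / (4 * (B' + 1))) powr (1 / q)"
  have "B' \<ge> 0" by (simp add: B'_def)
  then have \<eta>: "\<eta> > 0" "\<eta> powr q * B' \<le> \<epsilon> / 4"
  proof -
    show "\<eta> > 0" using e \<open>B' \<ge> 0\<close> by (simp add: \<eta>_def)
    have "\<eta> powr q = \<epsilon> / (4 * (B' + 1))" using e \<open>B' \<ge> 0\<close> pq by (simp add: \<eta>_def powr_powr)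
    moreover have "\<epsilon> / (4 * (B' + 1)) * B' \<le> \<epsilon> / 4" using e \<open>B' \<ge> 0\<close> by (simp add: field_simps)
    ultimately show "\<eta> powr q * B' \<le> \<epsilon> / 4" by simp
  qed
  \<comment> \<open>The part of \<open>f\<close> with values above \<open>n\<close>; the level is chosen by dominated convergence.\<close>
  let ?I = "\<lambda>n x. f x * indicator {x. f x > real n} x"
  have "(\<lambda>n. \<integral>x. ?I n x powr p \<partial>M) \<longlonglongrightarrow> (\<integral>x. 0 \<partial>M)"
  proof (rule integral_dominated_convergence[where w = "\<lambda>x. f x powr p"])
    show "AE x in M. (\<lambda>n. ?I n x powr p) \<longlonglongrightarrow> 0"
    proof (rule AE_I2)
      fix x
      obtain N where "f x < real N" using reals_Archimedean2 by blast
      then have "eventually (\<lambda>n. ?I n x powr p = 0) sequentially"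
        unfolding eventually_sequentially by (intro exI[of _ N]) auto
      then show "(\<lambda>n. ?I n x powr p) \<longlonglongrightarrow> 0" by (rule tendsto_eventually)
    qed
    show "AE x in M. norm (?I n x powr p) \<le> f x powr p" for n
      by (auto simp: indicator_def)
  qed (use fp in auto)
  then have "eventually (\<lambda>n. (\<integral>x. ?I n x powr p \<partial>M) < \<epsilon> / 4 / \<eta> powr - p) sequentially"
    using e \<eta> by (intro order_tendstoD) auto
  then obtain n where n: "(\<integral>x. ?I n x powr p \<partial>M) < \<epsilon> / 4 / \<eta> powr - p"
    by (auto simp: eventually_sequentially)
  have "integrable M (\<lambda>x. ?I n x powr p)"
    by (rule Bochner_Integration.integrable_bound[OF fp]) (auto simp: indicator_def)
  then have nI: "(\<integral>\<^sup>+x. ennreal (?I n x powr p) \<partial>M) = ennreal (\<integral>x. ?I n x powr p \<partial>M)"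
    by (rule nn_integral_eq_integral) auto
  let ?f = "\<lambda>x. f x * indicator {x. f x \<le> real n} x"
  define C where "C = real n powr (p' - p) * (\<integral>x. f x powr p \<partial>M)"
  have C0: "C \<ge> 0" by (simp add: C_def)
  have fC: "(\<integral>\<^sup>+x. ennreal (?f x powr p') \<partial>M) \<le> ennreal C"
  proof -
    have "(\<integral>\<^sup>+x. ennreal (?f x powr p') \<partial>M) \<le> (\<integral>\<^sup>+x. ennreal (real n powr (p' - p) * f x powr p) \<partial>M)"
    proof (intro nn_integral_mono ennreal_leI)
      fix x
      show "?f x powr p' \<le> real n powr (p' - p) * f x powr p"
      proof (cases "f x \<le> real n")
        case True
        have "f x powr p' = f x powr (p' - p) * f x powr p"
          by (simp flip: powr_add)
        also have "\<dots> \<le> real n powr (p' - p) * f x powr p"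
          using True f0[of x] pp' by (intro mult_right_mono powr_mono2) auto
        finally show ?thesis using True by simp
      qed simp
    qed
    also have "\<dots> = ennreal C"
      unfolding C_def using fp by (subst nn_integral_eq_integral) auto
    finally show ?thesis .
  qed
  \<comment> \<open>Young scale for the bounded values: it makes the term with \<open>f\<close> small, and the other term vanishes in the limit.\<close>
  define \<theta> where "\<theta> = ((C + 1) * 4 / \<epsilon>) powr (1 / p')"
  have \<theta>: "\<theta> > 0" "\<theta> powr - p' * C \<le> \<epsilon> / 4"
  proof -
    show "\<theta> > 0" using e C0 by (simp add: \<theta>_def)
    have "\<theta> powr - p' = \<epsilon> / ((C + 1) * 4)" using e C0 pq' by (simp add: \<theta>_def powr_powr powr_minus_divide)
    moreover have "\<epsilon> / ((C + 1) * 4) * C \<le> \<epsilon> / 4" using e C0 by (simp add: field_simps)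
    ultimately show "\<theta> powr - p' * C \<le> \<epsilon> / 4" by simp
  qed
  have "eventually (\<lambda>t. (\<integral>\<^sup>+x. ennreal (g t x powr q') \<partial>M) < ennreal (\<epsilon> / 4 / \<theta> powr q')) F"
    using e \<theta> by (intro order_tendstoD(2)[OF gq']) auto
  with gq show "eventually (\<lambda>t. (\<integral>\<^sup>+x. ennreal (f x * g t x) \<partial>M) < e) F"
  proof eventually_elim
    fix t assume t: "(\<integral>\<^sup>+x. ennreal (g t x powr q) \<partial>M) \<le> ennreal B"
      "(\<integral>\<^sup>+x. ennreal (g t x powr q') \<partial>M) < ennreal (\<epsilon> / 4 / \<theta> powr q')"
    have "(\<integral>\<^sup>+x. ennreal (f x * g t x) \<partial>M) = (\<integral>\<^sup>+x. ennreal (?I n x * g t x) + ennreal (?f x * g t x) \<partial>M)"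
      using f0 g0 by (intro nn_integral_cong) (auto simp: indicator_def simp flip: ennreal_plus)
    also have "\<dots> = (\<integral>\<^sup>+x. ennreal (?I n x * g t x) \<partial>M) + (\<integral>\<^sup>+x. ennreal (?f x * g t x) \<partial>M)"
      by (rule nn_integral_add) measurable
    also have "\<dots> \<le> (ennreal (\<epsilon> / 4) + ennreal (\<epsilon> / 4)) + (ennreal (\<epsilon> / 4) + ennreal (\<epsilon> / 4))"
    proof (rule add_mono)
      have "(\<integral>\<^sup>+x. ennreal (?I n x * g t x) \<partial>M) \<le> ennreal (\<eta> powr - p) * (\<integral>\<^sup>+x. ennreal (?I n x powr p) \<partial>M)
        + ennreal (\<eta> powr q) * (\<integral>\<^sup>+x. ennreal (g t x powr q) \<partial>M)"
        by (rule nn_integral_mult_bound) (use f0 g0 pq \<eta> in auto)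
      also have "\<dots> \<le> ennreal (\<epsilon> / 4) + ennreal (\<epsilon> / 4)"
      proof (rule add_mono)
        have "\<eta> powr - p * (\<integral>x. ?I n x powr p \<partial>M) \<le> \<epsilon> / 4"
          using n \<eta>(1) by (simp add: pos_less_divide_eq mult.commute)
        then show "ennreal (\<eta> powr - p) * (\<integral>\<^sup>+x. ennreal (?I n x powr p) \<partial>M) \<le> ennreal (\<epsilon> / 4)"
          unfolding nI by (simp flip: ennreal_mult' add: ennreal_leI)
        have "ennreal (\<eta> powr q) * (\<integral>\<^sup>+x. ennreal (g t x powr q) \<partial>M) \<le> ennreal (\<eta> powr q) * ennreal B'"
          using t(1) by (intro mult_left_mono order_trans[OF t(1)] ennreal_leI) (auto simp: B'_def)
        also have "\<dots> \<le> ennreal (\<epsilon> / 4)" using \<eta>(2) by (simp flip: ennreal_mult' add: ennreal_leI)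
        finally show "ennreal (\<eta> powr q) * (\<integral>\<^sup>+x. ennreal (g t x powr q) \<partial>M) \<le> ennreal (\<epsilon> / 4)" .
      qed
      finally show "(\<integral>\<^sup>+x. ennreal (?I n x * g t x) \<partial>M) \<le> ennreal (\<epsilon> / 4) + ennreal (\<epsilon> / 4)" .
      have "(\<integral>\<^sup>+x. ennreal (?f x * g t x) \<partial>M) \<le> ennreal (\<theta> powr - p') * (\<integral>\<^sup>+x. ennreal (?f x powr p') \<partial>M)
        + ennreal (\<theta> powr q') * (\<integral>\<^sup>+x. ennreal (g t x powr q') \<partial>M)"
        by (rule nn_integral_mult_bound) (use f0 g0 pq' \<theta> in auto)
      also have "\<dots> \<le> ennreal (\<epsilon> / 4) + ennreal (\<epsilon> / 4)"
      proof (rule add_mono)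
        have "ennreal (\<theta> powr - p') * (\<integral>\<^sup>+x. ennreal (?f x powr p') \<partial>M) \<le> ennreal (\<theta> powr - p') * ennreal C"
          by (intro mult_left_mono fC) auto
        also have "\<dots> \<le> ennreal (\<epsilon> / 4)" using \<theta>(2) by (simp flip: ennreal_mult' add: ennreal_leI)
        finally show "ennreal (\<theta> powr - p') * (\<integral>\<^sup>+x. ennreal (?f x powr p') \<partial>M) \<le> ennreal (\<epsilon> / 4)" .
        have "ennreal (\<theta> powr q') * (\<integral>\<^sup>+x. ennreal (g t x powr q') \<partial>M) \<le> ennreal (\<theta> powr q') * ennreal (\<epsilon> / 4 / \<theta> powr q')"
          using t(2) by (intro mult_left_mono) auto
        also have "\<dots> = ennreal (\<epsilon> / 4)" using \<theta>(1) by (simp flip: ennreal_mult')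
        finally show "ennreal (\<theta> powr q') * (\<integral>\<^sup>+x. ennreal (g t x powr q') \<partial>M) \<le> ennreal (\<epsilon> / 4)" .
      qed
      finally show "(\<integral>\<^sup>+x. ennreal (?f x * g t x) \<partial>M) \<le> ennreal (\<epsilon> / 4) + ennreal (\<epsilon> / 4)" .
    qed
    also have "\<dots> = ennreal \<epsilon>" using e by (simp flip: ennreal_plus)
    also note e(2)
    finally show "(\<integral>\<^sup>+x. ennreal (f x * g t x) \<partial>M) < e" .
  qed
qed simp

section \<open>Linear functionals of a stationary random field\<close>

lemma prod_le_sum_power:
  fixes a :: "'i \<Rightarrow> real"
  assumes "finite I" "I \<noteq> {}" "\<And>i. i \<in> I \<Longrightarrow> 0 \<le> a i"
  shows "(\<Prod>i\<in>I. a i) \<le> (\<Sum>i\<in>I. a i ^ card I)"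
proof -
  have "Max (a ` I) \<in> a ` I" using assms by (intro Max_in) auto
  then obtain m where m: "m \<in> I" "Max (a ` I) = a m" by auto
  have "(\<Prod>i\<in>I. a i) \<le> (\<Prod>i\<in>I. a m)"
    using assms m Max_ge[of "a ` I"] by (intro prod_mono) auto
  also have "\<dots> = a m ^ card I" by simp
  also have "\<dots> \<le> (\<Sum>i\<in>I. a i ^ card I)"
    by (rule member_le_sum) (use m assms in auto)
  finally show ?thesis .
qed

text \<open>The definite description picks the block that contains \<open>i\<close>.\<close>
lemma prod_partition_on:
  fixes g :: "'i \<Rightarrow> 'i set \<Rightarrow> 'b::comm_monoid_mult"
  assumes "finite I" "partition_on I \<pi>"
  shows "(\<Prod>i\<in>I. g i (THE B. B \<in> \<pi> \<and> i \<in> B)) = (\<Prod>B\<in>\<pi>. \<Prod>i\<in>B. g i B)"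
proof -
  have U: "I = \<Union>\<pi>" and d: "disjoint \<pi>" using assms(2) by (auto simp: partition_on_def)
  have fin: "finite B" if "B \<in> \<pi>" for B using that U assms(1) by (auto intro: finite_subset)
  have "(\<Prod>i\<in>I. g i (THE B. B \<in> \<pi> \<and> i \<in> B)) = (\<Prod>B\<in>\<pi>. \<Prod>i\<in>B. g i (THE B. B \<in> \<pi> \<and> i \<in> B))"
    unfolding U using d fin by (subst prod.Union_disjoint) (auto simp: disjoint_def)
  also have "\<dots> = (\<Prod>B\<in>\<pi>. \<Prod>i\<in>B. g i B)"
  proof (intro prod.cong refl)
    fix B i assume B: "B \<in> \<pi>" "i \<in> B"
    have "(THE B. B \<in> \<pi> \<and> i \<in> B) = B"
      by (rule the_equality) (use B d in \<open>auto simp: disjoint_def\<close>)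
    then show "g i (THE B. B \<in> \<pi> \<and> i \<in> B) = g i B" by simp
  qed
  finally show ?thesis .
qed

text \<open>A centred, strictly stationary, jointly measurable random field with all moments.\<close>
locale moment_field = prob_space M for M :: "'w measure" +
  fixes X :: "real ^ 'd \<Rightarrow> 'w \<Rightarrow> real"
  assumes X_joint: "(\<lambda>(t, \<omega>). X t \<omega>) \<in> borel_measurable (borel \<Otimes>\<^sub>M M)"
    and stationary: "strictly_stationary M X"
    and mean_zero: "\<And>t. (\<integral>\<omega>. X t \<omega> \<partial>M) = 0"
    and moments: "\<And>t k. k \<ge> (2::nat) \<Longrightarrow> integrable M (\<lambda>\<omega>. \<bar>X t \<omega>\<bar> ^ k)"
begin

lemma X_compose [measurable (raw)]:
  assumes "f \<in> N \<rightarrow>\<^sub>M borel" "g \<in> N \<rightarrow>\<^sub>M M"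
  shows "(\<lambda>x. X (f x) (g x)) \<in> borel_measurable N"
  using measurable_compose[OF measurable_Pair[OF assms] X_joint] by simp

lemma X_measurable [measurable]: "X t \<in> borel_measurable M"
  using X_compose[of "\<lambda>_. t" M "\<lambda>\<omega>. \<omega>"] by simp

lemma integrable_abs_power: "integrable M (\<lambda>\<omega>. \<bar>X t \<omega>\<bar> ^ k)"
proof (cases "k \<ge> 2")
  case False
  have "integrable M (\<lambda>\<omega>. 1 + \<bar>X t \<omega>\<bar> ^ 2)" using moments[of 2 t] by auto
  then show ?thesis
  proof (rule Bochner_Integration.integrable_bound)
    have "\<bar>X t \<omega>\<bar> \<le> 1 + \<bar>X t \<omega>\<bar> ^ 2" for \<omega>
      using sum_squares_bound[of 1 "\<bar>X t \<omega>\<bar>"] by (simp add: power2_eq_square)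
    moreover have "k = 0 \<or> k = 1" using False by auto
    ultimately show "AE \<omega> in M. norm (\<bar>X t \<omega>\<bar> ^ k) \<le> norm (1 + \<bar>X t \<omega>\<bar> ^ 2)" by auto
  qed simp
qed (use moments in auto)

lemma distr_shift: "finite J \<Longrightarrow> distr M (\<Pi>\<^sub>M t\<in>J. borel) (\<lambda>\<omega>. \<lambda>t\<in>J. X (t + h) \<omega>) =
        distr M (\<Pi>\<^sub>M t\<in>J. borel) (\<lambda>\<omega>. \<lambda>t\<in>J. X t \<omega>)"
  using stationary by (simp add: strictly_stationary_def)

text \<open>The absolute moments, which by stationarity do not depend on the point.\<close>
definition abs_moment :: "nat \<Rightarrow> real" where
  "abs_moment k = (\<integral>\<omega>. \<bar>X 0 \<omega>\<bar> ^ k \<partial>M)"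

lemma expectation_shift:
  fixes \<phi> :: "(real ^ 'd \<Rightarrow> real) \<Rightarrow> real"
  assumes "finite J" "\<phi> \<in> borel_measurable (\<Pi>\<^sub>M t\<in>J. borel)"
  shows "(\<integral>\<omega>. \<phi> (\<lambda>t\<in>J. X (t + h) \<omega>) \<partial>M) = (\<integral>\<omega>. \<phi> (\<lambda>t\<in>J. X t \<omega>) \<partial>M)"
proof -
  have m: "(\<lambda>\<omega>. \<lambda>t\<in>J. X (t + h) \<omega>) \<in> M \<rightarrow>\<^sub>M (\<Pi>\<^sub>M t\<in>J. borel)" for h
    by (intro measurable_restrict) simp
  have "(\<integral>\<omega>. \<phi> (\<lambda>t\<in>J. X (t + h) \<omega>) \<partial>M) = integral\<^sup>L (distr M (\<Pi>\<^sub>M t\<in>J. borel) (\<lambda>\<omega>. \<lambda>t\<in>J. X (t + h) \<omega>)) \<phi>"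
    by (rule integral_distr[symmetric, OF m assms(2)])
  also have "\<dots> = integral\<^sup>L (distr M (\<Pi>\<^sub>M t\<in>J. borel) (\<lambda>\<omega>. \<lambda>t\<in>J. X t \<omega>)) \<phi>"
    by (simp only: distr_shift[OF assms(1)])
  also have "\<dots> = (\<integral>\<omega>. \<phi> (\<lambda>t\<in>J. X t \<omega>) \<partial>M)"
    using integral_distr[OF m[of 0] assms(2)] by simp
  finally show ?thesis .
qed

lemma abs_moment_shift: "(\<integral>\<omega>. \<bar>X t \<omega>\<bar> ^ k \<partial>M) = abs_moment k"
  using expectation_shift[of "{0}" "\<lambda>x. \<bar>x 0\<bar> ^ k" t] by (simp add: abs_moment_def)

lemma covariance_shift: "(\<integral>\<omega>. X s \<omega> * X t \<omega> \<partial>M) = (\<integral>\<omega>. X (s - t) \<omega> * X 0 \<omega> \<partial>M)"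
  using expectation_shift[of "{s - t, 0}" "\<lambda>x. x (s - t) * x 0" t] by simp

lemma nn_integral_prod_le:
  assumes "finite I" "I \<noteq> {}"
  shows "(\<integral>\<^sup>+\<omega>. (\<Prod>i\<in>I. ennreal \<bar>X (t i) \<omega>\<bar>) \<partial>M) \<le> ennreal (real (card I) * abs_moment (card I))"
proof -
  have "(\<integral>\<^sup>+\<omega>. (\<Prod>i\<in>I. ennreal \<bar>X (t i) \<omega>\<bar>) \<partial>M) \<le> (\<integral>\<^sup>+\<omega>. ennreal (\<Sum>i\<in>I. \<bar>X (t i) \<omega>\<bar> ^ card I) \<partial>M)"
    by (intro nn_integral_mono) (simp add: prod_ennreal prod_le_sum_power[OF assms] ennreal_leI)
  also have "\<dots> = ennreal (\<Sum>i\<in>I. abs_moment (card I))"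
    by (subst nn_integral_eq_integral)
      (auto simp: integrable_abs_power abs_moment_shift intro!: AE_I2 sum_nonneg)
  finally show ?thesis by simp
qed

lemma integrable_prod_X:
  assumes "finite I"
  shows "integrable M (\<lambda>\<omega>. \<Prod>i\<in>I. X (t i) \<omega>)"
proof (cases "I = {}")
  case False
  show ?thesis
  proof (rule integrableI_bounded)
    have "(\<integral>\<^sup>+\<omega>. ennreal (norm (\<Prod>i\<in>I. X (t i) \<omega>)) \<partial>M) = (\<integral>\<^sup>+\<omega>. (\<Prod>i\<in>I. ennreal \<bar>X (t i) \<omega>\<bar>) \<partial>M)"
      by (simp add: abs_prod prod_ennreal)
    also have "\<dots> < \<infinity>" using nn_integral_prod_le[OF assms False, of t] by (rule order_le_less_trans) simp
    finally show "(\<integral>\<^sup>+\<omega>. ennreal (norm (\<Prod>i\<in>I. X (t i) \<omega>)) \<partial>M) < \<infinity>" .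
  qed measurable
qed simp

text \<open>
  The linear functional of the field with weight \<open>\<psi>\<close>. It has the default value \<open>0\<close> at outcomes where the
  integrand is not integrable; for integrable \<open>\<psi>\<close> these form a null set.
\<close>
definition lin_fun :: "(real ^ 'd \<Rightarrow> real) \<Rightarrow> 'w \<Rightarrow> real" where
  "lin_fun \<psi> \<omega> = (\<integral>t. \<psi> t * X t \<omega> \<partial>lborel)"

lemma lin_fun_measurable [measurable]:
  assumes [measurable]: "\<psi> \<in> borel_measurable borel"
  shows "lin_fun \<psi> \<in> borel_measurable M"
  unfolding lin_fun_def by measurable

text \<open>A majorant of \<^const>\<open>lin_fun\<close>, defined without any assumption of integrability.\<close>
definition abs_fun :: "(real ^ 'd \<Rightarrow> real) \<Rightarrow> 'w \<Rightarrow> ennreal" where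
  "abs_fun \<psi> \<omega> = (\<integral>\<^sup>+t. ennreal \<bar>\<psi> t * X t \<omega>\<bar> \<partial>lborel)"

lemma abs_fun_measurable [measurable]:
  assumes [measurable]: "\<psi> \<in> borel_measurable borel"
  shows "abs_fun \<psi> \<in> borel_measurable M"
  unfolding abs_fun_def by measurable

end

interpretation pos: product_sigma_finite "\<lambda>j::'i. lborel :: (real ^ 'd) measure"
  by standard

context moment_field
begin

lemma abs_fun_prod:
  assumes [measurable]: "\<psi> \<in> borel_measurable borel" and "finite I" "\<And>i. i \<in> I \<Longrightarrow> b i \<in> space M"
  shows "(\<Prod>i\<in>I. abs_fun \<psi> (b i)) = (\<integral>\<^sup>+t. (\<Prod>i\<in>I. ennreal \<bar>\<psi> (t i) * X (t i) (b i)\<bar>) \<partial>(\<Pi>\<^sub>M i\<in>I. lborel))"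
  unfolding abs_fun_def
  by (rule pos.product_nn_integral_prod[symmetric, where f = "\<lambda>i t. ennreal \<bar>\<psi> t * X t (b i)\<bar>"])
    (use assms in \<open>auto intro!: measurable_compose[OF _ measurable_ennreal] borel_measurable_abs borel_measurable_times X_compose\<close>)

lemma nn_integral_abs_fun_power:
  assumes [measurable]: "\<psi> \<in> borel_measurable borel" and "integrable lborel \<psi>" and "n > 0"
  shows "(\<integral>\<^sup>+\<omega>. abs_fun \<psi> \<omega> ^ n \<partial>M) < \<infinity>"
proof -
  let ?I = "{1..n}"
  let ?Q = "\<Pi>\<^sub>M i\<in>?I. (lborel :: (real ^ 'd) measure)"
  interpret Q: finite_product_sigma_finite "\<lambda>_::nat. lborel :: (real ^ 'd) measure" ?I by standard auto
  interpret QM: pair_sigma_finite ?Q M ..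
  have mc: "(\<lambda>x. fst x i) \<in> borel_measurable (?Q \<Otimes>\<^sub>M M)" if "i \<in> ?I" for i
    using measurable_compose[OF measurable_fst measurable_component_singleton[OF that, of "\<lambda>_. lborel"]] by simp
  have "(\<integral>\<^sup>+\<omega>. abs_fun \<psi> \<omega> ^ n \<partial>M) =
      (\<integral>\<^sup>+\<omega>. (\<integral>\<^sup>+t. (\<Prod>i\<in>?I. ennreal \<bar>\<psi> (t i) * X (t i) \<omega>\<bar>) \<partial>?Q) \<partial>M)"
    by (intro nn_integral_cong) (subst abs_fun_prod[symmetric], auto)
  also have "\<dots> = (\<integral>\<^sup>+t. (\<integral>\<^sup>+\<omega>. (\<Prod>i\<in>?I. ennreal \<bar>\<psi> (t i) * X (t i) \<omega>\<bar>) \<partial>M) \<partial>?Q)"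
    by (intro QM.Fubini')
      (simp only: split_beta', intro borel_measurable_prod_ennreal measurable_compose[OF _ measurable_ennreal]
         borel_measurable_abs borel_measurable_times X_compose measurable_snd measurable_compose[OF mc assms(1)] mc)
  also have "\<dots> \<le> (\<integral>\<^sup>+t. (\<Prod>i\<in>?I. ennreal \<bar>\<psi> (t i)\<bar>) * ennreal (real n * abs_moment n) \<partial>?Q)"
  proof (rule nn_integral_mono)
    fix t :: "nat \<Rightarrow> real ^ 'd"
    have "(\<integral>\<^sup>+\<omega>. (\<Prod>i\<in>?I. ennreal \<bar>\<psi> (t i) * X (t i) \<omega>\<bar>) \<partial>M) =
      (\<integral>\<^sup>+\<omega>. (\<Prod>i\<in>?I. ennreal \<bar>\<psi> (t i)\<bar>) * (\<Prod>i\<in>?I. ennreal \<bar>X (t i) \<omega>\<bar>) \<partial>M)"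
      by (simp add: abs_mult ennreal_mult' prod.distrib)
    also have "\<dots> = (\<Prod>i\<in>?I. ennreal \<bar>\<psi> (t i)\<bar>) * (\<integral>\<^sup>+\<omega>. (\<Prod>i\<in>?I. ennreal \<bar>X (t i) \<omega>\<bar>) \<partial>M)"
      by (rule nn_integral_cmult) measurable
    also have "\<dots> \<le> (\<Prod>i\<in>?I. ennreal \<bar>\<psi> (t i)\<bar>) * ennreal (real n * abs_moment n)"
      using nn_integral_prod_le[of ?I t] \<open>n > 0\<close> by (intro mult_left_mono) auto
    finally show "(\<integral>\<^sup>+\<omega>. (\<Prod>i\<in>?I. ennreal \<bar>\<psi> (t i) * X (t i) \<omega>\<bar>) \<partial>M) \<le> \<dots>" .
  qed
  also have "\<dots> = (\<integral>\<^sup>+t. (\<Prod>i\<in>?I. ennreal \<bar>\<psi> (t i)\<bar>) \<partial>?Q) * ennreal (real n * abs_moment n)"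
    by (intro nn_integral_multc borel_measurable_prod_ennreal)
      (auto intro!: measurable_compose[OF measurable_component_singleton])
  also have "(\<integral>\<^sup>+t. (\<Prod>i\<in>?I. ennreal \<bar>\<psi> (t i)\<bar>) \<partial>?Q) = (\<Prod>i\<in>?I. \<integral>\<^sup>+x. ennreal \<bar>\<psi> x\<bar> \<partial>lborel)"
    by (rule pos.product_nn_integral_prod) auto
  also have "(\<integral>\<^sup>+x. ennreal \<bar>\<psi> x\<bar> \<partial>lborel) = ennreal (\<integral>x. \<bar>\<psi> x\<bar> \<partial>lborel)"
    by (rule nn_integral_eq_integral) (use assms in auto)
  finally show ?thesis
    by (rule order_le_less_trans) (simp add: ennreal_mult_less_top ennreal_power prod_constant)
qed

lemma AE_integrable_weighted:
  assumes [measurable]: "\<psi> \<in> borel_measurable borel" and "integrable lborel \<psi>"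
  shows "AE \<omega> in M. integrable lborel (\<lambda>t. \<psi> t * X t \<omega>)"
proof -
  have "(\<integral>\<^sup>+\<omega>. abs_fun \<psi> \<omega> \<partial>M) < \<infinity>" using nn_integral_abs_fun_power[OF assms, of 1] by simp
  then have "AE \<omega> in M. abs_fun \<psi> \<omega> \<noteq> \<infinity>" by (intro nn_integral_PInf_AE) auto
  with AE_space show ?thesis
  proof eventually_elim
    fix \<omega> assume s: "\<omega> \<in> space M" and w: "abs_fun \<psi> \<omega> \<noteq> \<infinity>"
    show "integrable lborel (\<lambda>t. \<psi> t * X t \<omega>)"
    proof (rule integrableI_bounded)
      show "(\<lambda>t. \<psi> t * X t \<omega>) \<in> borel_measurable lborel"
        using s by (intro borel_measurable_times X_compose) auto
      show "(\<integral>\<^sup>+t. ennreal (norm (\<psi> t * X t \<omega>)) \<partial>lborel) < \<infinity>"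
        using w by (simp add: abs_fun_def top.not_eq_extremum)
    qed
  qed
qed

lemma lin_fun_le_abs_fun:
  "ennreal \<bar>lin_fun \<psi> \<omega>\<bar> \<le> abs_fun \<psi> \<omega>"
proof (cases "integrable lborel (\<lambda>t. \<psi> t * X t \<omega>)")
  case True
  then show ?thesis
    unfolding lin_fun_def abs_fun_def real_norm_def[symmetric] by (rule integral_norm_bound_ennreal)
qed (simp add: lin_fun_def not_integrable_integral_eq)

lemma integrable_lin_fun_power:
  assumes [measurable]: "\<psi> \<in> borel_measurable borel" and "integrable lborel \<psi>"
  shows "integrable M (\<lambda>\<omega>. lin_fun \<psi> \<omega> ^ n)"
proof (cases "n = 0")
  case False
  show ?thesis
  proof (rule integrableI_bounded)
    have "(\<integral>\<^sup>+\<omega>. ennreal (norm (lin_fun \<psi> \<omega> ^ n)) \<partial>M) \<le> (\<integral>\<^sup>+\<omega>. abs_fun \<psi> \<omega> ^ n \<partial>M)"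
      using lin_fun_le_abs_fun
      by (intro nn_integral_mono) (auto simp: power_abs ennreal_power[symmetric] intro!: power_mono)
    also have "\<dots> < \<infinity>" by (rule nn_integral_abs_fun_power) (use assms False in auto)
    finally show "(\<integral>\<^sup>+\<omega>. ennreal (norm (lin_fun \<psi> \<omega> ^ n)) \<partial>M) < \<infinity>" .
  qed measurable
qed simp

text \<open>
  A product of moments of \<open>lin_fun \<psi>\<close> is the expectation of one product over independent copies of the
  probability space, one copy for each block of the partition. Fubini's theorem is then applied once, to the
  product of \<open>I\<close> copies of Lebesgue measure and these copies.
\<close>
lemma prod_moments_eq_integral:
  fixes I :: "'i set"
  assumes [measurable]: "\<psi> \<in> borel_measurable borel" and psi: "integrable lborel \<psi>"
    and I: "finite I" "partition_on I \<pi>"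
  shows "integrable (\<Pi>\<^sub>M i\<in>I. lborel) (\<lambda>t. (\<Prod>i\<in>I. \<psi> (t i)) * (\<Prod>B\<in>\<pi>. \<integral>\<omega>. (\<Prod>i\<in>B. X (t i) \<omega>) \<partial>M))" (is ?th1)
    and "(\<Prod>B\<in>\<pi>. \<integral>\<omega>. lin_fun \<psi> \<omega> ^ card B \<partial>M) =
      (\<integral>t. (\<Prod>i\<in>I. \<psi> (t i)) * (\<Prod>B\<in>\<pi>. \<integral>\<omega>. (\<Prod>i\<in>B. X (t i) \<omega>) \<partial>M) \<partial>(\<Pi>\<^sub>M i\<in>I. lborel))" (is ?th2)
proof -
  let ?b = "\<lambda>i. THE B. B \<in> \<pi> \<and> i \<in> B"
  let ?Q = "\<Pi>\<^sub>M i\<in>I. (lborel :: (real ^ 'd) measure)"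
  let ?P = "\<Pi>\<^sub>M B\<in>\<pi>. M"
  have U: "I = \<Union>\<pi>" and d: "disjoint \<pi>" and ne: "{} \<notin> \<pi>" using I(2) by (auto simp: partition_on_def)
  have finB: "finite B" if "B \<in> \<pi>" for B using that U I(1) by (auto intro: finite_subset)
  have fin: "finite \<pi>" using I by (metis finite_elements)
  have cB: "card B > 0" if "B \<in> \<pi>" for B using that finB ne by (metis card_gt_0_iff)
  have b: "?b i \<in> \<pi>" if "i \<in> I" for i
  proof -
    obtain B where B: "B \<in> \<pi>" "i \<in> B" using \<open>i \<in> I\<close> unfolding U by auto
    have "?b i = B" by (rule the_equality) (use B d in \<open>auto simp: disjoint_def\<close>)
    then show ?thesis using B by simp
  qed
  interpret PM: product_sigma_finite "\<lambda>_::'i set. M" by standard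
  interpret Q: finite_product_sigma_finite "\<lambda>_::'i. lborel :: (real ^ 'd) measure" I by standard fact
  interpret P: finite_product_sigma_finite "\<lambda>_::'i set. M" \<pi> by standard fact
  interpret QP: pair_sigma_finite ?Q ?P ..
  \<comment> \<open>The point \<open>t i\<close> is evaluated in the copy that belongs to the block of \<open>i\<close>.\<close>
  define F where "F t w = (\<Prod>i\<in>I. \<psi> (t i) * X (t i) (w (?b i)))" for t w
  have mt: "(\<lambda>x. fst x i) \<in> borel_measurable (?Q \<Otimes>\<^sub>M ?P)" if "i \<in> I" for i
    using measurable_compose[OF measurable_fst measurable_component_singleton[OF that, of "\<lambda>_. lborel"]] by simp
  have mw: "(\<lambda>x. snd x B) \<in> (?Q \<Otimes>\<^sub>M ?P) \<rightarrow>\<^sub>M M" if "B \<in> \<pi>" for B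
    by (rule measurable_compose[OF measurable_snd measurable_component_singleton[OF that, of "\<lambda>_. M"]])
  have mf: "(\<lambda>x. \<psi> (fst x i) * X (fst x i) (snd x (?b i))) \<in> borel_measurable (?Q \<Otimes>\<^sub>M ?P)" if "i \<in> I" for i
    by (intro borel_measurable_times X_compose mw[OF b[OF that]] mt[OF that] measurable_compose[OF mt[OF that] assms(1)])
  have mF: "case_prod F \<in> borel_measurable (?Q \<Otimes>\<^sub>M ?P)"
    unfolding F_def split_beta' by (intro borel_measurable_prod mf)
  have block: "(\<Prod>i\<in>I. g i (w (?b i))) = (\<Prod>B\<in>\<pi>. \<Prod>i\<in>B. g i (w B))" for g :: "'i \<Rightarrow> 'w \<Rightarrow> 'z::comm_monoid_mult" and w
    using prod_partition_on[OF I, of "\<lambda>i B. g i (w B)"] .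
  have intF: "integrable (?Q \<Otimes>\<^sub>M ?P) (case_prod F)"
  proof (rule integrableI_bounded[OF mF])
    have "(\<integral>\<^sup>+x. ennreal (norm (case_prod F x)) \<partial>(?Q \<Otimes>\<^sub>M ?P)) =
        (\<integral>\<^sup>+w. (\<integral>\<^sup>+t. ennreal (norm (F t w)) \<partial>?Q) \<partial>?P)"
      using QP.nn_integral_snd[of "\<lambda>x. ennreal (norm (case_prod F x))"] mF by simp
    also have "\<dots> = (\<integral>\<^sup>+w. (\<Prod>B\<in>\<pi>. abs_fun \<psi> (w B) ^ card B) \<partial>?P)"
    proof (rule nn_integral_cong)
      fix w assume w: "w \<in> space ?P"
      have "(\<integral>\<^sup>+t. ennreal (norm (F t w)) \<partial>?Q) = (\<integral>\<^sup>+t. (\<Prod>i\<in>I. ennreal \<bar>\<psi> (t i) * X (t i) (w (?b i))\<bar>) \<partial>?Q)"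
        by (simp add: F_def abs_prod prod_ennreal)
      also have "\<dots> = (\<Prod>i\<in>I. abs_fun \<psi> (w (?b i)))"
        using w b by (intro abs_fun_prod[symmetric] I) (auto simp: space_PiM)
      also have "\<dots> = (\<Prod>B\<in>\<pi>. abs_fun \<psi> (w B) ^ card B)"
        using block[of "\<lambda>i. abs_fun \<psi>" w] by simp
      finally show "(\<integral>\<^sup>+t. ennreal (norm (F t w)) \<partial>?Q) = \<dots>" .
    qed
    also have "\<dots> = (\<Prod>B\<in>\<pi>. \<integral>\<^sup>+\<omega>. abs_fun \<psi> \<omega> ^ card B \<partial>M)"
      by (rule PM.product_nn_integral_prod[OF fin]) measurable
    also have "\<dots> < \<infinity>"
      using nn_integral_abs_fun_power[OF assms(1) psi cB] by (simp add: ennreal_prod_eq_top top.not_eq_extremum[symmetric])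
    finally show "(\<integral>\<^sup>+x. ennreal (norm (case_prod F x)) \<partial>(?Q \<Otimes>\<^sub>M ?P)) < \<infinity>" .
  qed
  have inner: "(\<integral>w. F t w \<partial>?P) = (\<Prod>i\<in>I. \<psi> (t i)) * (\<Prod>B\<in>\<pi>. \<integral>\<omega>. (\<Prod>i\<in>B. X (t i) \<omega>) \<partial>M)" for t
  proof -
    have "F t w = (\<Prod>i\<in>I. \<psi> (t i)) * (\<Prod>B\<in>\<pi>. \<Prod>i\<in>B. X (t i) (w B))" for w
      unfolding F_def prod.distrib using block[of "\<lambda>i. X (t i)" w] by simp
    then have "(\<integral>w. F t w \<partial>?P) = (\<Prod>i\<in>I. \<psi> (t i)) * (\<integral>w. (\<Prod>B\<in>\<pi>. \<Prod>i\<in>B. X (t i) (w B)) \<partial>?P)"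
      by simp
    also have "(\<integral>w. (\<Prod>B\<in>\<pi>. \<Prod>i\<in>B. X (t i) (w B)) \<partial>?P) = (\<Prod>B\<in>\<pi>. \<integral>\<omega>. (\<Prod>i\<in>B. X (t i) \<omega>) \<partial>M)"
      by (rule PM.product_integral_prod[OF fin, where f = "\<lambda>B \<omega>. \<Prod>i\<in>B. X (t i) \<omega>"])
        (intro integrable_prod_X finB)
    finally show ?thesis .
  qed
  show ?th1
    using QP.integrable_fst[OF intF] by (simp add: inner)
  have "(\<integral>t. (\<Prod>i\<in>I. \<psi> (t i)) * (\<Prod>B\<in>\<pi>. \<integral>\<omega>. (\<Prod>i\<in>B. X (t i) \<omega>) \<partial>M) \<partial>?Q) = (\<integral>t. (\<integral>w. F t w \<partial>?P) \<partial>?Q)"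
    by (simp only: inner)
  also have "\<dots> = (\<integral>w. (\<integral>t. F t w \<partial>?Q) \<partial>?P)"
    by (rule QP.Fubini_integral[OF intF, symmetric])
  also have "\<dots> = (\<integral>w. (\<Prod>B\<in>\<pi>. lin_fun \<psi> (w B) ^ card B) \<partial>?P)"
  proof (rule integral_cong_AE)
    show "(\<lambda>w. \<integral>t. F t w \<partial>?Q) \<in> borel_measurable ?P"
      using QP.integrable_snd[OF intF] by (rule borel_measurable_integrable)
    show "(\<lambda>w. \<Prod>B\<in>\<pi>. lin_fun \<psi> (w B) ^ card B) \<in> borel_measurable ?P"
      by (intro borel_measurable_prod borel_measurable_power
          measurable_compose[OF measurable_component_singleton[where M = "\<lambda>_. M"] lin_fun_measurable[OF assms(1)]])
    have "AE w in ?P. \<forall>B\<in>\<pi>. integrable lborel (\<lambda>t. \<psi> t * X t (w B))"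
    proof (intro AE_finite_allI fin)
      fix B assume "B \<in> \<pi>"
      then show "AE w in ?P. integrable lborel (\<lambda>t. \<psi> t * X t (w B))"
        by (intro AE_PiM_component[where M = "\<lambda>_. M" and P = "\<lambda>\<omega>. integrable lborel (\<lambda>t. \<psi> t * X t \<omega>)"] AE_integrable_weighted prob_space_axioms psi) auto
    qed
    then show "AE w in ?P. (\<integral>t. F t w \<partial>?Q) = (\<Prod>B\<in>\<pi>. lin_fun \<psi> (w B) ^ card B)"
    proof eventually_elim
      fix w assume w: "\<forall>B\<in>\<pi>. integrable lborel (\<lambda>t. \<psi> t * X t (w B))"
      have "(\<integral>t. F t w \<partial>?Q) = (\<Prod>i\<in>I. lin_fun \<psi> (w (?b i)))"
        unfolding F_def lin_fun_def
        by (rule pos.product_integral_prod[OF I(1), where f = "\<lambda>i t. \<psi> t * X t (w (?b i))"]) (use w b in auto)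
      also have "\<dots> = (\<Prod>B\<in>\<pi>. lin_fun \<psi> (w B) ^ card B)"
        using block[of "\<lambda>i. lin_fun \<psi>" w] by simp
      finally show "(\<integral>t. F t w \<partial>?Q) = (\<Prod>B\<in>\<pi>. lin_fun \<psi> (w B) ^ card B)" .
    qed
  qed
  also have "\<dots> = (\<Prod>B\<in>\<pi>. \<integral>\<omega>. lin_fun \<psi> \<omega> ^ card B \<partial>M)"
    by (rule PM.product_integral_prod[OF fin, where f = "\<lambda>B \<omega>. lin_fun \<psi> \<omega> ^ card B"])
      (intro integrable_lin_fun_power assms)
  finally show ?th2 ..
qed

text \<open>The moments of a linear functional of the field.\<close>
definition moment :: "(real ^ 'd \<Rightarrow> real) \<Rightarrow> nat \<Rightarrow> real" where
  "moment \<psi> n = (\<integral>\<omega>. lin_fun \<psi> \<omega> ^ n \<partial>M)"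

lemma partition_cumulant_eq_integral:
  assumes "\<psi> \<in> borel_measurable borel" and psi: "integrable lborel \<psi>"
  shows "partition_cumulant (moment \<psi>) k =
    (\<integral>t. (\<Prod>i\<in>{1..k}. \<psi> (t i)) * joint_cumulant M (\<lambda>j. X (t j)) {1..k} \<partial>(\<Pi>\<^sub>M i\<in>{1..k}. lborel))" (is "_ = ?R")
    and "integrable (\<Pi>\<^sub>M i\<in>{1..k}. lborel) (\<lambda>t. (\<Prod>i\<in>{1..k}. \<psi> (t i)) * joint_cumulant M (\<lambda>j. X (t j)) {1..k})" (is ?I)
proof -
  let ?P = "{\<pi>. partition_on {1..k} \<pi>}"
  let ?Q = "\<Pi>\<^sub>M i\<in>{1..k}. (lborel :: (real ^ 'd) measure)"
  let ?c = "\<lambda>\<pi>::nat set set. (- 1) ^ (card \<pi> - 1) * fact (card \<pi> - 1) :: real"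
  let ?g = "\<lambda>\<pi> t. (\<Prod>i\<in>{1..k}. \<psi> (t i)) * (\<Prod>B\<in>\<pi>. \<integral>\<omega>. (\<Prod>i\<in>B. X (t i) \<omega>) \<partial>M)"
  have fin: "finite ?P" by (rule finitely_many_partition_on) simp
  have e: "(\<Prod>i\<in>{1..k}. \<psi> (t i)) * joint_cumulant M (\<lambda>j. X (t j)) {1..k} = (\<Sum>\<pi>\<in>?P. ?c \<pi> * ?g \<pi> t)" for t
    unfolding joint_cumulant_def sum_distrib_left by (intro sum.cong) (auto simp: mult_ac)
  have int: "integrable ?Q (?g \<pi>)" if "\<pi> \<in> ?P" for \<pi>
    by (rule prod_moments_eq_integral(1)[OF assms]) (use that in auto)
  show ?I unfolding e by (intro Bochner_Integration.integrable_sum integrable_mult_right int)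
  have "partition_cumulant (moment \<psi>) k = (\<Sum>\<pi>\<in>?P. ?c \<pi> * (\<integral>t. ?g \<pi> t \<partial>?Q))"
    unfolding partition_cumulant_def moment_def
    by (intro sum.cong refl arg_cong2[where f = "(*)"] prod_moments_eq_integral(2)[OF assms]) auto
  also have "\<dots> = (\<integral>t. (\<Sum>\<pi>\<in>?P. ?c \<pi> * ?g \<pi> t) \<partial>?Q)"
  proof -
    have "(\<integral>t. (\<Sum>\<pi>\<in>?P. ?c \<pi> * ?g \<pi> t) \<partial>?Q) = (\<Sum>\<pi>\<in>?P. \<integral>t. ?c \<pi> * ?g \<pi> t \<partial>?Q)"
      by (rule Bochner_Integration.integral_sum) (intro integrable_mult_right int)
    then show ?thesis by (simp only: integral_mult_right_zero)
  qed
  finally show "partition_cumulant (moment \<psi>) k = ?R" unfolding e .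
qed

end

text \<open>The Fourier transform of a weight, normalised as \<^const>\<open>fourier_set\<close>.\<close>
definition fourier :: "(real ^ 'd \<Rightarrow> real) \<Rightarrow> real ^ 'd \<Rightarrow> complex" where
  "fourier \<psi> l = (\<integral>t. complex_of_real (\<psi> t) * cis (t \<bullet> l) \<partial>lborel)"

lemma cis_measurable [measurable]: "cis \<in> borel_measurable borel"
  by (intro borel_measurable_continuous_onI continuous_on_cis continuous_on_id)

lemma fourier_measurable [measurable]:
  assumes [measurable]: "\<psi> \<in> borel_measurable borel"
  shows "fourier \<psi> \<in> borel_measurable borel"
  unfolding fourier_def[abs_def] by measurable

lemma integrable_fourier:
  assumes "integrable lborel \<psi>"
  shows "integrable lborel (\<lambda>t. complex_of_real (\<psi> t) * cis (t \<bullet> l))"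
proof -
  have m: "\<psi> \<in> borel_measurable borel" using assms by auto
  have "integrable lborel (\<lambda>t. complex_of_real (\<psi> t))" using assms by (simp add: integrable_of_real)
  then show ?thesis
    by (rule Bochner_Integration.integrable_bound) (use m in \<open>auto simp: norm_mult\<close>)
qed

lemma cis_sum: "finite A \<Longrightarrow> cis (\<Sum>i\<in>A. g i) = (\<Prod>i\<in>A. cis (g i))"
  by (induction A rule: finite_induct) (auto simp: cis_mult[symmetric])

text \<open>
  The exponent in the spectral representation is symmetric in the \<open>k\<close> points once the dependent frequency is
  included.
\<close>
lemma sum_last_freq:
  assumes "k \<ge> 1"
  shows "(\<Sum>j\<in>{1..<k}. l j \<bullet> (t j - t k)) = (\<Sum>j\<in>{1..k}. t j \<bullet> last_freq k l j)"
proof -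
  have "{1..k} = insert k {1..<k}" using assms by auto
  then have "(\<Sum>j\<in>{1..k}. t j \<bullet> last_freq k l j) = t k \<bullet> last_freq k l k + (\<Sum>j\<in>{1..<k}. t j \<bullet> last_freq k l j)"
    by simp
  also have "(\<Sum>j\<in>{1..<k}. t j \<bullet> last_freq k l j) = (\<Sum>j\<in>{1..<k}. l j \<bullet> t j)"
    by (intro sum.cong) (auto simp: last_freq_def inner_commute)
  also have "t k \<bullet> last_freq k l k = - (\<Sum>j\<in>{1..<k}. l j \<bullet> t k)"
    by (simp add: last_freq_def inner_sum_right inner_commute)
  finally show ?thesis by (simp add: inner_diff_right sum_subtractf)
qed

context moment_field
begin

lemma partition_cumulant_spectral:
  assumes psi_m[measurable]: "\<psi> \<in> borel_measurable borel" and psi: "integrable lborel \<psi>"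
    and f: "cumulant_spectral_densities M X f" and k: "k \<ge> 2"
  shows "complex_of_real (partition_cumulant (moment \<psi>) k) =
    (\<integral>l. (\<Prod>j\<in>{1..k}. fourier \<psi> (last_freq k l j)) * f k l \<partial>freq_space k)"
proof -
  let ?Q = "\<Pi>\<^sub>M i\<in>{1..k}. (lborel :: (real ^ 'd) measure)"
  let ?L = "freq_space k :: (nat \<Rightarrow> real ^ 'd) measure"
  interpret Q: finite_product_sigma_finite "\<lambda>_::nat. lborel :: (real ^ 'd) measure" "{1..k}" by standard simp
  interpret L: finite_product_sigma_finite "\<lambda>_::nat. lborel :: (real ^ 'd) measure" "{1..<k}" by standard simp
  interpret QL: pair_sigma_finite ?Q ?L unfolding freq_space_def ..
  have fi: "integrable ?L (f k)" and cum: "complex_of_real (joint_cumulant M (\<lambda>j. X (t j)) {1..k}) =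
           (\<integral>l. cis (\<Sum>j\<in>{1..<k}. l j \<bullet> (t j - t k)) * f k l \<partial>?L)" for t
    using f k by (auto simp: cumulant_spectral_densities_def)
  have fm: "f k \<in> borel_measurable ?L" using fi by auto
  define G where "G t l = (\<Prod>i\<in>{1..k}. complex_of_real (\<psi> (t i)) * cis (t i \<bullet> last_freq k l i)) * f k l" for t l
  have mt: "(\<lambda>x. fst x i) \<in> borel_measurable (?Q \<Otimes>\<^sub>M ?L)" if "i \<in> {1..k}" for i
    using measurable_compose[OF measurable_fst measurable_component_singleton[OF that, of "\<lambda>_. lborel"]] by simp
  have ml: "(\<lambda>x. last_freq k (snd x) i) \<in> borel_measurable (?Q \<Otimes>\<^sub>M ?L)" if "i \<in> {1..k}" for i
    by (rule measurable_compose[OF measurable_snd measurable_last_freq[OF that]])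
  have mpsi: "(\<lambda>x. complex_of_real (\<psi> (fst x i))) \<in> borel_measurable (?Q \<Otimes>\<^sub>M ?L)" if "i \<in> {1..k}" for i
  proof -
    have [measurable]: "(\<lambda>x. \<psi> (fst x i)) \<in> borel_measurable (?Q \<Otimes>\<^sub>M ?L)"
      by (rule measurable_compose[OF mt[OF that] psi_m])
    show ?thesis by measurable
  qed
  have mG: "case_prod G \<in> borel_measurable (?Q \<Otimes>\<^sub>M ?L)"
    unfolding G_def split_beta'
    by (intro borel_measurable_times borel_measurable_prod measurable_compose[OF _ cis_measurable] borel_measurable_inner mt ml
        measurable_compose[OF measurable_snd fm] mpsi)
  have nG: "norm (G t l) = norm (f k l) * (\<Prod>i\<in>{1..k}. \<bar>\<psi> (t i)\<bar>)" for t l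
    by (simp add: G_def norm_mult prod_norm[symmetric] mult.commute)
  have intpsi: "integrable ?Q (\<lambda>t. \<Prod>i\<in>{1..k}. \<bar>\<psi> (t i)\<bar>)"
    by (rule pos.product_integrable_prod) (use psi in auto)
  have intG: "integrable (?Q \<Otimes>\<^sub>M ?L) (case_prod G)"
  proof (rule QL.Fubini_integrable[OF mG])
    show "integrable ?Q (\<lambda>t. \<integral>l. norm (case_prod G (t, l)) \<partial>?L)"
      using intpsi by (simp add: nG)
    show "AE t in ?Q. integrable ?L (\<lambda>l. case_prod G (t, l))"
    proof (rule AE_I2)
      fix t assume t: "t \<in> space ?Q"
      have "(\<lambda>l. case_prod G (t, l)) \<in> borel_measurable ?L"
        by (rule measurable_compose[OF measurable_Pair1'[OF t] mG])
      then show "integrable ?L (\<lambda>l. case_prod G (t, l))"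
        by (rule Bochner_Integration.integrable_bound[OF integrable_mult_left[OF integrable_norm[OF fi], of "\<Prod>i\<in>{1..k}. \<bar>\<psi> (t i)\<bar>"]])
          (simp add: nG abs_mult abs_prod)
    qed
  qed
  have "complex_of_real (partition_cumulant (moment \<psi>) k) =
      (\<integral>t. complex_of_real ((\<Prod>i\<in>{1..k}. \<psi> (t i)) * joint_cumulant M (\<lambda>j. X (t j)) {1..k}) \<partial>?Q)"
    unfolding partition_cumulant_eq_integral(1)[OF psi_m psi] by (rule integral_complex_of_real[symmetric])
  also have "\<dots> = (\<integral>t. (\<integral>l. G t l \<partial>?L) \<partial>?Q)"
  proof (rule Bochner_Integration.integral_cong[OF refl])
    fix t
    have "complex_of_real ((\<Prod>i\<in>{1..k}. \<psi> (t i)) * joint_cumulant M (\<lambda>j. X (t j)) {1..k}) =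
        (\<Prod>i\<in>{1..k}. complex_of_real (\<psi> (t i))) * (\<integral>l. cis (\<Sum>j\<in>{1..<k}. l j \<bullet> (t j - t k)) * f k l \<partial>?L)"
      by (simp only: of_real_mult of_real_prod cum)
    also have "\<dots> = (\<integral>l. (\<Prod>i\<in>{1..k}. complex_of_real (\<psi> (t i))) * (cis (\<Sum>j\<in>{1..<k}. l j \<bullet> (t j - t k)) * f k l) \<partial>?L)"
      by (rule integral_mult_right_zero[symmetric])
    also have "\<dots> = (\<integral>l. G t l \<partial>?L)"
    proof (rule Bochner_Integration.integral_cong[OF refl])
      fix l :: "nat \<Rightarrow> real ^ 'd"
      have "cis (\<Sum>j\<in>{1..<k}. l j \<bullet> (t j - t k)) = (\<Prod>i\<in>{1..k}. cis (t i \<bullet> last_freq k l i))"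
        using k by (subst sum_last_freq) (auto simp: cis_sum)
      then show "(\<Prod>i\<in>{1..k}. complex_of_real (\<psi> (t i))) * (cis (\<Sum>j\<in>{1..<k}. l j \<bullet> (t j - t k)) * f k l) = G t l"
        unfolding G_def prod.distrib by (simp only: mult.assoc)
    qed
    finally show "complex_of_real ((\<Prod>i\<in>{1..k}. \<psi> (t i)) * joint_cumulant M (\<lambda>j. X (t j)) {1..k}) = (\<integral>l. G t l \<partial>?L)" .
  qed
  also have "\<dots> = (\<integral>l. (\<integral>t. G t l \<partial>?Q) \<partial>?L)"
    by (rule QL.Fubini_integral[OF intG, symmetric])
  also have "\<dots> = (\<integral>l. (\<Prod>j\<in>{1..k}. fourier \<psi> (last_freq k l j)) * f k l \<partial>?L)"
  proof (rule Bochner_Integration.integral_cong[OF refl])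
    fix l :: "nat \<Rightarrow> real ^ 'd"
    have "(\<integral>t. G t l \<partial>?Q) = (\<integral>t. (\<Prod>i\<in>{1..k}. complex_of_real (\<psi> (t i)) * cis (t i \<bullet> last_freq k l i)) \<partial>?Q) * f k l"
      unfolding G_def by (rule integral_mult_left_zero)
    also have "(\<integral>t. (\<Prod>i\<in>{1..k}. complex_of_real (\<psi> (t i)) * cis (t i \<bullet> last_freq k l i)) \<partial>?Q) =
        (\<Prod>j\<in>{1..k}. fourier \<psi> (last_freq k l j))"
      unfolding fourier_def
      by (rule pos.product_integral_prod[where f = "\<lambda>i t. complex_of_real (\<psi> t) * cis (t \<bullet> last_freq k l i)"])
        (use integrable_fourier[OF psi] in auto)
    finally show "(\<integral>t. G t l \<partial>?Q) = (\<Prod>j\<in>{1..k}. fourier \<psi> (last_freq k l j)) * f k l" .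
  qed
  finally show ?thesis .
qed

lemma abs_partition_cumulant_le:
  assumes "\<psi> \<in> borel_measurable borel" and psi: "integrable lborel \<psi>"
    and f: "cumulant_spectral_densities M X f" and k: "k \<ge> 2"
  shows "ennreal \<bar>partition_cumulant (moment \<psi>) k\<bar> \<le>
    (\<integral>\<^sup>+l. ennreal (norm (f k l) * (\<Prod>j\<in>{1..k}. norm (fourier \<psi> (last_freq k l j)))) \<partial>freq_space k)"
proof -
  let ?g = "\<lambda>l. (\<Prod>j\<in>{1..k}. fourier \<psi> (last_freq k l j)) * f k l"
  have e: "\<bar>partition_cumulant (moment \<psi>) k\<bar> = norm (\<integral>l. ?g l \<partial>freq_space k)"
    by (subst partition_cumulant_spectral[OF assms, symmetric]) simp
  have "ennreal (norm (\<integral>l. ?g l \<partial>freq_space k)) \<le> (\<integral>\<^sup>+l. ennreal (norm (?g l)) \<partial>freq_space k)"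
    by (cases "integrable (freq_space k) ?g") (auto intro: integral_norm_bound_ennreal simp: not_integrable_integral_eq)
  then show ?thesis unfolding e by (simp add: norm_mult prod_norm[symmetric] mult.commute)
qed

end

section \<open>Rescaling, and dilates of a convex body\<close>

lemma nn_integral_scale:
  fixes f :: "'a::euclidean_space \<Rightarrow> ennreal"
  assumes [measurable]: "f \<in> borel_measurable borel" and T: "T > 0"
  shows "(\<integral>\<^sup>+x. f (x /\<^sub>R T) \<partial>lborel) = ennreal (T ^ DIM('a)) * (\<integral>\<^sup>+x. f x \<partial>lborel)"
proof -
  have e: "(lborel :: 'a measure) = density (distr lborel borel (\<lambda>x. T *\<^sub>R x)) (\<lambda>_. ennreal (T ^ DIM('a)))"
    using lborel_affine[of T "0 :: 'a"] T by simp
  have "(\<integral>\<^sup>+x. f (x /\<^sub>R T) \<partial>lborel) = (\<integral>\<^sup>+x. f (x /\<^sub>R T) \<partial>(density (distr lborel borel (\<lambda>x. T *\<^sub>R x)) (\<lambda>_. ennreal (T ^ DIM('a)))))"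
    by (subst e) simp
  also have "\<dots> = ennreal (T ^ DIM('a)) * (\<integral>\<^sup>+x. f x \<partial>lborel)"
    using T by (simp add: nn_integral_density nn_integral_distr nn_integral_cmult)
  finally show ?thesis .
qed

lemma integral_scale:
  fixes f :: "'a::euclidean_space \<Rightarrow> 'b::{banach, second_countable_topology}"
  assumes [measurable]: "f \<in> borel_measurable borel" and T: "T > 0"
  shows "(\<integral>x. f (x /\<^sub>R T) \<partial>lborel) = T ^ DIM('a) *\<^sub>R (\<integral>x. f x \<partial>lborel)"
proof -
  have e: "(lborel :: 'a measure) = density (distr lborel borel (\<lambda>x. T *\<^sub>R x)) (\<lambda>_. ennreal (T ^ DIM('a)))"
    using lborel_affine[of T "0 :: 'a"] T by simp
  have "(\<integral>x. f (x /\<^sub>R T) \<partial>lborel) = (\<integral>x. f (x /\<^sub>R T) \<partial>(density (distr lborel borel (\<lambda>x. T *\<^sub>R x)) (\<lambda>_. ennreal (T ^ DIM('a)))))"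
    by (subst e) simp
  also have "\<dots> = T ^ DIM('a) *\<^sub>R (\<integral>x. f x \<partial>lborel)"
    using T by (subst integral_density) (auto simp: integral_distr)
  finally show ?thesis .
qed

lemma integrable_scale:
  fixes f :: "'a::euclidean_space \<Rightarrow> 'b::{banach, second_countable_topology}"
  assumes f: "integrable lborel f" and T: "T > 0"
  shows "integrable lborel (\<lambda>x. f (x /\<^sub>R T))"
proof -
  have m[measurable]: "f \<in> borel_measurable borel" using f by auto
  show ?thesis
  proof (rule integrableI_bounded)
    show "(\<lambda>x. f (x /\<^sub>R T)) \<in> borel_measurable lborel" by measurable
    show "(\<integral>\<^sup>+x. ennreal (norm (f (x /\<^sub>R T))) \<partial>lborel) < \<infinity>"
      using f T nn_integral_scale[of "\<lambda>x. ennreal (norm (f x))" T]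
      by (simp add: integrable_iff_bounded ennreal_mult_less_top)
  qed
qed

lemma AE_scale:
  fixes P :: "'a::euclidean_space \<Rightarrow> bool"
  assumes P: "AE x in lborel. P x" and T: "T > 0"
  shows "AE x in lborel. P (x /\<^sub>R T)"
proof -
  obtain Z where Z: "Z \<in> null_sets lborel" "{x. \<not> P x} \<subseteq> Z" using P by (auto simp: eventually_ae_filter)
  have [measurable]: "Z \<in> sets borel" using Z by auto
  have "(\<integral>\<^sup>+x. indicator Z (x /\<^sub>R T) \<partial>lborel) = 0"
    using nn_integral_scale[of "indicator Z" T] Z T by (simp add: null_sets_def)
  then have "AE x in lborel. (indicator Z (x /\<^sub>R T) :: ennreal) = 0"
    by (subst (asm) nn_integral_0_iff_AE) auto
  then show ?thesis
  proof eventually_elim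
    fix x assume "(indicator Z (x /\<^sub>R T) :: ennreal) = 0"
    then show "P (x /\<^sub>R T)" using Z(2) by (auto simp: indicator_def split: if_splits)
  qed
qed

text \<open>The weight \<open>\<Psi>\<close> stretched to the scale \<open>T\<close> and normalised so that its \<open>L\<^sup>2\<close> norm is kept.\<close>
definition rescaled :: "(real ^ 'd \<Rightarrow> real) \<Rightarrow> real \<Rightarrow> real ^ 'd \<Rightarrow> real" where
  "rescaled \<Psi> T t = \<Psi> (t /\<^sub>R T) / T powr (real CARD('d) / 2)"

lemma powr_half_square:
  "T > 0 \<Longrightarrow> T powr (real CARD('d) / 2) * T powr (real CARD('d) / 2) = T ^ CARD('d::finite)"
  by (simp add: powr_add[symmetric] powr_realpow)

lemma rescaled_measurable [measurable]:
  assumes [measurable]: "\<Psi> \<in> borel_measurable borel"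
  shows "rescaled \<Psi> T \<in> borel_measurable borel"
  unfolding rescaled_def[abs_def] by measurable

lemma rescaled_integrable: "integrable lborel \<Psi> \<Longrightarrow> T > 0 \<Longrightarrow> integrable lborel (rescaled \<Psi> T)"
  unfolding rescaled_def[abs_def] by (intro Bochner_Integration.integrable_divide integrable_scale)

lemma integral_rescaled_shift:
  fixes \<Psi> :: "real ^ 'd \<Rightarrow> real"
  assumes [measurable]: "\<Psi> \<in> borel_measurable borel" and T: "T > 0"
  shows "(\<integral>t. rescaled \<Psi> T t * rescaled \<Psi> T (t - h) \<partial>lborel) = (\<integral>x. \<Psi> x * \<Psi> (x - h /\<^sub>R T) \<partial>lborel)"
proof -
  have "(\<integral>t. rescaled \<Psi> T t * rescaled \<Psi> T (t - h) \<partial>lborel) =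
      (\<integral>t. (\<lambda>x. \<Psi> x * \<Psi> (x - h /\<^sub>R T) / T ^ CARD('d)) (t /\<^sub>R T) \<partial>lborel)"
    using T by (simp add: rescaled_def scaleR_diff_right powr_half_square)
  also have "\<dots> = T ^ CARD('d) * (\<integral>x. \<Psi> x * \<Psi> (x - h /\<^sub>R T) / T ^ CARD('d) \<partial>lborel)"
    using T by (subst integral_scale) auto
  also have "\<dots> = (\<integral>x. \<Psi> x * \<Psi> (x - h /\<^sub>R T) \<partial>lborel)" using T by simp
  finally show ?thesis .
qed

lemma fourier_rescaled:
  fixes \<Psi> :: "real ^ 'd \<Rightarrow> real"
  assumes [measurable]: "\<Psi> \<in> borel_measurable borel" and T: "T > 0"
  shows "fourier (rescaled \<Psi> T) l = T powr (real CARD('d) / 2) *\<^sub>R fourier \<Psi> (T *\<^sub>R l)"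
proof -
  let ?a = "T powr (real CARD('d) / 2)"
  have "fourier (rescaled \<Psi> T) l = (\<integral>t. (\<lambda>x. (complex_of_real (\<Psi> x) * cis (x \<bullet> (T *\<^sub>R l))) /\<^sub>R ?a) (t /\<^sub>R T) \<partial>lborel)"
    unfolding fourier_def rescaled_def
  proof (rule Bochner_Integration.integral_cong[OF refl])
    fix t :: "real ^ 'd"
    have "(t /\<^sub>R T) \<bullet> (T *\<^sub>R l) = t \<bullet> l" using T by simp
    then show "complex_of_real (\<Psi> (t /\<^sub>R T) / ?a) * cis (t \<bullet> l) =
        (complex_of_real (\<Psi> (t /\<^sub>R T)) * cis ((t /\<^sub>R T) \<bullet> (T *\<^sub>R l))) /\<^sub>R ?a"
      by (simp only: divide_inverse of_real_mult scaleR_conv_of_real mult_ac)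
  qed
  also have "\<dots> = T ^ CARD('d) *\<^sub>R (\<integral>x. (complex_of_real (\<Psi> x) * cis (x \<bullet> (T *\<^sub>R l))) /\<^sub>R ?a \<partial>lborel)"
    using T by (subst integral_scale) auto
  also have "\<dots> = T ^ CARD('d) *\<^sub>R (fourier \<Psi> (T *\<^sub>R l) /\<^sub>R ?a)"
    unfolding fourier_def by (subst integral_scaleR_right) simp
  also have "\<dots> = ?a *\<^sub>R fourier \<Psi> (T *\<^sub>R l)"
  proof -
    have "?a > 0" using T by simp
    then have "T ^ CARD('d) * inverse ?a = ?a"
      unfolding powr_half_square[OF T, symmetric] by (simp only: mult.assoc right_inverse mult_1_right less_irrefl)
    then show ?thesis by (simp only: scaleR_scaleR)
  qed
  finally show ?thesis .
qed

text \<open>The power of \<open>T\<close> vanishes for \<open>s = 2\<close> and is negative for \<open>s < 2\<close>.\<close>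
lemma nn_integral_fourier_rescaled:
  fixes \<Psi> :: "real ^ 'd \<Rightarrow> real"
  assumes [measurable]: "\<Psi> \<in> borel_measurable borel" and T: "T > 0"
  shows "(\<integral>\<^sup>+l. ennreal (norm (fourier (rescaled \<Psi> T) l) powr s) \<partial>lborel) =
    ennreal (T powr (real CARD('d) * (s / 2 - 1))) * (\<integral>\<^sup>+l. ennreal (norm (fourier \<Psi> l) powr s) \<partial>lborel)"
proof -
  let ?a = "T powr (real CARD('d) / 2)"
  have "(\<integral>\<^sup>+l. ennreal (norm (fourier (rescaled \<Psi> T) l) powr s) \<partial>lborel) =
      (\<integral>\<^sup>+l. ennreal (?a powr s) * (\<lambda>x. ennreal (norm (fourier \<Psi> x) powr s)) (l /\<^sub>R inverse T) \<partial>lborel)"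
    using T by (simp add: fourier_rescaled powr_mult ennreal_mult')
  also have "\<dots> = ennreal (?a powr s) * (\<integral>\<^sup>+l. (\<lambda>x. ennreal (norm (fourier \<Psi> x) powr s)) (l /\<^sub>R inverse T) \<partial>lborel)"
    by (rule nn_integral_cmult) measurable
  also have "\<dots> = ennreal (?a powr s) * (ennreal (inverse T ^ CARD('d)) * (\<integral>\<^sup>+l. ennreal (norm (fourier \<Psi> l) powr s) \<partial>lborel))"
    using T by (subst nn_integral_scale) auto
  also have "\<dots> = ennreal (?a powr s * inverse T ^ CARD('d)) * (\<integral>\<^sup>+l. ennreal (norm (fourier \<Psi> l) powr s) \<partial>lborel)"
    using T by (simp add: ennreal_mult mult.assoc)
  also have "?a powr s * inverse T ^ CARD('d) = T powr (real CARD('d) * (s / 2 - 1))"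
  proof -
    have "inverse T ^ CARD('d) = T powr - real CARD('d)" using T by (simp add: powr_minus powr_realpow power_inverse)
    then have "?a powr s * inverse T ^ CARD('d) = T powr (real CARD('d) / 2 * s + - real CARD('d))"
      by (simp only: powr_powr powr_add)
    also have "real CARD('d) / 2 * s + - real CARD('d) = real CARD('d) * (s / 2 - 1)"
      by (simp add: algebra_simps)
    finally show ?thesis .
  qed
  finally show ?thesis .
qed

text \<open>A bounded convex set that contains the origin. Its dilates increase with the factor.\<close>
locale convex_body =
  fixes K :: "(real ^ 'd) set"
  assumes bounded_K: "bounded K" and convex_K: "convex K" and origin_K: "0 \<in> K"
begin

abbreviation vol :: real where "vol \<equiv> measure lebesgue K"

text \<open>
  A Borel version of the indicator of the dilate of \<open>K\<close> by \<open>\<rho>\<close>. The set \<open>K\<close> need not be Borel, so its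
  interior is used; for \<open>\<rho> = 0\<close> the dilate is a single point, which is null.
\<close>
definition ind :: "real \<Rightarrow> real ^ 'd \<Rightarrow> real" where
  "ind \<rho> t = (if \<rho> > 0 then indicator (interior K) (t /\<^sub>R \<rho>) else 0)"

lemma ind_measurable [measurable]: "ind \<rho> \<in> borel_measurable borel"
proof (cases "\<rho> > 0")
  case True
  have [measurable]: "interior K \<in> sets borel" by simp
  have "(\<lambda>t. indicator (interior K) (t /\<^sub>R \<rho>) :: real) \<in> borel_measurable borel" by measurable
  then show ?thesis using True by (simp add: ind_def[abs_def])
qed (simp add: ind_def[abs_def])

lemma ind_bounds: "0 \<le> ind \<rho> t" "ind \<rho> t \<le> 1" "\<bar>ind \<rho> t\<bar> \<le> 1"
  by (auto simp: ind_def indicator_def)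

lemma ind_scale: "T > 0 \<Longrightarrow> ind (\<rho> * T) t = ind \<rho> (t /\<^sub>R T)"
  by (simp add: ind_def zero_less_mult_iff)

lemma dilate_iff: "\<rho> > 0 \<Longrightarrow> t \<in> dilate \<rho> K \<longleftrightarrow> t /\<^sub>R \<rho> \<in> K"
  by (force simp: dilate_def image_iff)

lemma dilate_0: "dilate 0 K = {0}"
  using origin_K by (auto simp: dilate_def)

lemma dilate_lmeasurable: "dilate \<rho> K \<in> lmeasurable"
  unfolding dilate_def by (intro measurable_convex convex_scaling convex_K bounded_scaling bounded_K)

lemma AE_frontier: "AE t in lborel. t \<notin> frontier K"
proof -
  have "frontier K \<in> null_sets lebesgue"
    using negligible_convex_frontier[OF convex_K] by (simp add: negligible_iff_null_sets)
  moreover have "frontier K \<in> sets lborel" by (simp add: borel_closed)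
  ultimately have "frontier K \<in> null_sets lborel" by (simp add: null_sets_completion_iff)
  then show ?thesis by (rule AE_not_in)
qed

text \<open>The frontier of a convex set is null.\<close>
lemma AE_ind:
  assumes "\<rho> \<ge> 0"
  shows "AE t in lborel. indicator (dilate \<rho> K) t = ind \<rho> t"
proof (cases "\<rho> = 0")
  case True
  have "AE t in lborel. t \<noteq> (0 :: real ^ 'd)" by (rule AE_lborel_singleton)
  then show ?thesis by eventually_elim (simp add: True dilate_0 ind_def)
next
  case False
  with assms have r: "\<rho> > 0" by simp
  show ?thesis
    using AE_scale[OF AE_frontier r]
  proof eventually_elim
    fix t assume "t /\<^sub>R \<rho> \<notin> frontier K"
    then have "t /\<^sub>R \<rho> \<in> K \<longleftrightarrow> t /\<^sub>R \<rho> \<in> interior K"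
      using closure_subset[of K] interior_subset[of K] by (auto simp: frontier_def)
    then show "indicator (dilate \<rho> K) t = ind \<rho> t"
      using r dilate_iff[OF r, of t] by (simp add: ind_def indicator_def)
  qed
qed

lemma dilate_mono: "0 \<le> \<rho> \<Longrightarrow> \<rho> \<le> \<rho>' \<Longrightarrow> dilate \<rho> K \<subseteq> dilate \<rho>' K"
proof
  fix t assume r: "0 \<le> \<rho>" "\<rho> \<le> \<rho>'" and t: "t \<in> dilate \<rho> K"
  then obtain x where x: "x \<in> K" "t = \<rho> *\<^sub>R x" by (auto simp: dilate_def)
  show "t \<in> dilate \<rho>' K"
  proof (cases "\<rho>' = 0")
    case False
    then have "(\<rho> / \<rho>') *\<^sub>R x + (1 - \<rho> / \<rho>') *\<^sub>R 0 \<in> K"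
      using r by (intro convexD[OF convex_K] x origin_K) auto
    then show ?thesis using False x unfolding dilate_def by (intro image_eqI[of _ _ "(\<rho> / \<rho>') *\<^sub>R x"]) auto
  qed (use r t in auto)
qed

lemma AE_ind_mono:
  assumes r: "0 \<le> \<rho>" "\<rho> \<le> \<rho>'"
  shows "AE t in lborel. ind \<rho> t \<le> ind \<rho>' t"
proof -
  have "\<rho>' \<ge> 0" using r by simp
  show ?thesis using AE_ind[OF r(1)] AE_ind[OF \<open>\<rho>' \<ge> 0\<close>]
  proof eventually_elim
    fix t :: "real ^ 'd"
    assume "indicator (dilate \<rho> K) t = ind \<rho> t" "indicator (dilate \<rho>' K) t = ind \<rho>' t"
    moreover have "(indicator (dilate \<rho> K) t :: real) \<le> indicator (dilate \<rho>' K) t"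
      using dilate_mono[OF r] by (auto simp: indicator_def)
    ultimately show "ind \<rho> t \<le> ind \<rho>' t" by simp
  qed
qed

lemma set_integral_eq_lborel:
  fixes g :: "real ^ 'd \<Rightarrow> 'b::{banach, second_countable_topology}"
  assumes A: "A \<in> sets lebesgue" and g: "g \<in> borel_measurable borel" and \<psi>: "\<psi> \<in> borel_measurable borel"
    and ae: "AE t in lborel. indicator A t = \<psi> t"
  shows "(LINT t:A|lebesgue. g t) = (\<integral>t. \<psi> t *\<^sub>R g t \<partial>lborel)"
proof -
  have m: "(\<lambda>t. \<psi> t *\<^sub>R g t) \<in> borel_measurable lborel" using g \<psi> by (intro borel_measurable_scaleR) auto
  have "(LINT t:A|lebesgue. g t) = (\<integral>t. \<psi> t *\<^sub>R g t \<partial>lebesgue)"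
    unfolding set_lebesgue_integral_def
  proof (rule integral_cong_AE)
    show "(\<lambda>t. indicat_real A t *\<^sub>R g t) \<in> borel_measurable lebesgue"
      using A g by (intro borel_measurable_scaleR borel_measurable_indicator measurable_completion) auto
    show "(\<lambda>t. \<psi> t *\<^sub>R g t) \<in> borel_measurable lebesgue" by (rule measurable_completion[OF m])
    show "AE t in lebesgue. indicat_real A t *\<^sub>R g t = \<psi> t *\<^sub>R g t"
      by (rule AE_completion) (use ae in eventually_elim, simp)
  qed
  also have "\<dots> = (\<integral>t. \<psi> t *\<^sub>R g t \<partial>lborel)" by (rule integral_completion[OF m])
  finally show ?thesis .
qed

lemma set_integral_dilate:
  fixes g :: "real ^ 'd \<Rightarrow> 'b::{banach, second_countable_topology}"
  assumes "\<rho> \<ge> 0" "g \<in> borel_measurable borel"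
  shows "(LINT t:dilate \<rho> K|lebesgue. g t) = (\<integral>t. ind \<rho> t *\<^sub>R g t \<partial>lborel)"
  using dilate_lmeasurable assms by (intro set_integral_eq_lborel AE_ind) (auto simp: fmeasurable_def)

lemma AE_ind_diff:
  assumes r: "0 \<le> \<rho>" "\<rho> \<le> \<rho>'"
  shows "AE t in lborel. indicator (dilate \<rho>' K - dilate \<rho> K) t = ind \<rho>' t - ind \<rho> t"
proof -
  have "\<rho>' \<ge> 0" using r by simp
  show ?thesis using AE_ind[OF r(1)] AE_ind[OF \<open>\<rho>' \<ge> 0\<close>]
  proof eventually_elim
    fix t :: "real ^ 'd"
    assume "indicator (dilate \<rho> K) t = ind \<rho> t" "indicator (dilate \<rho>' K) t = ind \<rho>' t"
    moreover have "(indicator (dilate \<rho>' K - dilate \<rho> K) t :: real) = indicator (dilate \<rho>' K) t - indicator (dilate \<rho> K) t"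
      using dilate_mono[OF r] by (auto simp: indicator_def)
    ultimately show "indicator (dilate \<rho>' K - dilate \<rho> K) t = ind \<rho>' t - ind \<rho> t" by simp
  qed
qed

lemma cis_inner_measurable: "(\<lambda>t. cis (t \<bullet> l)) \<in> borel_measurable (borel :: (real ^ 'd) measure)"
  by measurable

lemma fourier_set_dilate: "\<rho> \<ge> 0 \<Longrightarrow> fourier_set (dilate \<rho> K) l = fourier (ind \<rho>) l"
  unfolding fourier_set_def fourier_def using set_integral_dilate[of \<rho> "\<lambda>t. cis (t \<bullet> l)"] cis_inner_measurable
  by (simp add: scaleR_conv_of_real)

lemma fourier_set_dilate_diff:
  assumes "0 \<le> \<rho>" "\<rho> \<le> \<rho>'"
  shows "fourier_set (dilate \<rho>' K - dilate \<rho> K) l = fourier (\<lambda>t. ind \<rho>' t - ind \<rho> t) l"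
proof -
  have "dilate \<rho>' K - dilate \<rho> K \<in> sets lebesgue"
    using dilate_lmeasurable by (intro sets.Diff) (auto simp: fmeasurable_def)
  from set_integral_eq_lborel[OF this cis_inner_measurable _ AE_ind_diff[OF assms]] show ?thesis
    by (simp add: fourier_set_def fourier_def scaleR_conv_of_real)
qed

lemma integral_ind_mult:
  assumes "0 \<le> \<rho>" "0 \<le> \<rho>'"
  shows "(\<integral>t. ind \<rho> t * ind \<rho>' t \<partial>lborel) = measure lebesgue (dilate \<rho> K \<inter> dilate \<rho>' K)"
    and "integrable lborel (\<lambda>t. ind \<rho> t * ind \<rho>' t)"
proof -
  let ?A = "dilate \<rho> K \<inter> dilate \<rho>' K"
  have A: "?A \<in> lmeasurable" by (intro fmeasurable.Int dilate_lmeasurable)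
  have m: "(\<lambda>t. ind \<rho> t * ind \<rho>' t) \<in> borel_measurable lborel" by simp
  have ae: "AE t in lebesgue. (indicator ?A t :: real) = ind \<rho> t * ind \<rho>' t"
  proof (rule AE_completion)
    show "AE t in lborel. (indicator ?A t :: real) = ind \<rho> t * ind \<rho>' t"
      using AE_ind[OF assms(1)] AE_ind[OF assms(2)]
      by eventually_elim (simp add: indicator_inter_arith)
  qed
  have mA: "indicat_real ?A \<in> borel_measurable lebesgue" using A by (auto simp: fmeasurable_def)
  have iA: "integrable lebesgue (indicat_real ?A)"
    using A by (intro integrable_real_indicator) (auto simp: fmeasurable_def)
  have "integrable lebesgue (\<lambda>t. ind \<rho> t * ind \<rho>' t)"
    using iA integrable_cong_AE[OF mA measurable_completion[OF m] ae] by simp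
  then show "integrable lborel (\<lambda>t. ind \<rho> t * ind \<rho>' t)" by (simp add: integrable_completion[OF m])
  have "measure lebesgue ?A = (\<integral>t. indicat_real ?A t \<partial>lebesgue)" using A by (simp add: fmeasurable_def)
  also have "\<dots> = (\<integral>t. ind \<rho> t * ind \<rho>' t \<partial>lebesgue)"
    by (rule integral_cong_AE[OF mA measurable_completion[OF m] ae])
  also have "\<dots> = (\<integral>t. ind \<rho> t * ind \<rho>' t \<partial>lborel)" by (rule integral_completion[OF m])
  finally show "(\<integral>t. ind \<rho> t * ind \<rho>' t \<partial>lborel) = measure lebesgue ?A" ..
qed

lemma ind_square: "ind \<rho> t * ind \<rho> t = ind \<rho> t"
  by (simp add: ind_def indicator_def)

lemma integrable_ind: "integrable lborel (ind \<rho>)"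
proof (cases "\<rho> \<ge> 0")
  case True
  then show ?thesis using integral_ind_mult(2)[of \<rho> \<rho>] unfolding ind_square by simp
qed (simp add: ind_def[abs_def])

lemma integral_ind:
  assumes "\<rho> \<ge> 0"
  shows "(\<integral>t. ind \<rho> t \<partial>lborel) = \<rho> ^ CARD('d) * vol"
proof (cases "\<rho> = 0")
  case False
  have "dilate 1 K = K" by (simp add: dilate_def)
  then have 1: "(\<integral>t. ind 1 t \<partial>lborel) = vol"
    using integral_ind_mult(1)[of 1 1] by (simp add: ind_square)
  have "(\<integral>t. ind \<rho> t \<partial>lborel) = (\<integral>t. ind 1 (t /\<^sub>R \<rho>) \<partial>lborel)"
    using False assms ind_scale[of \<rho> 1] by simp
  also have "\<dots> = \<rho> ^ CARD('d) * vol"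
    using False assms by (subst integral_scale) (auto simp: 1)
  finally show ?thesis .
qed (simp add: ind_def)

lemma integral_abs_ind_diff:
  assumes "0 \<le> \<rho>" "\<rho> \<le> \<rho>'"
  shows "(\<integral>t. \<bar>ind \<rho>' t - ind \<rho> t\<bar> \<partial>lborel) = (\<rho>' ^ CARD('d) - \<rho> ^ CARD('d)) * vol"
proof -
  have "(\<integral>t. \<bar>ind \<rho>' t - ind \<rho> t\<bar> \<partial>lborel) = (\<integral>t. ind \<rho>' t - ind \<rho> t \<partial>lborel)"
  proof (rule integral_cong_AE)
    show "AE t in lborel. \<bar>ind \<rho>' t - ind \<rho> t\<bar> = ind \<rho>' t - ind \<rho> t"
      using AE_ind_mono[OF assms] by eventually_elim simp
  qed auto
  also have "\<dots> = (\<rho>' ^ CARD('d) - \<rho> ^ CARD('d)) * vol"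
    using assms by (simp add: integrable_ind integral_ind left_diff_distrib)
  finally show ?thesis .
qed

lemma tendsto_indicator_interior:
  assumes x: "(x \<longlongrightarrow> a) F" and a: "a \<notin> frontier K"
  shows "((\<lambda>n. indicator (interior K) (x n) :: real) \<longlongrightarrow> indicator (interior K) a) F"
proof (cases "a \<in> interior K")
  case True
  then have "eventually (\<lambda>n. x n \<in> interior K) F"
    using topological_tendstoD[OF x, of "interior K"] by simp
  then show ?thesis using True by (intro tendsto_eventually) (auto elim: eventually_mono)
next
  case False
  then have "a \<in> - closure K" using a by (simp add: frontier_def)
  then have "eventually (\<lambda>n. x n \<in> - closure K) F"
    by (intro topological_tendstoD[OF x]) auto
  then have "eventually (\<lambda>n. x n \<notin> interior K) F"
    by eventually_elim (use interior_subset[of K] closure_subset[of K] in blast)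
  then show ?thesis using False by (intro tendsto_eventually) (auto elim: eventually_mono)
qed

lemma AE_ind_tendsto:
  assumes r: "\<And>n. r n \<ge> 0" "r \<longlonglongrightarrow> \<rho>"
  shows "AE t in lborel. (\<lambda>n. ind (r n) t) \<longlonglongrightarrow> ind \<rho> t"
proof (cases "\<rho> > 0")
  case True
  show ?thesis
    using AE_scale[OF AE_frontier True]
  proof eventually_elim
    fix t assume t: "t /\<^sub>R \<rho> \<notin> frontier K"
    have "(\<lambda>n. t /\<^sub>R r n) \<longlonglongrightarrow> t /\<^sub>R \<rho>" using True by (intro tendsto_intros r) auto
    from tendsto_indicator_interior[OF this t]
    have "(\<lambda>n. indicator (interior K) (t /\<^sub>R r n) :: real) \<longlonglongrightarrow> ind \<rho> t" using True by (simp add: ind_def)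
    moreover from order_tendstoD(1)[OF r(2) True] have "eventually (\<lambda>n. indicator (interior K) (t /\<^sub>R r n) = ind (r n) t) sequentially"
      by eventually_elim (simp add: ind_def)
    ultimately show "(\<lambda>n. ind (r n) t) \<longlonglongrightarrow> ind \<rho> t"
      by (rule Lim_transform_eventually)
  qed
next
  case False
  then have 0: "\<rho> = 0" using LIMSEQ_le_const[OF r(2), of 0] r(1) by force
  obtain B where B: "B > 0" "\<And>x. x \<in> K \<Longrightarrow> norm x \<le> B" using bounded_K by (auto simp: bounded_pos)
  have "AE t in lborel. t \<noteq> (0 :: real ^ 'd)" by (rule AE_lborel_singleton)
  then show ?thesis
  proof eventually_elim
    fix t :: "real ^ 'd" assume t: "t \<noteq> 0"
    have "eventually (\<lambda>n. r n < norm t / B) sequentially"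
      by (rule order_tendstoD(2)[OF r(2)]) (use t B 0 in auto)
    then have "eventually (\<lambda>n. ind (r n) t = ind \<rho> t) sequentially"
    proof eventually_elim
      fix n assume n: "r n < norm t / B"
      have "t /\<^sub>R r n \<notin> K" if "r n > 0"
      proof
        assume "t /\<^sub>R r n \<in> K"
        then have "norm t / r n \<le> B" using B(2)[of "t /\<^sub>R r n"] that by (simp add: divide_inverse mult.commute)
        then show False using n that B(1) by (simp add: field_simps)
      qed
      then show "ind (r n) t = ind \<rho> t" using interior_subset[of K] by (auto simp: ind_def 0 indicator_def)
    qed
    then show "(\<lambda>n. ind (r n) t) \<longlonglongrightarrow> ind \<rho> t" by (rule tendsto_eventually)
  qed
qed

lemma AE_ind_translate:
  assumes h: "(h \<longlongrightarrow> 0) sequentially"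
  shows "AE t in lborel. (\<lambda>n. ind \<rho> (t - h n)) \<longlonglongrightarrow> ind \<rho> t"
proof (cases "\<rho> > 0")
  case True
  show ?thesis
    using AE_scale[OF AE_frontier True]
  proof eventually_elim
    fix t assume t: "t /\<^sub>R \<rho> \<notin> frontier K"
    have "(\<lambda>n. (t - h n) /\<^sub>R \<rho>) \<longlonglongrightarrow> (t - 0) /\<^sub>R \<rho>" by (intro tendsto_intros h)
    then show "(\<lambda>n. ind \<rho> (t - h n)) \<longlonglongrightarrow> ind \<rho> t"
      using tendsto_indicator_interior[of "\<lambda>n. (t - h n) /\<^sub>R \<rho>"] t True by (simp add: ind_def)
  qed
qed (simp add: ind_def)

text \<open>
  Integrals over a continuously growing dilate are continuous, because the indicators converge off a
  null frontier.
\<close>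
lemma continuous_on_ind_integral:
  fixes x :: "real ^ 'd \<Rightarrow> real" and S :: "real set"
  assumes x: "integrable lborel (\<lambda>t. ind R t * x t)" "x \<in> borel_measurable borel"
    and r: "continuous_on S r" "\<And>u. u \<in> S \<Longrightarrow> 0 \<le> r u \<and> r u \<le> R"
  shows "continuous_on S (\<lambda>u. \<integral>t. ind (r u) t * x t \<partial>lborel)"
  unfolding continuous_on_sequentially
proof (intro allI ballI impI)
  fix v u assume u: "u \<in> S" and "(\<forall>n. v n \<in> S) \<and> v \<longlonglongrightarrow> u"
  then have v: "\<forall>n. v n \<in> S" "v \<longlonglongrightarrow> u" by auto
  have rv: "(\<lambda>n. r (v n)) \<longlonglongrightarrow> r u" using r(1) u v unfolding continuous_on_sequentially by (auto simp: o_def)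
  have [measurable]: "x \<in> borel_measurable borel" by fact
  show "((\<lambda>u. \<integral>t. ind (r u) t * x t \<partial>lborel) \<circ> v) \<longlonglongrightarrow> (\<integral>t. ind (r u) t * x t \<partial>lborel)"
    unfolding o_def
  proof (rule integral_dominated_convergence[where w = "\<lambda>t. \<bar>ind R t * x t\<bar>"])
    show "AE t in lborel. (\<lambda>n. ind (r (v n)) t * x t) \<longlonglongrightarrow> ind (r u) t * x t"
    proof -
      have "AE t in lborel. (\<lambda>n. ind (r (v n)) t) \<longlonglongrightarrow> ind (r u) t"
        using r(2) v rv by (intro AE_ind_tendsto) auto
      then show ?thesis by eventually_elim (intro tendsto_intros)
    qed
    show "AE t in lborel. norm (ind (r (v n)) t * x t) \<le> \<bar>ind R t * x t\<bar>" for n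
    proof -
      have "AE t in lborel. ind (r (v n)) t \<le> ind R t" using r(2) v by (intro AE_ind_mono) auto
      then show ?thesis
      proof eventually_elim
        fix t assume "ind (r (v n)) t \<le> ind R t"
        then show "norm (ind (r (v n)) t * x t) \<le> \<bar>ind R t * x t\<bar>"
          using ind_bounds(1)[of "r (v n)" t] ind_bounds(1)[of R t] by (simp add: abs_mult mult_right_mono)
      qed
    qed
  qed (use x in auto)
qed

end

section \<open>Second moments and decay of higher cumulants\<close>

context moment_field
begin

text \<open>The covariance function of the field.\<close>
definition covar :: "real ^ 'd \<Rightarrow> real" where
  "covar h = (\<integral>\<omega>. X h \<omega> * X 0 \<omega> \<partial>M)"

lemma moment_1:
  assumes "\<psi> \<in> borel_measurable borel" "integrable lborel \<psi>"
  shows "moment \<psi> 1 = 0"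
proof -
  have "moment \<psi> 1 = (\<integral>t. \<psi> (t 0) * (\<integral>\<omega>. X (t 0) \<omega> \<partial>M) \<partial>(\<Pi>\<^sub>M i\<in>{0::nat}. lborel))"
    using prod_moments_eq_integral(2)[OF assms, of "{0::nat}" "{{0}}"]
    by (simp add: moment_def partition_on_def)
  then show ?thesis by (simp add: mean_zero)
qed

text \<open>
  The second moment as an integral of the covariance function against the autocorrelation of \<open>\<psi>\<close>. Boundedness of \<open>\<psi>\<close>
  makes the double integral absolutely convergent.
\<close>
lemma moment_2_eq:
  assumes psi_m[measurable]: "\<psi> \<in> borel_measurable borel" and psi: "integrable lborel \<psi>"
    and bd: "\<And>t. \<bar>\<psi> t\<bar> \<le> C" and cov: "integrable lborel covar"
  shows "moment \<psi> 2 = (\<integral>h. covar h * (\<integral>t. \<psi> t * \<psi> (t - h) \<partial>lborel) \<partial>lborel)"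
proof -
  have cov_m[measurable]: "covar \<in> borel_measurable borel" using cov by auto
  let ?I = "{0, 1 :: nat}"
  let ?f = "\<lambda>t. \<psi> (t 0) * \<psi> (t 1) * covar (t 0 - t 1)"
  have e: "(\<integral>\<omega>. X s \<omega> * X t \<omega> \<partial>M) = covar (s - t)" for s t
    unfolding covar_def by (rule covariance_shift)
  have P: "partition_on ?I {?I}" by (rule partition_on_space) simp
  have int: "integrable (\<Pi>\<^sub>M i\<in>?I. lborel) ?f"
    using prod_moments_eq_integral(1)[OF psi_m psi _ P] by (simp add: e)
  have "moment \<psi> 2 = (\<integral>t. ?f t \<partial>(\<Pi>\<^sub>M i\<in>?I. lborel))"
    using prod_moments_eq_integral(2)[OF psi_m psi _ P] by (simp add: moment_def e numeral_2_eq_2)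
  also have "\<dots> = (\<integral>t. ?f t \<partial>(\<Pi>\<^sub>M i\<in>insert 1 {0::nat}. lborel))"
    by (simp add: insert_commute)
  also have "\<dots> = (\<integral>x. (\<integral>y. ?f (x(1 := y)) \<partial>lborel) \<partial>(\<Pi>\<^sub>M i\<in>{0::nat}. lborel))"
    by (rule pos.product_integral_insert) (use int in \<open>auto simp: insert_commute\<close>)
  also have "\<dots> = (\<integral>x. (\<lambda>s. \<integral>y. \<psi> s * \<psi> y * covar (s - y) \<partial>lborel) (x 0) \<partial>(\<Pi>\<^sub>M i\<in>{0::nat}. lborel))"
    by simp
  also have "\<dots> = (\<integral>s. (\<integral>y. \<psi> s * \<psi> y * covar (s - y) \<partial>lborel) \<partial>lborel)"
    by (rule pos.product_integral_singleton) measurable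
  also have "\<dots> = (\<integral>s. (\<integral>h. covar h * (\<psi> s * \<psi> (s - h)) \<partial>lborel) \<partial>lborel)"
  proof (rule Bochner_Integration.integral_cong[OF refl])
    fix s :: "real ^ 'd"
    have "(lborel :: (real ^ 'd) measure) = distr lborel borel (\<lambda>h. s + (- 1) *\<^sub>R h)"
      using lborel_affine[of "- 1" s] by (simp add: density_1)
    then have "(\<integral>y. \<psi> s * \<psi> y * covar (s - y) \<partial>lborel) = (\<integral>y. \<psi> s * \<psi> y * covar (s - y) \<partial>(distr lborel borel (\<lambda>h. s + (- 1) *\<^sub>R h)))"
      by (rule arg_cong)
    also have "\<dots> = (\<integral>h. covar h * (\<psi> s * \<psi> (s - h)) \<partial>lborel)"
      by (subst integral_distr) (auto simp: mult_ac)
    finally show "(\<integral>y. \<psi> s * \<psi> y * covar (s - y) \<partial>lborel) = (\<integral>h. covar h * (\<psi> s * \<psi> (s - h)) \<partial>lborel)" .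
  qed
  also have "\<dots> = (\<integral>h. (\<integral>s. covar h * (\<psi> s * \<psi> (s - h)) \<partial>lborel) \<partial>lborel)"
  proof (rule lborel_pair.Fubini_integral[symmetric])
    let ?g = "\<lambda>(s, h). covar h * (\<psi> s * \<psi> (s - h))"
    have m: "?g \<in> borel_measurable (lborel \<Otimes>\<^sub>M lborel)" by measurable
    have C0: "C \<ge> 0" using bd[of 0] by linarith
    have le: "norm (?g (s, h)) \<le> \<bar>covar h\<bar> * (\<bar>\<psi> s\<bar> * C)" for s h
      using bd[of "s - h"] by (simp add: abs_mult mult_left_mono)
    have inn: "integrable lborel (\<lambda>h. \<bar>covar h\<bar> * (\<bar>\<psi> s\<bar> * C))" for s using cov by simp
    show "integrable (lborel \<Otimes>\<^sub>M lborel) ?g"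
    proof (rule integrableI_bounded[OF m])
      have "(\<integral>\<^sup>+x. ennreal (norm (?g x)) \<partial>(lborel \<Otimes>\<^sub>M lborel)) = (\<integral>\<^sup>+s. \<integral>\<^sup>+h. ennreal (norm (?g (s, h))) \<partial>lborel \<partial>lborel)"
        using m by (intro lborel.nn_integral_fst[symmetric]) simp
      also have "\<dots> \<le> (\<integral>\<^sup>+s. \<integral>\<^sup>+h. ennreal (\<bar>\<psi> s\<bar> * C) * ennreal \<bar>covar h\<bar> \<partial>lborel \<partial>lborel)"
      proof (intro nn_integral_mono)
        fix s h
        show "ennreal (norm (?g (s, h))) \<le> ennreal (\<bar>\<psi> s\<bar> * C) * ennreal \<bar>covar h\<bar>"
          using le[of s h] C0 by (simp add: ennreal_mult[symmetric] ennreal_leI mult.commute)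
      qed
      also have "\<dots> = (\<integral>\<^sup>+s. ennreal (\<bar>\<psi> s\<bar> * C) * (\<integral>\<^sup>+h. ennreal \<bar>covar h\<bar> \<partial>lborel) \<partial>lborel)"
        by (intro nn_integral_cong nn_integral_cmult) measurable
      also have "\<dots> = (\<integral>\<^sup>+s. ennreal (\<bar>\<psi> s\<bar> * C) \<partial>lborel) * (\<integral>\<^sup>+h. ennreal \<bar>covar h\<bar> \<partial>lborel)"
        by (rule nn_integral_multc) measurable
      also have "\<dots> = ennreal (\<integral>s. \<bar>\<psi> s\<bar> * C \<partial>lborel) * ennreal (\<integral>h. \<bar>covar h\<bar> \<partial>lborel)"
        using psi cov C0 by (intro arg_cong2[where f = "(*)"] nn_integral_eq_integral) auto
      also have "\<dots> < \<infinity>" by (simp add: ennreal_mult_less_top)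
      finally show "(\<integral>\<^sup>+x. ennreal (norm (?g x)) \<partial>(lborel \<Otimes>\<^sub>M lborel)) < \<infinity>" .
    qed
  qed
  finally show ?thesis by simp
qed

lemma integrable_shift_product:
  fixes \<psi> :: "real ^ 'd \<Rightarrow> real"
  assumes [measurable]: "\<psi> \<in> borel_measurable borel" and psi: "integrable lborel \<psi>" and bd: "\<And>t. \<bar>\<psi> t\<bar> \<le> C"
  shows "integrable lborel (\<lambda>t. \<psi> t * \<psi> (t - h))" "\<bar>\<integral>t. \<psi> t * \<psi> (t - h) \<partial>lborel\<bar> \<le> C * (\<integral>t. \<bar>\<psi> t\<bar> \<partial>lborel)"
proof -
  have le: "\<bar>\<psi> t * \<psi> (t - h)\<bar> \<le> C * \<bar>\<psi> t\<bar>" for t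
  proof -
    have "\<bar>\<psi> t\<bar> * \<bar>\<psi> (t - h)\<bar> \<le> \<bar>\<psi> t\<bar> * C" by (intro mult_left_mono bd) simp
    then show ?thesis by (simp add: abs_mult mult.commute)
  qed
  have ci: "integrable lborel (\<lambda>t. C * \<bar>\<psi> t\<bar>)" using psi by simp
  have C0: "C \<ge> 0" using bd[of 0] by linarith
  show 1: "integrable lborel (\<lambda>t. \<psi> t * \<psi> (t - h))"
    by (rule Bochner_Integration.integrable_bound[OF ci]) (use le C0 in \<open>auto simp: abs_mult\<close>)
  have "\<bar>\<integral>t. \<psi> t * \<psi> (t - h) \<partial>lborel\<bar> \<le> (\<integral>t. \<bar>\<psi> t * \<psi> (t - h)\<bar> \<partial>lborel)" by (rule integral_abs_bound)
  also have "\<dots> \<le> (\<integral>t. C * \<bar>\<psi> t\<bar> \<partial>lborel)"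
    by (rule integral_mono) (use 1 ci le in auto)
  finally show "\<bar>\<integral>t. \<psi> t * \<psi> (t - h) \<partial>lborel\<bar> \<le> C * (\<integral>t. \<bar>\<psi> t\<bar> \<partial>lborel)" by simp
qed

lemma abs_moment_2_le:
  assumes psi_m[measurable]: "\<psi> \<in> borel_measurable borel" and psi: "integrable lborel \<psi>"
    and bd: "\<And>t. \<bar>\<psi> t\<bar> \<le> C" and cov: "integrable lborel covar"
  shows "\<bar>moment \<psi> 2\<bar> \<le> (\<integral>h. \<bar>covar h\<bar> \<partial>lborel) * (C * (\<integral>t. \<bar>\<psi> t\<bar> \<partial>lborel))"
proof -
  let ?D = "C * (\<integral>t. \<bar>\<psi> t\<bar> \<partial>lborel)"
  have cov_m[measurable]: "covar \<in> borel_measurable borel" using cov by auto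
  have C0: "C \<ge> 0" using bd[of 0] by linarith
  have le: "\<bar>covar h * (\<integral>t. \<psi> t * \<psi> (t - h) \<partial>lborel)\<bar> \<le> \<bar>covar h\<bar> * ?D" for h
    using integrable_shift_product(2)[OF psi_m psi bd, of h] by (simp add: abs_mult mult_left_mono)
  have Di: "integrable lborel (\<lambda>h. \<bar>covar h\<bar> * ?D)" using cov by simp
  have i: "integrable lborel (\<lambda>h. covar h * (\<integral>t. \<psi> t * \<psi> (t - h) \<partial>lborel))"
  proof (rule Bochner_Integration.integrable_bound[OF Di])
    show "AE h in lborel. norm (covar h * (\<integral>t. \<psi> t * \<psi> (t - h) \<partial>lborel)) \<le> norm (\<bar>covar h\<bar> * ?D)"
      unfolding real_norm_def by (intro AE_I2 order_trans[OF le abs_ge_self])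
  qed measurable
  have "\<bar>moment \<psi> 2\<bar> \<le> (\<integral>h. \<bar>covar h * (\<integral>t. \<psi> t * \<psi> (t - h) \<partial>lborel)\<bar> \<partial>lborel)"
    unfolding moment_2_eq[OF assms] by (rule integral_abs_bound)
  also have "\<dots> \<le> (\<integral>h. \<bar>covar h\<bar> * ?D \<partial>lborel)"
    by (rule integral_mono) (use i Di le in auto)
  finally show ?thesis by simp
qed

text \<open>
  After rescaling, the autocorrelation at \<open>h\<close> is the one of \<open>\<Psi>\<close> at \<open>h / T\<close>, and it tends to \<open>\<integral> \<Psi>\<^sup>2\<close>. The
  translation continuity needed for this is assumed almost everywhere, as it holds for indicators of convex
  sets.
\<close>
lemma moment_2_tendsto:
  assumes psi_m[measurable]: "\<Psi> \<in> borel_measurable borel" and psi: "integrable lborel \<Psi>"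
    and bd: "\<And>t. \<bar>\<Psi> t\<bar> \<le> C" and cov: "integrable lborel covar"
    and cont: "\<And>h :: nat \<Rightarrow> real ^ 'd. h \<longlonglongrightarrow> 0 \<Longrightarrow> AE t in lborel. (\<lambda>n. \<Psi> (t - h n)) \<longlonglongrightarrow> \<Psi> t"
  shows "((\<lambda>T. moment (rescaled \<Psi> T) 2) \<longlongrightarrow> (\<integral>h. covar h \<partial>lborel) * (\<integral>t. \<Psi> t * \<Psi> t \<partial>lborel)) at_top"
proof (rule tendsto_at_topI_sequentially)
  fix S :: "nat \<Rightarrow> real" assume S: "filterlim S at_top sequentially"
  have cov_m[measurable]: "covar \<in> borel_measurable borel" using cov by auto
  let ?D = "C * (\<integral>t. \<bar>\<Psi> t\<bar> \<partial>lborel)"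
  have C0: "C \<ge> 0" using bd[of 0] by linarith
  have inner: "(\<lambda>n. \<integral>x. \<Psi> x * \<Psi> (x - h /\<^sub>R S n) \<partial>lborel) \<longlonglongrightarrow> (\<integral>t. \<Psi> t * \<Psi> t \<partial>lborel)" for h
  proof (rule integral_dominated_convergence[where w = "\<lambda>t. C * \<bar>\<Psi> t\<bar>"])
    have "(\<lambda>n. inverse (S n)) \<longlonglongrightarrow> 0"
      by (rule tendsto_inverse_0_at_top[OF S])
    then have "(\<lambda>n. h /\<^sub>R S n) \<longlonglongrightarrow> 0 *\<^sub>R h" by (intro tendsto_intros)
    then have "AE t in lborel. (\<lambda>n. \<Psi> (t - h /\<^sub>R S n)) \<longlonglongrightarrow> \<Psi> t" by (intro cont) simp
    then show "AE t in lborel. (\<lambda>n. \<Psi> t * \<Psi> (t - h /\<^sub>R S n)) \<longlonglongrightarrow> \<Psi> t * \<Psi> t"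
      by eventually_elim (intro tendsto_intros)
    show "AE t in lborel. norm (\<Psi> t * \<Psi> (t - h /\<^sub>R S n)) \<le> C * \<bar>\<Psi> t\<bar>" for n
    proof (rule AE_I2)
      fix t
      have "\<bar>\<Psi> t\<bar> * \<bar>\<Psi> (t - h /\<^sub>R S n)\<bar> \<le> \<bar>\<Psi> t\<bar> * C" by (intro mult_left_mono bd) simp
      then show "norm (\<Psi> t * \<Psi> (t - h /\<^sub>R S n)) \<le> C * \<bar>\<Psi> t\<bar>" by (simp add: abs_mult mult.commute)
    qed
  qed (use psi in auto)
  have "(\<lambda>n. \<integral>h. covar h * (\<integral>x. \<Psi> x * \<Psi> (x - h /\<^sub>R S n) \<partial>lborel) \<partial>lborel) \<longlonglongrightarrow>
      (\<integral>h. covar h * (\<integral>t. \<Psi> t * \<Psi> t \<partial>lborel) \<partial>lborel)"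
  proof (rule integral_dominated_convergence[where w = "\<lambda>h. \<bar>covar h\<bar> * ?D"])
    show "AE h in lborel. norm (covar h * (\<integral>x. \<Psi> x * \<Psi> (x - h /\<^sub>R S n) \<partial>lborel)) \<le> \<bar>covar h\<bar> * ?D" for n
      using integrable_shift_product(2)[OF psi_m psi bd] by (intro AE_I2) (simp add: abs_mult mult_left_mono)
    show "AE h in lborel. (\<lambda>n. covar h * (\<integral>x. \<Psi> x * \<Psi> (x - h /\<^sub>R S n) \<partial>lborel)) \<longlonglongrightarrow> covar h * (\<integral>t. \<Psi> t * \<Psi> t \<partial>lborel)"
      by (intro AE_I2 tendsto_intros inner)
  qed (use cov in auto)
  moreover have "eventually (\<lambda>n. (\<integral>h. covar h * (\<integral>x. \<Psi> x * \<Psi> (x - h /\<^sub>R S n) \<partial>lborel) \<partial>lborel) = moment (rescaled \<Psi> (S n)) 2) sequentially"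
  proof -
    have "eventually (\<lambda>n. S n > 0) sequentially" using S by (simp add: filterlim_at_top_dense)
    then show ?thesis
    proof eventually_elim
      fix n assume n: "S n > 0"
      have "\<bar>rescaled \<Psi> (S n) t\<bar> \<le> C / S n powr (real CARD('d) / 2)" for t
        unfolding rescaled_def abs_divide using bd n by (simp add: divide_right_mono)
      from moment_2_eq[OF rescaled_measurable[OF psi_m] rescaled_integrable[OF psi n] this cov]
      show "(\<integral>h. covar h * (\<integral>x. \<Psi> x * \<Psi> (x - h /\<^sub>R S n) \<partial>lborel) \<partial>lborel) = moment (rescaled \<Psi> (S n)) 2"
        by (simp add: integral_rescaled_shift[OF psi_m n])
    qed
  qed
  ultimately show "(\<lambda>n. moment (rescaled \<Psi> (S n)) 2) \<longlonglongrightarrow> (\<integral>h. covar h \<partial>lborel) * (\<integral>t. \<Psi> t * \<Psi> t \<partial>lborel)"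
    by (simp add: Lim_transform_eventually)
qed

text \<open>
  The product of Fourier transforms is bounded in \<open>L\<^sup>q\<close> with \<open>q = 2 (k - 1) / k\<close>, the dual exponent to the one
  assumed for \<open>f k\<close>, and tends to \<open>0\<close> in the space with exponent \<open>s (k - 1) / k\<close>. The condition \<open>s > 3 / 2\<close>
  makes the latter exponent larger than \<open>1\<close> for all \<open>k \<ge> 3\<close>.
\<close>
lemma partition_cumulant_tendsto_0:
  assumes psi_m[measurable]: "\<Psi> \<in> borel_measurable borel" and psi: "integrable lborel \<Psi>"
    and f: "cumulant_spectral_densities M X f" and k: "k \<ge> 3"
    and fk: "in_Lp (2 * (real k - 1) / (real k - 2)) (freq_space k) (f k)"
    and s: "3 / 2 < s" "s < 2" and Ls: "(\<integral>\<^sup>+l. ennreal (norm (fourier \<Psi> l) powr s) \<partial>lborel) < \<infinity>"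
    and L2: "(\<integral>\<^sup>+l. ennreal (norm (fourier \<Psi> l) powr 2) \<partial>lborel) < \<infinity>"
  shows "((\<lambda>T. partition_cumulant (moment (rescaled \<Psi> T)) k) \<longlongrightarrow> 0) at_top"
proof -
  define p q where "p = 2 * (real k - 1) / (real k - 2)" and "q = 2 * (real k - 1) / real k"
  define q' where "q' = s * (real k - 1) / real k"
  define p' where "p' = q' / (q' - 1)"
  have pq: "p > 1" "q > 1" "1 / p + 1 / q = 1"
  proof -
    show "p > 1" "q > 1" using k by (auto simp: p_def q_def less_divide_eq_1_pos)
    have "1 / p + 1 / q = ((real k - 2) + real k) / (2 * (real k - 1))"
      unfolding p_def q_def add_divide_distrib by simp
    also have "(real k - 2) + real k = 2 * (real k - 1)" by simp
    finally show "1 / p + 1 / q = 1" using k by simp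
  qed
  have q1: "q' > 1"
  proof -
    have "real k \<le> (3 / 2) * (real k - 1)" using k by simp
    also have "\<dots> < s * (real k - 1)" using s k by (intro mult_strict_right_mono) auto
    finally show ?thesis using k by (simp add: q'_def)
  qed
  have pq': "p' > 1" "1 / p' + 1 / q' = 1" "q' < q"
  proof -
    show "p' > 1" using q1 by (simp add: p'_def less_divide_eq_1_pos)
    have "1 / p' + 1 / q' = (q' - 1 + 1) / q'" unfolding p'_def add_divide_distrib by simp
    then show "1 / p' + 1 / q' = 1" using q1 by simp
    show "q' < q" unfolding q_def q'_def using s k by (intro divide_strict_right_mono mult_strict_right_mono) auto
  qed
  define G where "G T l = (\<Prod>j\<in>{1..k}. norm (fourier (rescaled \<Psi> T) (last_freq k l j)))" for T l
  have Gm: "G T \<in> borel_measurable (freq_space k)" for T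
  proof -
    have "(\<lambda>x. norm (fourier (rescaled \<Psi> T) x)) \<in> borel_measurable borel" by measurable
    from measurable_compose[OF measurable_last_freq this]
    show ?thesis unfolding G_def by (intro borel_measurable_prod) auto
  qed
  have G0: "G T l \<ge> 0" for T l unfolding G_def by (intro prod_nonneg) auto
  have Gs: "(\<integral>\<^sup>+l. ennreal (G T l powr (\<sigma> * (real k - 1) / real k)) \<partial>freq_space k) \<le>
      (ennreal (T powr (real CARD('d) * (\<sigma> / 2 - 1))) * (\<integral>\<^sup>+l. ennreal (norm (fourier \<Psi> l) powr \<sigma>) \<partial>lborel)) ^ (k - 1)"
    if "T > 0" "\<sigma> > 0" for T \<sigma>
  proof -
    have "(\<lambda>x. norm (fourier (rescaled \<Psi> T) x)) \<in> borel_measurable borel" by measurable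
    from nn_integral_freq_prod_le[OF this _ _ that(2), of k] k show ?thesis
      unfolding G_def nn_integral_fourier_rescaled[OF psi_m that(1)] by simp
  qed
  let ?V = "\<integral>\<^sup>+l. ennreal (norm (fourier \<Psi> l) powr 2) \<partial>lborel"
  let ?S = "\<integral>\<^sup>+l. ennreal (norm (fourier \<Psi> l) powr s) \<partial>lborel"
  have lim: "((\<lambda>T. \<integral>\<^sup>+l. ennreal (norm (f k l) * G T l) \<partial>freq_space k) \<longlongrightarrow> 0) at_top"
  proof (rule nn_integral_mult_tendsto_0[OF _ Gm _ G0 pq pq'(1) q1 pq'(2,3)])
    show "(\<lambda>l. norm (f k l)) \<in> borel_measurable (freq_space k)" "integrable (freq_space k) (\<lambda>l. norm (f k l) powr p)"
      using fk by (auto simp: in_Lp_def p_def)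
    show "eventually (\<lambda>T. (\<integral>\<^sup>+l. ennreal (G T l powr q) \<partial>freq_space k) \<le> ennreal (enn2real (?V ^ (k - 1)))) at_top"
      using eventually_gt_at_top[of 0]
    proof eventually_elim
      fix T :: real assume T: "T > 0"
      have "?V ^ (k - 1) < \<infinity>" using L2 by (simp add: power_less_top_ennreal)
      then show "(\<integral>\<^sup>+l. ennreal (G T l powr q) \<partial>freq_space k) \<le> ennreal (enn2real (?V ^ (k - 1)))"
        using Gs[OF T, of 2] T by (simp add: q_def)
    qed
    show "((\<lambda>T. \<integral>\<^sup>+l. ennreal (G T l powr q') \<partial>freq_space k) \<longlongrightarrow> 0) at_top"
    proof (rule tendsto_sandwich[where f = "\<lambda>_. 0"])
      show "eventually (\<lambda>T. (\<integral>\<^sup>+l. ennreal (G T l powr q') \<partial>freq_space k) \<le>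
          (ennreal (T powr (real CARD('d) * (s / 2 - 1))) * ?S) ^ (k - 1)) at_top"
        using eventually_gt_at_top[of 0]
      proof eventually_elim
        fix T :: real assume "T > 0"
        then show "(\<integral>\<^sup>+l. ennreal (G T l powr q') \<partial>freq_space k) \<le>
          (ennreal (T powr (real CARD('d) * (s / 2 - 1))) * ?S) ^ (k - 1)"
          using Gs[of T s] s unfolding q'_def by simp
      qed
      have "((\<lambda>T. T powr (real CARD('d) * (s / 2 - 1))) \<longlongrightarrow> 0) at_top"
        using s by (intro tendsto_neg_powr filterlim_ident) (simp add: mult_pos_neg)
      then have "((\<lambda>T. ((T powr (real CARD('d) * (s / 2 - 1))) * enn2real ?S) ^ (k - 1)) \<longlongrightarrow> (0 * enn2real ?S) ^ (k - 1)) at_top"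
        by (intro tendsto_intros)
      then have "((\<lambda>T. ennreal (((T powr (real CARD('d) * (s / 2 - 1))) * enn2real ?S) ^ (k - 1))) \<longlongrightarrow> ennreal ((0 * enn2real ?S) ^ (k - 1))) at_top"
        by (rule tendsto_ennrealI)
      moreover have "ennreal (((T powr (real CARD('d) * (s / 2 - 1))) * enn2real ?S) ^ (k - 1)) = (ennreal (T powr (real CARD('d) * (s / 2 - 1))) * ?S) ^ (k - 1)" for T
        using Ls by (simp add: ennreal_power[symmetric] ennreal_mult')
      moreover have "(0 * enn2real ?S) ^ (k - 1) = 0" using k by simp
      ultimately show "((\<lambda>T. (ennreal (T powr (real CARD('d) * (s / 2 - 1))) * ?S) ^ (k - 1)) \<longlongrightarrow> 0) at_top"
        by (simp only: ennreal_0)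
    qed auto
  qed auto
  show ?thesis
  proof (rule tendsto_rabs_zero_cancel)
    have "((\<lambda>T. ennreal \<bar>partition_cumulant (moment (rescaled \<Psi> T)) k\<bar>) \<longlongrightarrow> 0) at_top"
    proof (rule tendsto_sandwich[where f = "\<lambda>_. 0", OF _ _ tendsto_const lim])
      show "eventually (\<lambda>T. ennreal \<bar>partition_cumulant (moment (rescaled \<Psi> T)) k\<bar> \<le>
          (\<integral>\<^sup>+l. ennreal (norm (f k l) * G T l) \<partial>freq_space k)) at_top"
        using eventually_gt_at_top[of 0]
      proof eventually_elim
        fix T :: real assume "T > 0"
        then show "ennreal \<bar>partition_cumulant (moment (rescaled \<Psi> T)) k\<bar> \<le> (\<integral>\<^sup>+l. ennreal (norm (f k l) * G T l) \<partial>freq_space k)"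
          unfolding G_def using k by (intro abs_partition_cumulant_le rescaled_measurable rescaled_integrable psi psi_m f) auto
      qed
    qed auto
    then show "((\<lambda>T. \<bar>partition_cumulant (moment (rescaled \<Psi> T)) k\<bar>) \<longlongrightarrow> 0) at_top"
      by (intro tendsto_ennrealD) auto
  qed
qed

end

section \<open>Moments and characteristic functions of Gaussian limits\<close>

text \<open>
  The partition into a single block contributes the moment of order \<open>n\<close> to the cumulant of order \<open>n\<close>; all other partitions
  involve moments of lower order only.
\<close>
lemma moments_tendsto_from_cumulants:
  fixes m :: "'t \<Rightarrow> nat \<Rightarrow> real" and \<mu> :: "nat \<Rightarrow> real"
  assumes cum: "\<And>n. n \<ge> 1 \<Longrightarrow> ((\<lambda>T. partition_cumulant (m T) n) \<longlongrightarrow> partition_cumulant \<mu> n) F"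
    and n: "n \<ge> 1"
  shows "((\<lambda>T. m T n) \<longlongrightarrow> \<mu> n) F"
  using n
proof (induction n rule: less_induct)
  case (less n)
  let ?P = "{\<pi>. partition_on {1..n} \<pi>}" and ?t = "{{1..n}}"
  let ?c = "\<lambda>m \<pi>. (- 1) ^ (card \<pi> - 1) * fact (card \<pi> - 1) * (\<Prod>B\<in>\<pi>. m (card B)) :: real"
  have fin: "finite ?P" by (rule finitely_many_partition_on) simp
  have top: "?t \<in> ?P" using less.prems partition_on_space[of "{1..n}"] by simp
  have split: "m n = partition_cumulant m n - (\<Sum>\<pi>\<in>?P - {?t}. ?c m \<pi>)" for m
  proof -
    have "partition_cumulant m n = ?c m ?t + (\<Sum>\<pi>\<in>?P - {?t}. ?c m \<pi>)"
      unfolding partition_cumulant_def by (rule sum.remove[OF fin top])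
    moreover have "?c m ?t = m n" by simp
    ultimately show ?thesis by linarith
  qed
  have small: "1 \<le> card B \<and> card B < n" if \<pi>: "\<pi> \<in> ?P - {?t}" and B: "B \<in> \<pi>" for \<pi> B
  proof -
    have p: "\<Union>\<pi> = {1..n}" "disjoint \<pi>" "{} \<notin> \<pi>" using \<pi> by (auto simp: partition_on_def)
    have sub: "B \<subseteq> {1..n}" using p(1) B by blast
    have "B \<noteq> {1..n}"
    proof
      assume eq: "B = {1..n}"
      have "C = B" if C: "C \<in> \<pi>" for C
      proof (rule ccontr)
        assume "C \<noteq> B"
        then have "C \<inter> B = {}" using p(2) B C unfolding disjoint_def by blast
        moreover have "C \<subseteq> B" using p(1) C unfolding eq by blast
        ultimately have "C = {}" by blast
        then show False using p(3) C by simp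
      qed
      then have "\<pi> = ?t" using B eq by blast
      then show False using \<pi> by simp
    qed
    then have "card B < card {1..n}" using sub by (intro psubset_card_mono) auto
    moreover have "finite B" using sub finite_subset by blast
    moreover have "B \<noteq> {}" using p(3) B by blast
    ultimately show ?thesis by (simp add: card_gt_0_iff Suc_le_eq)
  qed
  have "((\<lambda>T. partition_cumulant (m T) n - (\<Sum>\<pi>\<in>?P - {?t}. ?c (m T) \<pi>)) \<longlongrightarrow>
      partition_cumulant \<mu> n - (\<Sum>\<pi>\<in>?P - {?t}. ?c \<mu> \<pi>)) F"
  proof (rule tendsto_diff[OF cum[OF less.prems] tendsto_sum])
    fix \<pi> assume \<pi>: "\<pi> \<in> ?P - {?t}"
    have "((\<lambda>T. \<Prod>B\<in>\<pi>. m T (card B)) \<longlongrightarrow> (\<Prod>B\<in>\<pi>. \<mu> (card B))) F"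
    proof (rule tendsto_prod)
      fix B assume "B \<in> \<pi>"
      from small[OF \<pi> this] show "((\<lambda>T. m T (card B)) \<longlongrightarrow> \<mu> (card B)) F" by (intro less.IH) auto
    qed
    then show "((\<lambda>T. ?c (m T) \<pi>) \<longlongrightarrow> ?c \<mu> \<pi>) F" by (rule tendsto_mult_left)
  qed
  then show ?case by (simp only: split[symmetric])
qed

lemma gaussian_moment_odd: "odd n \<Longrightarrow> gaussian_moment v n = 0"
  by (simp add: gaussian_moment_def)

lemma gaussian_moment_even: "gaussian_moment v (2 * j) / fact (2 * j) = (v / 2) ^ j / fact j"
  by (simp add: gaussian_moment_def)

lemma gaussian_moment_simps: "gaussian_moment v 1 = 0" "gaussian_moment v 2 = v" "gaussian_moment v 4 = 3 * v\<^sup>2"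
  by (simp_all add: gaussian_moment_def fact_numeral power2_eq_square)

text \<open>
  The Taylor polynomial of odd degree of the characteristic function, in which the terms of odd order
  vanish.
\<close>
lemma gaussian_taylor_sum:
  "(\<Sum>k\<le>2 * N + 1. \<i> ^ k * complex_of_real (gaussian_moment v k) / fact k) =
     complex_of_real (\<Sum>j\<le>N. (- v / 2) ^ j / fact j)"
proof (induction N)
  case 0
  show ?case by (simp add: gaussian_moment_def)
next
  case (Suc N)
  have e: "{..2 * Suc N + 1} = insert (2 * Suc N + 1) (insert (2 * Suc N) {..2 * N + 1})" by auto
  have "\<i> ^ (2 * Suc N) * complex_of_real (gaussian_moment v (2 * Suc N)) / fact (2 * Suc N) =
      \<i> ^ (2 * Suc N) * complex_of_real (gaussian_moment v (2 * Suc N) / fact (2 * Suc N))"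
    by (simp only: of_real_divide of_real_fact times_divide_eq_right)
  also have "\<dots> = (- 1) ^ Suc N * complex_of_real ((v / 2) ^ Suc N / fact (Suc N))"
    unfolding gaussian_moment_even by (simp only: power_mult power2_i)
  also have "\<dots> = complex_of_real ((- v / 2) ^ Suc N / fact (Suc N))"
  proof -
    have "(- v / 2) ^ Suc N = (- 1) ^ Suc N * (v / 2) ^ Suc N"
      by (simp only: power_mult_distrib[symmetric]) simp
    then have "(- v / 2) ^ Suc N / fact (Suc N) = (- 1) ^ Suc N * ((v / 2) ^ Suc N / fact (Suc N))"
      by (simp only: times_divide_eq_right)
    then show ?thesis by (simp only: of_real_mult of_real_power of_real_minus of_real_1)
  qed
  finally have t: "\<i> ^ (2 * Suc N) * complex_of_real (gaussian_moment v (2 * Suc N)) / fact (2 * Suc N) =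
      complex_of_real ((- v / 2) ^ Suc N / fact (Suc N))" .
  have o: "gaussian_moment v (2 * Suc N + 1) = 0" by (rule gaussian_moment_odd) simp
  have "(\<Sum>k\<le>2 * Suc N + 1. \<i> ^ k * complex_of_real (gaussian_moment v k) / fact k) =
      complex_of_real ((- v / 2) ^ Suc N / fact (Suc N)) + (\<Sum>k\<le>2 * N + 1. \<i> ^ k * complex_of_real (gaussian_moment v k) / fact k)"
    unfolding e by (subst sum.insert, simp, simp, subst sum.insert) (simp_all only: finite_atMost atMost_iff t o, simp_all)
  then show ?case unfolding Suc by (simp add: add.commute)
qed

text \<open>The degree is odd so that the remainder is a moment of even order, without absolute values.\<close>
lemma (in prob_space) char_taylor_bound:
  fixes S :: "'a \<Rightarrow> real"
  assumes [measurable]: "S \<in> borel_measurable M" and int: "\<And>n. integrable M (\<lambda>\<omega>. S \<omega> ^ n)"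
  shows "norm ((\<integral>\<omega>. cis (S \<omega>) \<partial>M) - (\<Sum>k\<le>2 * N + 1. \<i> ^ k * complex_of_real (\<integral>\<omega>. S \<omega> ^ k \<partial>M) / fact k))
    \<le> (\<integral>\<omega>. S \<omega> ^ (2 * N + 2) \<partial>M) / fact (2 * N + 2)"
proof -
  have ci: "integrable M (\<lambda>\<omega>. cis (S \<omega>))" by (rule integrable_const_bound[of _ 1]) auto
  have ti: "integrable M (\<lambda>\<omega>. \<i> ^ k * complex_of_real (S \<omega> ^ k) / fact k)" for k
    using int[of k] by (intro Bochner_Integration.integrable_divide integrable_mult_right integrable_of_real)
  have si: "integrable M (\<lambda>\<omega>. \<Sum>k\<le>2 * N + 1. \<i> ^ k * complex_of_real (S \<omega> ^ k) / fact k)"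
    by (intro Bochner_Integration.integrable_sum ti)
  have "(\<integral>\<omega>. \<i> ^ k * complex_of_real (S \<omega> ^ k) / fact k \<partial>M) = \<i> ^ k * complex_of_real (\<integral>\<omega>. S \<omega> ^ k \<partial>M) / fact k" for k
    by (simp only: integral_divide_zero integral_mult_right_zero integral_complex_of_real)
  then have e: "(\<integral>\<omega>. (\<Sum>k\<le>2 * N + 1. \<i> ^ k * complex_of_real (S \<omega> ^ k) / fact k) \<partial>M) =
      (\<Sum>k\<le>2 * N + 1. \<i> ^ k * complex_of_real (\<integral>\<omega>. S \<omega> ^ k \<partial>M) / fact k)"
    by (subst Bochner_Integration.integral_sum[OF ti]) simp
  have "norm ((\<integral>\<omega>. cis (S \<omega>) \<partial>M) - (\<Sum>k\<le>2 * N + 1. \<i> ^ k * complex_of_real (\<integral>\<omega>. S \<omega> ^ k \<partial>M) / fact k)) =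
      norm (\<integral>\<omega>. cis (S \<omega>) - (\<Sum>k\<le>2 * N + 1. \<i> ^ k * complex_of_real (S \<omega> ^ k) / fact k) \<partial>M)"
    unfolding e[symmetric] by (rule arg_cong[where f = norm], rule Bochner_Integration.integral_diff[symmetric, OF ci si])
  also have "\<dots> \<le> (\<integral>\<omega>. norm (cis (S \<omega>) - (\<Sum>k\<le>2 * N + 1. \<i> ^ k * complex_of_real (S \<omega> ^ k) / fact k)) \<partial>M)"
    by (rule integral_norm_bound)
  also have "\<dots> \<le> (\<integral>\<omega>. S \<omega> ^ (2 * N + 2) / fact (2 * N + 2) \<partial>M)"
  proof (rule integral_mono)
    show "integrable M (\<lambda>\<omega>. norm (cis (S \<omega>) - (\<Sum>k\<le>2 * N + 1. \<i> ^ k * complex_of_real (S \<omega> ^ k) / fact k)))"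
      by (intro integrable_norm Bochner_Integration.integrable_diff ci si)
    show "integrable M (\<lambda>\<omega>. S \<omega> ^ (2 * N + 2) / fact (2 * N + 2))" by (intro Bochner_Integration.integrable_divide int)
    fix \<omega>
    have 1: "cis (S \<omega>) = iexp (S \<omega>)" by (simp add: cis_conv_exp)
    have 2: "\<i> ^ k * complex_of_real (S \<omega> ^ k) = (\<i> * complex_of_real (S \<omega>)) ^ k" for k
      by (simp add: power_mult_distrib)
    have 3: "S \<omega> ^ (2 * N + 2) = \<bar>S \<omega>\<bar> ^ Suc (2 * N + 1)"
      using power_even_abs[of "2 * N + 2" "S \<omega>"] by (simp only: Suc_eq_plus1 add.assoc one_add_one) simp
    show "norm (cis (S \<omega>) - (\<Sum>k\<le>2 * N + 1. \<i> ^ k * complex_of_real (S \<omega> ^ k) / fact k)) \<le> S \<omega> ^ (2 * N + 2) / fact (2 * N + 2)"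
      using iexp_approx1[of "S \<omega>" "2 * N + 1"] unfolding 1 2 3 by simp
  qed
  finally show ?thesis by simp
qed

text \<open>
  The method of moments. The remainder at degree \<open>2 N + 1\<close> converges to \<open>(v / 2) ^ (N + 1) / fact (N + 1)\<close>,
  which is small for large \<open>N\<close>; this bypasses the question of determinacy.
\<close>
lemma (in prob_space) char_tendsto_gaussian:
  fixes S :: "'t \<Rightarrow> 'a \<Rightarrow> real"
  assumes S: "eventually (\<lambda>T. S T \<in> borel_measurable M \<and> (\<forall>n. integrable M (\<lambda>\<omega>. S T \<omega> ^ n))) F"
    and lim: "\<And>n. ((\<lambda>T. \<integral>\<omega>. S T \<omega> ^ n \<partial>M) \<longlongrightarrow> gaussian_moment v n) F"
  shows "((\<lambda>T. \<integral>\<omega>. cis (S T \<omega>) \<partial>M) \<longlongrightarrow> complex_of_real (exp (- v / 2))) F"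
proof (rule tendstoI)
  fix e :: real assume e: "e > 0"
  have sums: "(\<lambda>j. (- v / 2) ^ j / fact j) sums exp (- v / 2)"
    using exp_converges[of "- v / 2"] by (simp only: real_scaleR_def divide_inverse mult.commute)
  have "(\<lambda>N. \<Sum>j\<le>N. (- v / 2) ^ j / fact j) \<longlonglongrightarrow> exp (- v / 2)" using sums unfolding sums_def_le .
  then have "eventually (\<lambda>N. dist (\<Sum>j\<le>N. (- v / 2) ^ j / fact j) (exp (- v / 2)) < e / 4) sequentially"
    by (rule tendstoD) (use e in simp)
  moreover have "(\<lambda>j. (v / 2) ^ j / fact j) \<longlonglongrightarrow> 0"
    using summable_LIMSEQ_zero[OF summable_exp[of "v / 2"]] by (simp only: divide_inverse mult.commute)
  then have "(\<lambda>N. (v / 2) ^ Suc N / fact (Suc N)) \<longlonglongrightarrow> 0" by (rule LIMSEQ_Suc)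
  then have "eventually (\<lambda>N. (v / 2) ^ Suc N / fact (Suc N) < e / 4) sequentially"
    by (rule order_tendstoD) (use e in simp)
  ultimately have ev: "eventually (\<lambda>N. dist (\<Sum>j\<le>N. (- v / 2) ^ j / fact j) (exp (- v / 2)) < e / 4 \<and>
      (v / 2) ^ Suc N / fact (Suc N) < e / 4) sequentially" by (rule eventually_conj)
  obtain N where N: "dist (\<Sum>j\<le>N. (- v / 2) ^ j / fact j) (exp (- v / 2)) < e / 4"
      "(v / 2) ^ Suc N / fact (Suc N) < e / 4" using eventually_happens'[OF sequentially_bot ev] by blast
  let ?P = "\<lambda>T. \<Sum>k\<le>2 * N + 1. \<i> ^ k * complex_of_real (\<integral>\<omega>. S T \<omega> ^ k \<partial>M) / fact k"
  let ?L = "complex_of_real (\<Sum>j\<le>N. (- v / 2) ^ j / fact j)"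
  have "(?P \<longlongrightarrow> (\<Sum>k\<le>2 * N + 1. \<i> ^ k * complex_of_real (gaussian_moment v k) / fact k)) F"
    by (intro tendsto_sum tendsto_divide tendsto_mult tendsto_const tendsto_of_real lim) simp
  then have "(?P \<longlongrightarrow> ?L) F" unfolding gaussian_taylor_sum .
  then have 1: "eventually (\<lambda>T. dist (?P T) ?L < e / 4) F" by (rule tendstoD) (use e in simp)
  have "((\<lambda>T. (\<integral>\<omega>. S T \<omega> ^ (2 * N + 2) \<partial>M) / fact (2 * N + 2)) \<longlongrightarrow> gaussian_moment v (2 * N + 2) / fact (2 * N + 2)) F"
    by (intro tendsto_divide tendsto_const lim) simp
  moreover have "gaussian_moment v (2 * N + 2) / fact (2 * N + 2) = (v / 2) ^ Suc N / fact (Suc N)"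
    using gaussian_moment_even[of v "Suc N"] by (simp only: mult_Suc_right add.commute)
  ultimately have 2: "eventually (\<lambda>T. (\<integral>\<omega>. S T \<omega> ^ (2 * N + 2) \<partial>M) / fact (2 * N + 2) < e / 4) F"
    using N(2) by (intro order_tendstoD(2)) auto
  show "eventually (\<lambda>T. dist (\<integral>\<omega>. cis (S T \<omega>) \<partial>M) (complex_of_real (exp (- v / 2))) < e) F"
    using S 1 2
  proof eventually_elim
    fix T assume ST: "S T \<in> borel_measurable M \<and> (\<forall>n. integrable M (\<lambda>\<omega>. S T \<omega> ^ n))"
      and 1: "dist (?P T) ?L < e / 4" and 2: "(\<integral>\<omega>. S T \<omega> ^ (2 * N + 2) \<partial>M) / fact (2 * N + 2) < e / 4"
    have a: "dist (\<integral>\<omega>. cis (S T \<omega>) \<partial>M) (?P T) < e / 4"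
      unfolding dist_norm using char_taylor_bound[of "S T" N] ST 2 by (meson order_le_less_trans)
    have b: "dist ?L (complex_of_real (exp (- v / 2))) < e / 4"
      using N(1) by (simp only: dist_of_real)
    have "dist (\<integral>\<omega>. cis (S T \<omega>) \<partial>M) (complex_of_real (exp (- v / 2))) \<le>
       dist (\<integral>\<omega>. cis (S T \<omega>) \<partial>M) (?P T) + (dist (?P T) ?L + dist ?L (complex_of_real (exp (- v / 2))))"
      by (intro order_trans[OF dist_triangle add_left_mono] dist_triangle)
    then show "dist (\<integral>\<omega>. cis (S T \<omega>) \<partial>M) (complex_of_real (exp (- v / 2))) < e" using a b 1 e by linarith
  qed
qed

lemma (in prob_space) char_gaussian:
  fixes S :: "'a \<Rightarrow> real"
  assumes "S \<in> borel_measurable M" "\<And>n. integrable M (\<lambda>\<omega>. S \<omega> ^ n)" "\<And>n. (\<integral>\<omega>. S \<omega> ^ n \<partial>M) = gaussian_moment v n"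
  shows "(\<integral>\<omega>. cis (S \<omega>) \<partial>M) = complex_of_real (exp (- v / 2))"
proof -
  have "((\<lambda>_::nat. \<integral>\<omega>. cis (S \<omega>) \<partial>M) \<longlongrightarrow> complex_of_real (exp (- v / 2))) sequentially"
    by (rule char_tendsto_gaussian) (use assms in auto)
  then show ?thesis by (simp add: LIMSEQ_const_iff)
qed

text \<open>The degenerate distribution is included, with variance \<open>0\<close>.\<close>
lemma (in prob_space) centred_gaussian_moments:
  assumes Z: "gaussian_rv M Z" and mean: "(\<integral>\<omega>. Z \<omega> \<partial>M) = 0"
  shows "\<exists>v. \<forall>n. integrable M (\<lambda>\<omega>. Z \<omega> ^ n) \<and> (\<integral>\<omega>. Z \<omega> ^ n \<partial>M) = gaussian_moment v n"
proof -
  have Zm[measurable]: "Z \<in> borel_measurable M" using Z by (simp add: gaussian_rv_def)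
  consider \<mu> \<sigma> where "0 < \<sigma>" "distributed M lborel Z (normal_density \<mu> \<sigma>)" | \<mu> where "AE \<omega> in M. Z \<omega> = \<mu>"
    using Z by (auto simp: gaussian_rv_def)
  then show ?thesis
  proof cases
    case (1 \<mu> \<sigma>)
    define V where "V \<omega> = (Z \<omega> - \<mu>) / \<sigma>" for \<omega>
    have V: "distributed M lborel V std_normal_density"
      using 1 normal_standard_normal_convert[of \<sigma> Z \<mu>] by (simp add: V_def[abs_def])
    have [measurable]: "V \<in> borel_measurable M" unfolding V_def[abs_def] by measurable
    have d: "distr M lborel V = std_normal_distribution" using V by (rule distributed_distr_eq_density)
    have d': "V \<in> M \<rightarrow>\<^sub>M lborel" by simp
    have Vi: "integrable M (\<lambda>\<omega>. V \<omega> ^ n)" for n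
    proof -
      have "integrable (distr M lborel V) (\<lambda>x. x ^ n)" unfolding d by (rule integrable_std_normal_distribution_moment)
      then show ?thesis by (rule integrable_distr[OF d'])
    qed
    have Vn: "(\<integral>\<omega>. V \<omega> ^ n \<partial>M) = gaussian_moment 1 n" for n
    proof -
      have "(\<integral>\<omega>. V \<omega> ^ n \<partial>M) = (\<integral>x. x ^ n \<partial>distr M lborel V)"
        by (rule integral_distr[symmetric, OF d']) simp
      also have "\<dots> = gaussian_moment 1 n"
      proof (cases "even n")
        case True
        then obtain k where k: "n = 2 * k" by auto
        show ?thesis unfolding d k std_normal_distribution_even_moments(1) by (simp add: gaussian_moment_def power_divide)
      next
        case False
        then show ?thesis unfolding d using integral_std_normal_distribution_moment_odd[OF False]
          by (simp add: gaussian_moment_odd)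
      qed
      finally show ?thesis .
    qed
    have Z': "Z \<omega> = \<mu> + \<sigma> * V \<omega>" for \<omega> using 1 by (simp add: V_def)
    have "(\<integral>\<omega>. Z \<omega> \<partial>M) = \<mu>"
      unfolding Z' using Vi[of 1] Vn[of 1] by (simp add: gaussian_moment_def prob_space)
    with mean have "\<mu> = 0" by simp
    then have Zn: "Z \<omega> ^ n = \<sigma> ^ n * V \<omega> ^ n" for \<omega> n by (simp add: Z' power_mult_distrib)
    have "\<sigma> ^ n * gaussian_moment 1 n = gaussian_moment (\<sigma>\<^sup>2) n" for n
    proof (cases "even n")
      case True
      then obtain k where "n = 2 * k" by auto
      then show ?thesis by (simp add: gaussian_moment_def power_mult power_divide)
    qed (simp add: gaussian_moment_odd)
    then show ?thesis unfolding Zn using Vi Vn by (intro exI[of _ "\<sigma>\<^sup>2"]) simp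
  next
    case (2 \<mu>)
    have "(\<integral>\<omega>. Z \<omega> \<partial>M) = (\<integral>\<omega>. \<mu> \<partial>M)" by (rule integral_cong_AE) (use 2 in auto)
    then have "\<mu> = 0" using mean by (simp add: prob_space)
    with 2 have ae: "AE \<omega> in M. 0 ^ n = Z \<omega> ^ n" for n by (auto elim!: eventually_mono)
    have "integrable M (\<lambda>\<omega>. Z \<omega> ^ n)" for n
      by (rule integrable_cong_AE_imp[OF integrable_const[of "0 ^ n"] _ ae]) measurable
    moreover have "(\<integral>\<omega>. Z \<omega> ^ n \<partial>M) = gaussian_moment 0 n" for n
    proof -
      have "(\<integral>\<omega>. 0 ^ n \<partial>M) = (\<integral>\<omega>. Z \<omega> ^ n \<partial>M)" by (rule integral_cong_AE[OF _ _ ae]) measurable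
      then show ?thesis by (cases "n = 0") (auto simp: prob_space gaussian_moment_def power_0_left)
    qed
    ultimately show ?thesis by (intro exI[of _ 0]) simp
  qed
qed

section \<open>Continuous functions on the unit interval\<close>

interpretation C01: Metric_space "mspace C01" "mdist C01"
  by (rule Metric_space_mspace_mdist)

lemma mtopology_C01: "mtopology_of C01 = C01.mtopology"
  by (simp add: mtopology_of_def)

lemma mspace_C01: "mspace C01 = {x. x \<in> extensional {0..1} \<and> continuous_on {0..1} x}"
  unfolding C01_def by (subst compactin_mspace_cfunspace) (auto simp: compactin_subtopology)

lemma mdist_C01_le:
  assumes "0 \<le> a" "\<And>u. u \<in> {0..1} \<Longrightarrow> \<bar>x u - y u\<bar> \<le> a"
  shows "mdist C01 x y \<le> a"
  unfolding C01_def by (rule mdist_cfunspace_le) (use assms in \<open>auto simp: dist_real_def\<close>)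

lemma path_C01_in_mspace [simp]: "path_C01 Y \<omega> \<in> mspace C01"
proof -
  have "continuous_on {0..1} (\<lambda>u\<in>{0..1::real}. Y u \<omega>)" if "continuous_on {0..1} (\<lambda>u. Y u \<omega>)"
    using that by (rule continuous_on_eq) auto
  moreover have "continuous_on {0..1} (\<lambda>u\<in>{0..1::real}. 0::real)"
    by (rule continuous_on_eq[OF continuous_on_const[of _ 0]]) auto
  ultimately show ?thesis by (auto simp: mspace_C01 path_C01_def)
qed

text \<open>
  Bernstein polynomials with rational coefficients: a countable dense subset of \<^const>\<open>C01\<close>. The pair consists of
  the degree and the list of coefficients.
\<close>
definition rational_bernstein :: "nat \<times> rat list \<Rightarrow> real \<Rightarrow> real" where
  "rational_bernstein = (\<lambda>(n, q). \<lambda>u\<in>{0..1}. \<Sum>k\<le>n. real_of_rat (q ! k) * Bernstein n k u)"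

lemma rational_bernstein_in_mspace: "rational_bernstein p \<in> mspace C01"
proof -
  obtain n q where p: "p = (n, q)" by (cases p)
  have "continuous_on {0..1} (\<lambda>u. \<Sum>k\<le>n. real_of_rat (q ! k) * Bernstein n k u)"
    unfolding Bernstein_def by (intro continuous_intros)
  then have "continuous_on {0..1} (\<lambda>u\<in>{0..1}. \<Sum>k\<le>n. real_of_rat (q ! k) * Bernstein n k u)"
    by (rule continuous_on_eq) auto
  then show ?thesis by (auto simp: p mspace_C01 rational_bernstein_def)
qed

lemma rational_bernstein_dense:
  assumes x: "x \<in> mspace C01" and e: "e > 0"
  shows "\<exists>p. \<forall>u\<in>{0..1}. \<bar>x u - rational_bernstein p u\<bar> < e"
proof -
  have "continuous_on {0..1} x" using x by (simp add: mspace_C01)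
  from Bernstein_Weierstrass[OF this half_gt_zero[OF e]] obtain n where
    n': "\<forall>m u. n \<le> m \<and> u \<in> {0..1} \<longrightarrow> \<bar>x u - (\<Sum>k\<le>m. x (k / m) * Bernstein m k u)\<bar> < e / 2" by blast
  have n: "\<bar>x u - (\<Sum>k\<le>n. x (k / n) * Bernstein n k u)\<bar> < e / 2" if "u \<in> {0..1}" for u
    using n'[rule_format, of n u] that by simp
  have "\<exists>r. \<bar>x (real k / real n) - real_of_rat r\<bar> < e / 2" for k
  proof -
    have "x (real k / real n) - e / 2 < x (real k / real n) + e / 2" using e by simp
    from of_rat_dense[OF this] obtain q where "x (real k / real n) - e / 2 < of_rat q" "of_rat q < x (real k / real n) + e / 2"
      by blast
    then show ?thesis by (intro exI[of _ q]) linarith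
  qed
  then obtain r where r: "\<And>k. \<bar>x (real k / real n) - real_of_rat (r k)\<bar> < e / 2" by metis
  show ?thesis
  proof (intro exI[of _ "(n, map r [0..<Suc n])"] ballI)
    fix u :: real assume u: "u \<in> {0..1}"
    have "\<bar>(\<Sum>k\<le>n. x (k / n) * Bernstein n k u) - rational_bernstein (n, map r [0..<Suc n]) u\<bar> =
        \<bar>\<Sum>k\<le>n. (x (k / n) - real_of_rat (r k)) * Bernstein n k u\<bar>"
      using u by (simp add: rational_bernstein_def sum_subtractf left_diff_distrib del: upt_Suc)
    also have "\<dots> \<le> (\<Sum>k\<le>n. \<bar>(x (k / n) - real_of_rat (r k)) * Bernstein n k u\<bar>)" by (rule sum_abs)
    also have "\<dots> \<le> (\<Sum>k\<le>n. e / 2 * Bernstein n k u)"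
    proof (rule sum_mono)
      fix k
      have "Bernstein n k u \<ge> 0" using u by (intro Bernstein_nonneg) auto
      then show "\<bar>(x (k / n) - real_of_rat (r k)) * Bernstein n k u\<bar> \<le> e / 2 * Bernstein n k u"
        using r[of k] e unfolding abs_mult by (intro mult_mono) auto
    qed
    also have "\<dots> = e / 2" unfolding sum_distrib_left[symmetric] sum_Bernstein by simp
    finally show "\<bar>x u - rational_bernstein (n, map r [0..<Suc n]) u\<bar> < e" using n[OF u] by linarith
  qed
qed

lemma continuous_on_le_rational:
  fixes h :: "real \<Rightarrow> real"
  assumes h: "continuous_on {0..1} h" and le: "\<And>q. q \<in> \<rat> \<inter> {0..1} \<Longrightarrow> \<bar>h q\<bar> \<le> r" and u: "u \<in> {0..1}"
  shows "\<bar>h u\<bar> \<le> r"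
proof -
  have "{0<..<1::real} \<subseteq> closure (\<rat> \<inter> {0<..<1})"
    using open_Int_closure_subset[of "{0<..<1::real}" "\<rat>"] Rats_closure_real by (simp add: Int_commute)
  then have "closure {0<..<1::real} \<subseteq> closure (\<rat> \<inter> {0<..<1})" by (rule closure_minimal) simp
  moreover have "closure (\<rat> \<inter> {0<..<1}) \<subseteq> {0..1::real}" by (rule closure_minimal) auto
  ultimately have cl: "closure (\<rat> \<inter> {0<..<1}) = {0..1::real}" by simp
  have "\<bar>h u\<bar> \<le> r"
  proof (rule continuous_le_on_closure[of "\<rat> \<inter> {0<..<1}" "\<lambda>u. \<bar>h u\<bar>" u r])
    show "continuous_on (closure (\<rat> \<inter> {0<..<1})) (\<lambda>u. \<bar>h u\<bar>)"
      unfolding cl by (intro continuous_intros h)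
  qed (use le u cl in auto)
  then show ?thesis .
qed

text \<open>
  Evaluations generate the Borel sets: an open set is a countable union of closed balls around rational
  Bernstein polynomials, and membership in such a ball is decided at rational points.
\<close>
lemma measurable_into_C01:
  assumes sp: "\<And>\<omega>. \<omega> \<in> space M \<Longrightarrow> x \<omega> \<in> mspace C01"
    and ev: "\<And>u. u \<in> {0..1} \<Longrightarrow> (\<lambda>\<omega>. x \<omega> u) \<in> borel_measurable M"
  shows "x \<in> M \<rightarrow>\<^sub>M borel_top (mtopology_of C01)"
  unfolding borel_top_def
proof (rule measurable_measure_of)
  show "{U. openin (mtopology_of C01) U} \<subseteq> Pow (topspace (mtopology_of C01))"
    using openin_subset by fast
  show "x \<in> space M \<rightarrow> topspace (mtopology_of C01)" using sp by auto
  fix U assume "U \<in> {U. openin (mtopology_of C01) U}"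
  then have U: "U \<subseteq> mspace C01" "\<And>y. y \<in> U \<Longrightarrow> \<exists>r>0. C01.mball y r \<subseteq> U"
    by (auto simp: mtopology_C01 C01.openin_mtopology)
  define I where "I = {(p, r :: rat). {y \<in> mspace C01. \<forall>u\<in>{0..1}. \<bar>y u - rational_bernstein p u\<bar> \<le> real_of_rat r} \<subseteq> U}"
  let ?G = "\<lambda>p r. {\<omega> \<in> space M. \<forall>q :: rat. real_of_rat q \<in> {0..1} \<longrightarrow>
      \<bar>x \<omega> (real_of_rat q) - rational_bernstein p (real_of_rat q)\<bar> \<le> real_of_rat r}"
  have "x -` U \<inter> space M = (\<Union>(p, r)\<in>I. ?G p r)"
  proof (intro equalityI subsetI)
    fix \<omega> assume w: "\<omega> \<in> x -` U \<inter> space M"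
    then have "x \<omega> \<in> U" by simp
    from U(2)[OF this] obtain e where e: "e > 0" "C01.mball (x \<omega>) e \<subseteq> U" by blast
    obtain r :: rat where r: "0 < real_of_rat r" "real_of_rat r < e / 2"
      using of_rat_dense[of 0 "e / 2"] e by auto
    obtain p where p: "\<forall>u\<in>{0..1}. \<bar>x \<omega> u - rational_bernstein p u\<bar> < real_of_rat r"
      using rational_bernstein_dense[OF sp r(1), of \<omega>] w by auto
    have "(p, r) \<in> I"
      unfolding I_def
    proof (clarify)
      fix y assume y: "y \<in> mspace C01" "\<forall>u\<in>{0..1}. \<bar>y u - rational_bernstein p u\<bar> \<le> real_of_rat r"
      have "mdist C01 (x \<omega>) y \<le> 2 * real_of_rat r"
      proof (rule mdist_C01_le)
        fix u :: real assume u: "u \<in> {0..1}"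
        have "\<bar>x \<omega> u - rational_bernstein p u\<bar> < real_of_rat r" "\<bar>y u - rational_bernstein p u\<bar> \<le> real_of_rat r"
          using y p u by auto
        then show "\<bar>x \<omega> u - y u\<bar> \<le> 2 * real_of_rat r" by linarith
      qed (use r in auto)
      then have "y \<in> C01.mball (x \<omega>) e" using r y w sp by auto
      then show "y \<in> U" using e by auto
    qed
    then show "\<omega> \<in> (\<Union>(p, r)\<in>I. ?G p r)"
    proof (rule UN_I)
      have "\<bar>x \<omega> u - rational_bernstein p u\<bar> \<le> real_of_rat r" if "u \<in> {0..1}" for u
        using p that by (intro less_imp_le) blast
      then show "\<omega> \<in> (case (p, r) of (p, r) \<Rightarrow> ?G p r)" using w by simp
    qed
  next
    fix \<omega> assume "\<omega> \<in> (\<Union>(p, r)\<in>I. ?G p r)"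
    then obtain p r where pr: "(p, r) \<in> I" "\<omega> \<in> space M" "\<And>q. real_of_rat q \<in> {0..1} \<Longrightarrow>
        \<bar>x \<omega> (real_of_rat q) - rational_bernstein p (real_of_rat q)\<bar> \<le> real_of_rat r"
      by (auto split: prod.splits)
    have "\<bar>x \<omega> u - rational_bernstein p u\<bar> \<le> real_of_rat r" if "u \<in> {0..1}" for u
    proof (rule continuous_on_le_rational[of "\<lambda>u. x \<omega> u - rational_bernstein p u"])
      show "continuous_on {0..1} (\<lambda>u. x \<omega> u - rational_bernstein p u)"
        using sp[OF pr(2)] rational_bernstein_in_mspace[of p] by (intro continuous_intros) (auto simp: mspace_C01)
    qed (use pr(3) that in \<open>auto elim!: Rats_cases\<close>)
    then have "x \<omega> \<in> U" using pr(1) sp[OF pr(2)] by (auto simp: I_def)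
    then show "\<omega> \<in> x -` U \<inter> space M" using pr by auto
  qed
  also have "\<dots> \<in> sets M"
  proof (rule sets.countable_UN'')
    show "countable I" by (rule countableI_type)
    fix pr assume "pr \<in> I"
    obtain p r where pr: "pr = (p, r)" by (cases pr)
    have "Measurable.pred M (\<lambda>\<omega>. \<forall>q :: rat. real_of_rat q \<in> {0..1} \<longrightarrow>
        \<bar>x \<omega> (real_of_rat q) - rational_bernstein p (real_of_rat q)\<bar> \<le> real_of_rat r)"
    proof (rule pred_intros_countable(1))
      fix q :: rat
      show "Measurable.pred M (\<lambda>\<omega>. real_of_rat q \<in> {0..1} \<longrightarrow>
        \<bar>x \<omega> (real_of_rat q) - rational_bernstein p (real_of_rat q)\<bar> \<le> real_of_rat r)"
      proof (cases "real_of_rat q \<in> {0..1::real}")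
        case True
        then have [measurable]: "(\<lambda>\<omega>. x \<omega> (real_of_rat q)) \<in> borel_measurable M" by (rule ev)
        show ?thesis by measurable
      qed auto
    qed
    then have "?G p r \<in> sets M" by (simp add: pred_def)
    then show "(case pr of (p, r) \<Rightarrow> ?G p r) \<in> sets M"
      by (simp add: pr)
  qed
  finally show "x -` U \<inter> space M \<in> sets M" .
qed

lemma borel_measurable_completion_AE:
  fixes f g :: "'a \<Rightarrow> real"
  assumes f: "f \<in> borel_measurable M" and ae: "AE x in M. f x = g x"
  shows "g \<in> borel_measurable (completion M)"
proof (rule measurableI)
  obtain N where N: "N \<in> null_sets M" "{x \<in> space M. f x \<noteq> g x} \<subseteq> N" using ae by (auto elim: AE_E simp: null_sets_def)
  fix A :: "real set" assume A: "A \<in> sets borel"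
  have f': "f -` A \<inter> space M - N \<in> sets (completion M)"
    using f A N by (intro sets_completionI_sets sets.Diff) (auto simp: measurable_sets)
  have "g -` A \<inter> space M \<inter> N \<in> sets (completion M)"
    by (rule null_setsD2[OF null_sets_completion_subset[of _ N]]) (use N null_sets_completionI in auto)
  moreover have "g -` A \<inter> space (completion M) = (f -` A \<inter> space M - N) \<union> (g -` A \<inter> space M \<inter> N)"
    using N by auto
  ultimately show "g -` A \<inter> space (completion M) \<in> sets (completion M)" using f' by (metis sets.Un)
qed simp

text \<open>A process on the unit interval with almost surely continuous paths.\<close>
locale continuous_process = prob_space M for M :: "'w measure" +
  fixes Y :: "real \<Rightarrow> 'w \<Rightarrow> real"
  assumes Y_measurable [measurable]: "\<And>u. u \<in> {0..1} \<Longrightarrow> Y u \<in> borel_measurable M"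
    and Y_continuous: "AE \<omega> in M. continuous_on {0..1} (\<lambda>u. Y u \<omega>)"
begin

lemma path_eq: "AE \<omega> in M. \<forall>u\<in>{0..1}. path_C01 Y \<omega> u = Y u \<omega>"
  using Y_continuous by eventually_elim (auto simp: path_C01_def)

lemma path_measurable: "path_C01 Y \<in> completion M \<rightarrow>\<^sub>M borel_top (mtopology_of C01)"
proof (rule measurable_into_C01)
  fix u :: real assume u: "u \<in> {0..1}"
  have "AE \<omega> in M. Y u \<omega> = path_C01 Y \<omega> u" using path_eq by eventually_elim (use u in auto)
  then show "(\<lambda>\<omega>. path_C01 Y \<omega> u) \<in> borel_measurable (completion M)"
    by (rule borel_measurable_completion_AE[OF Y_measurable[OF u]])
qed auto

lemma continuous_map_borel:
  assumes g: "continuous_map (mtopology_of C01) euclideanreal g"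
  shows "g \<in> borel_measurable (borel_top (mtopology_of C01))"
proof (rule borel_measurableI)
  fix S :: "real set" assume "open S"
  then have "openin (mtopology_of C01) {x \<in> topspace (mtopology_of C01). g x \<in> S}"
    using g by (auto simp: continuous_map_def)
  then have "{x \<in> topspace (mtopology_of C01). g x \<in> S} \<in> sets (borel_top (mtopology_of C01))"
    unfolding borel_top_def using openin_subset
    by (subst sets_measure_of) (fast, intro sigma_sets.Basic, simp)
  moreover have "g -` S \<inter> space (borel_top (mtopology_of C01)) = {x \<in> topspace (mtopology_of C01). g x \<in> S}"
    by (auto simp: borel_top_def space_measure_of_conv)
  ultimately show "g -` S \<inter> space (borel_top (mtopology_of C01)) \<in> sets (borel_top (mtopology_of C01))" by simp
qed

lemma integral_law:
  assumes g: "continuous_map (mtopology_of C01) euclideanreal g"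
  shows "(\<integral>x. g x \<partial>law_C01 M Y) = (\<integral>\<omega>. g (path_C01 Y \<omega>) \<partial>completion M)"
    and "(\<lambda>\<omega>. g (path_C01 Y \<omega>)) \<in> borel_measurable (completion M)"
  unfolding law_C01_def using path_measurable continuous_map_borel[OF g]
  by (simp_all add: integral_distr measurable_compose)

end

text \<open>
  Functions vanishing at \<open>0\<close> whose oscillation over distances up to \<open>2\<^sup>-\<^sup>n\<close> is at most \<open>c (9/10)\<^sup>n\<close>. The ratio
  \<open>9/10\<close> is chosen for \<open>2 (9/10)\<^sup>4 > 1\<close>, which makes the probabilities in the chaining argument
  summable.
\<close>
definition holder_set :: "real \<Rightarrow> (real \<Rightarrow> real) set" where
  "holder_set c = {x. x \<in> extensional {0..1} \<and> x 0 = 0 \<and>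
     (\<forall>n. \<forall>u\<in>{0..1}. \<forall>v\<in>{0..1}. \<bar>u - v\<bar> \<le> 1 / 2 ^ n \<longrightarrow> \<bar>x u - x v\<bar> \<le> c * (9 / 10) ^ n)}"

lemma power_small:
  fixes c e :: real
  assumes "e > 0"
  shows "\<exists>n. c * (9 / 10) ^ n < e"
proof -
  have "(\<lambda>n. c * (9 / 10 :: real) ^ n) \<longlonglongrightarrow> c * 0"
    by (intro tendsto_intros LIMSEQ_realpow_zero) auto
  then have "eventually (\<lambda>n. c * (9 / 10) ^ n < e) sequentially"
    using assms by (intro order_tendstoD) auto
  then show ?thesis by (auto simp: eventually_sequentially)
qed

lemma holder_set_subset: "holder_set c \<subseteq> mspace C01"
proof
  fix x assume x: "x \<in> holder_set c"
  have "continuous_on {0..1} x"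
    unfolding continuous_on_iff
  proof (intro ballI allI impI)
    fix u e :: real assume u: "u \<in> {0..1}" and e: "0 < e"
    obtain n where n: "c * (9 / 10) ^ n < e" using power_small[OF e] by blast
    show "\<exists>d>0. \<forall>v\<in>{0..1}. dist v u < d \<longrightarrow> dist (x v) (x u) < e"
    proof (intro exI[of _ "1 / 2 ^ n"] conjI ballI impI)
      fix v :: real assume v: "v \<in> {0..1}" "dist v u < 1 / 2 ^ n"
      then have "\<bar>x v - x u\<bar> \<le> c * (9 / 10) ^ n"
        using x u by (auto simp: holder_set_def dist_real_def)
      then show "dist (x v) (x u) < e" using n by (simp add: dist_real_def)
    qed simp
  qed
  then show "x \<in> mspace C01" using x by (simp add: mspace_C01 holder_set_def)
qed

text \<open>Compactness refers to the product topology of the function type, that is, to pointwise convergence.\<close>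
lemma compact_holder_set: "compact (holder_set c)"
proof -
  \<comment> \<open>Extensional functions take the fixed value \<open>undefined\<close> outside of the interval. The bound is the modulus for \<open>n = 0\<close>.\<close>
  define K where "K = PiE UNIV (\<lambda>u::real. if u \<in> {0..1} then cball 0 \<bar>c\<bar> else {undefined :: real})"
  have "compactin (product_topology (\<lambda>_. euclidean) UNIV) K"
    unfolding K_def by (subst compactin_PiE) auto
  then have K: "compact K" by (simp add: euclidean_product_topology)
  have cl: "closed {x. \<bar>x u - x v\<bar> \<le> a}" for u v a :: real
    by (intro closed_Collect_le continuous_intros) auto
  have cl0: "closed {x :: real \<Rightarrow> real. x 0 = 0}"
    by (intro closed_Collect_eq continuous_intros) auto
  define C where "C = {x :: real \<Rightarrow> real. x 0 = 0} \<inter> (\<Inter>n. \<Inter>u\<in>{0..1}. \<Inter>v\<in>{0..1} \<inter> {v. \<bar>u - v\<bar> \<le> 1 / 2 ^ n}. {x. \<bar>x u - x v\<bar> \<le> c * (9 / 10) ^ n})"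
  have "closed C" unfolding C_def by (intro closed_Int cl0 closed_INT ballI cl)
  moreover have "holder_set c = K \<inter> C"
  proof (intro equalityI subsetI)
    fix x assume x: "x \<in> holder_set c"
    have "\<bar>x u\<bar> \<le> \<bar>c\<bar>" if "u \<in> {0..1}" for u
    proof -
      have "\<bar>u - 0\<bar> \<le> 1 / 2 ^ 0" using that by auto
      then have "\<bar>x u - x 0\<bar> \<le> c * (9 / 10) ^ 0" using x that unfolding holder_set_def mem_Collect_eq by (meson atLeastAtMost_iff order_refl zero_le_one)
      then show ?thesis using x by (simp add: holder_set_def)
    qed
    then show "x \<in> K \<inter> C" using x by (auto simp: holder_set_def K_def C_def extensional_def)
  next
    fix x assume "x \<in> K \<inter> C"
    then show "x \<in> holder_set c"
      by (auto simp: holder_set_def K_def C_def extensional_def PiE_def Pi_def split: if_splits)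
  qed
  ultimately show ?thesis using K by (simp add: compact_Int_closed)
qed

lemma grid_point:
  assumes "u \<in> {0..1::real}"
  shows "\<exists>k\<le>2 ^ n. \<bar>u - real k / 2 ^ n\<bar> \<le> 1 / 2 ^ n \<and> real k / 2 ^ n \<in> {0..1}"
proof -
  let ?k = "nat \<lfloor>u * 2 ^ n\<rfloor>"
  have k: "real ?k \<le> u * 2 ^ n" "u * 2 ^ n < real ?k + 1" using assms by (auto simp: of_nat_nat)
  have "u * 2 ^ n \<le> 2 ^ n" using assms mult_right_mono[of u 1 "2 ^ n"] by auto
  then have "real ?k \<le> 2 ^ n" using k by linarith
  then have k2: "?k \<le> 2 ^ n" by (metis of_nat_le_iff of_nat_numeral of_nat_power)
  have "u - real ?k / 2 ^ n \<ge> 0" "u - real ?k / 2 ^ n \<le> 1 / 2 ^ n"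
    using divide_right_mono[OF k(1), of "2 ^ n"] divide_strict_right_mono[OF k(2), of "2 ^ n"] by (auto simp: add_divide_distrib)
  then show ?thesis using k2 \<open>real ?k \<le> 2 ^ n\<close> by (intro exI[of _ ?k]) auto
qed

text \<open>
  By the common modulus of continuity, closeness at the points of a fine dyadic grid implies uniform
  closeness.
\<close>
lemma continuous_on_holder_set:
  assumes g: "continuous_map (mtopology_of C01) euclideanreal g"
  shows "continuous_on (holder_set c) g"
  unfolding continuous_on_def
proof (intro ballI tendstoI)
  fix x e assume x: "x \<in> holder_set c" and e: "(e::real) > 0"
  have xm: "x \<in> mspace C01" using x holder_set_subset by auto
  have "openin C01.mtopology {y \<in> topspace (mtopology_of C01). g y \<in> ball (g x) e}"
    using g unfolding continuous_map_def mtopology_C01[symmetric] by auto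
  then obtain d where d: "d > 0" "C01.mball x d \<subseteq> {y \<in> topspace (mtopology_of C01). g y \<in> ball (g x) e}"
    using xm e by (auto simp: C01.openin_mtopology)
  obtain n where n: "c * (9 / 10) ^ n < d / 4" using power_small[of "d / 4"] d by auto
  define A where "A = (\<Inter>k\<in>{..2 ^ n::nat}. {y :: real \<Rightarrow> real. \<bar>y (real k / 2 ^ n) - x (real k / 2 ^ n)\<bar> < d / 4})"
  have "open A" unfolding A_def
    by (intro open_INT finite_atMost ballI open_Collect_less continuous_intros) auto
  moreover have "x \<in> A" using d by (auto simp: A_def)
  moreover have "dist (g y) (g x) < e" if y: "y \<in> A" "y \<in> holder_set c" for y
  proof -
    have "mdist C01 x y \<le> 3 * d / 4"
    proof (rule mdist_C01_le)
      fix u :: real assume u: "u \<in> {0..1}"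
      obtain k where k: "k \<le> 2 ^ n" "\<bar>u - real k / 2 ^ n\<bar> \<le> 1 / 2 ^ n" "real k / 2 ^ n \<in> {0..1}"
        using grid_point[OF u] by blast
      have "\<bar>x u - x (real k / 2 ^ n)\<bar> \<le> c * (9 / 10) ^ n" "\<bar>y u - y (real k / 2 ^ n)\<bar> \<le> c * (9 / 10) ^ n"
        using x y k u unfolding holder_set_def by blast+
      moreover have "\<bar>y (real k / 2 ^ n) - x (real k / 2 ^ n)\<bar> < d / 4" using y k by (auto simp: A_def)
      ultimately show "\<bar>x u - y u\<bar> \<le> 3 * d / 4" using n by linarith
    qed (use d in auto)
    then have "y \<in> C01.mball x d" using d xm y holder_set_subset by auto
    then show ?thesis using d by (auto simp: dist_commute)
  qed
  ultimately show "eventually (\<lambda>y. dist (g y) (g x) < e) (at x within holder_set c)"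
    unfolding eventually_at_topological by blast
qed

section \<open>Tightness and weak convergence of continuous processes\<close>

lemma open_coordinate_vimage:
  fixes W :: "'b::topological_space set"
  shows "open W \<Longrightarrow> open ((\<lambda>z::'a \<Rightarrow> 'b. z i) -` W)"
  by (rule open_vimage[OF _ continuous_on_product_coordinates])

text \<open>
  The product topology over a family of Hausdorff spaces is Hausdorff; the Stone-Weierstrass theorem needs this for the
  function type, in the form of a type class instance.
\<close>
instance "fun" :: (type, t0_space) t0_space
proof
  fix x y :: "'a \<Rightarrow> 'b"
  assume "x \<noteq> y"
  then obtain i where "x i \<noteq> y i" by auto
  from t0_space_class.t0_space[OF this] obtain U where U: "open U" "\<not> (x i \<in> U \<longleftrightarrow> y i \<in> U)" by (elim exE conjE)
  show "\<exists>U. open U \<and> \<not> (x \<in> U \<longleftrightarrow> y \<in> U)"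
    by (rule exI[of _ "(\<lambda>z. z i) -` U"]) (simp only: vimage_eq U open_coordinate_vimage simp_thms)
qed

instance "fun" :: (type, t1_space) t1_space
proof
  fix x y :: "'a \<Rightarrow> 'b"
  assume "x \<noteq> y"
  then obtain i where "x i \<noteq> y i" by auto
  from t1_space_class.t1_space[OF this] obtain U where U: "open U" "x i \<in> U" "y i \<notin> U" by (elim exE conjE)
  show "\<exists>U. open U \<and> x \<in> U \<and> y \<notin> U"
    by (rule exI[of _ "(\<lambda>z. z i) -` U"]) (simp only: vimage_eq U open_coordinate_vimage simp_thms)
qed

instance "fun" :: (type, t2_space) t2_space
proof
  fix x y :: "'a \<Rightarrow> 'b"
  assume "x \<noteq> y"
  then obtain i where "x i \<noteq> y i" by auto
  from hausdorff[OF this] obtain U V where UV: "open U" "open V" "x i \<in> U" "y i \<in> V" "U \<inter> V = {}"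
    by (elim exE conjE)
  show "\<exists>U V. open U \<and> open V \<and> x \<in> U \<and> y \<in> V \<and> U \<inter> V = {}"
    by (rule exI[of _ "(\<lambda>z. z i) -` U"], rule exI[of _ "(\<lambda>z. z i) -` V"])
      (simp only: vimage_eq UV open_coordinate_vimage vimage_Int[symmetric] vimage_empty simp_thms)
qed

lemma dyadic_floor_step:
  assumes "u \<in> {0..1::real}"
  defines "k \<equiv> \<lambda>n. nat \<lfloor>2 ^ n * u\<rfloor>"
  shows "k n \<le> 2 ^ n" and "real (k n) \<le> 2 ^ n * u" and "2 ^ n * u < real (k n) + 1"
    and "k (Suc n) = 2 * k n \<or> k (Suc n) = 2 * k n + 1"
proof -
  show a: "real (k n) \<le> 2 ^ n * u" "2 ^ n * u < real (k n) + 1" for n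
    using assms(1) by (auto simp: k_def)
  have "2 ^ n * u \<le> 2 ^ n" using assms(1) by simp
  then have "real (k n) \<le> real (2 ^ n)" using a(1)[of n] by (simp only: of_nat_power of_nat_numeral)
  then show "k n \<le> 2 ^ n" using of_nat_le_iff[where 'a = real] by blast
  have "real (k (Suc n)) < real (2 * k n + 2)" "real (2 * k n) < real (k (Suc n) + 1)"
    using a[of n] a[of "Suc n"] by auto
  then show "k (Suc n) = 2 * k n \<or> k (Suc n) = 2 * k n + 1" by linarith
qed

text \<open>
  A point is reached from its dyadic approximation of order \<open>n\<close> by steps summing to at most
  \<open>c \<Sum>\<^sub>m (9/10)\<^sup>n\<^sup>+\<^sup>m = 10 c (9/10)\<^sup>n\<close>. This is used for both points, and their approximations of order
  \<open>n\<close> are equal or adjacent, so that the constant is \<open>10 + 10 + 1\<close>.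
\<close>
lemma dyadic_chaining:
  fixes x :: "real \<Rightarrow> real"
  assumes cont: "continuous_on {0..1} x" and c: "c \<ge> 0"
    and inc: "\<And>n k. k < 2 ^ n \<Longrightarrow> \<bar>x (real (Suc k) / 2 ^ n) - x (real k / 2 ^ n)\<bar> \<le> c * (9 / 10) ^ n"
    and uv: "u \<in> {0..1}" "v \<in> {0..1}" "\<bar>u - v\<bar> \<le> 1 / 2 ^ n"
  shows "\<bar>x u - x v\<bar> \<le> 21 * c * (9 / 10) ^ n"
proof -
  define k where "k u n = nat \<lfloor>2 ^ n * u\<rfloor>" for u :: real and n :: nat
  define D where "D u n = real (k u n) / 2 ^ n" for u n
  let ?r = "9 / 10 :: real"
  note k = dyadic_floor_step[folded k_def]
  have near: "\<bar>x u - x (D u n)\<bar> \<le> 10 * c * ?r ^ n" if u: "u \<in> {0..1}" for u n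
  proof -
    have step: "\<bar>x (D u (Suc n)) - x (D u n)\<bar> \<le> c * ?r ^ n" for n
    proof -
      have "\<bar>x (D u (Suc n)) - x (D u n)\<bar> \<le> c * ?r ^ Suc n"
      proof (cases "k u (Suc n) = 2 * k u n")
        case True
        then have "D u (Suc n) = D u n" by (simp add: D_def)
        then show ?thesis using c by simp
      next
        case False
        then have e: "k u (Suc n) = Suc (2 * k u n)" using k(4)[OF u, of n] by simp
        then have "2 * k u n < 2 ^ Suc n" using k(1)[OF u, of "Suc n"] by simp
        from inc[OF this] show ?thesis by (simp add: D_def e)
      qed
      also have "\<dots> \<le> c * ?r ^ n" using c by (intro mult_left_mono) auto
      finally show ?thesis .
    qed
    have tele: "\<bar>x (D u (n + m)) - x (D u n)\<bar> \<le> 10 * c * ?r ^ n * (1 - ?r ^ m)" for m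
    proof (induction m)
      case (Suc m)
      have "\<bar>x (D u (n + Suc m)) - x (D u n)\<bar> \<le> c * ?r ^ (n + m) + 10 * c * ?r ^ n * (1 - ?r ^ m)"
        using step[of "n + m"] Suc by simp
      also have "\<dots> = 10 * c * ?r ^ n * (1 - ?r ^ Suc m)" by (simp add: power_add algebra_simps)
      finally show ?case .
    qed simp
    have D01: "D u m \<in> {0..1}" for m
    proof -
      have "real (k u m) \<le> 2 ^ m" using k(1)[OF u, of m] by (metis of_nat_le_iff of_nat_numeral of_nat_power)
      then show ?thesis by (auto simp: D_def)
    qed
    have "(\<lambda>m. D u (n + m)) \<longlonglongrightarrow> u"
    proof (rule LIMSEQ_I)
      fix e :: real assume e: "e > 0"
      obtain N where N: "(1 / 2 :: real) ^ N < e" using real_arch_pow_inv[OF e, of "1 / 2"] by auto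
      show "\<exists>N. \<forall>m\<ge>N. norm (D u (n + m) - u) < e"
      proof (intro exI[of _ N] allI impI)
        fix m assume "m \<ge> N"
        have "real (k u (n + m)) / 2 ^ (n + m) \<le> 2 ^ (n + m) * u / 2 ^ (n + m)"
          "2 ^ (n + m) * u / 2 ^ (n + m) \<le> (real (k u (n + m)) + 1) / 2 ^ (n + m)"
          using k(2,3)[OF u, of "n + m"] by (intro divide_right_mono; simp)+
        then have "norm (D u (n + m) - u) \<le> 1 / 2 ^ (n + m)" by (simp add: D_def add_divide_distrib)
        also have "\<dots> \<le> 1 / 2 ^ N" using \<open>m \<ge> N\<close> by (intro divide_left_mono power_increasing) auto
        also have "\<dots> < e" using N by (simp add: power_one_over)
        finally show "norm (D u (n + m) - u) < e" .
      qed
    qed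
    then have "(\<lambda>m. x (D u (n + m))) \<longlonglongrightarrow> x u"
      using cont u D01 unfolding continuous_on_sequentially by (auto simp: o_def)
    then have "(\<lambda>m. \<bar>x (D u (n + m)) - x (D u n)\<bar>) \<longlonglongrightarrow> \<bar>x u - x (D u n)\<bar>"
      by (intro tendsto_intros)
    moreover have "\<bar>x (D u (n + m)) - x (D u n)\<bar> \<le> 10 * c * ?r ^ n" for m
    proof -
      have "10 * c * ?r ^ n * (1 - ?r ^ m) \<le> 10 * c * ?r ^ n" using c by (intro mult_left_le) auto
      then show ?thesis using tele[of m] by simp
    qed
    ultimately show ?thesis by (intro LIMSEQ_le_const2) auto
  qed
  have adj: "\<bar>x (D u n) - x (D v n)\<bar> \<le> c * ?r ^ n"
    if uv: "u \<in> {0..1}" "v \<in> {0..1}" "\<bar>u - v\<bar> \<le> 1 / 2 ^ n" "u \<le> v" for u v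
  proof -
    have "2 ^ n * u \<le> 2 ^ n * v" using uv by simp
    moreover have "2 ^ n * v \<le> 2 ^ n * u + 1" using uv by (simp add: field_simps)
    ultimately have "real (k u n) < real (k v n) + 1" "real (k v n) < real (k u n) + 2"
      using k(2,3)[OF uv(1), of n] k(2,3)[OF uv(2), of n] by linarith+
    then have "k v n = k u n \<or> k v n = Suc (k u n)" by linarith
    then show ?thesis
    proof
      assume e: "k v n = Suc (k u n)"
      then have "k u n < 2 ^ n" using k(1)[OF uv(2), of n] by simp
      from inc[OF this] show ?thesis by (simp add: D_def e abs_minus_commute)
    qed (use c in \<open>auto simp: D_def\<close>)
  qed
  have "\<bar>x (D u n) - x (D v n)\<bar> \<le> c * ?r ^ n"
  proof (cases "u \<le> v")
    case False
    then show ?thesis using adj[of v u] uv by (simp add: abs_minus_commute)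
  qed (use adj uv in auto)
  then show ?thesis using near[OF uv(1), of n] near[OF uv(2), of n] by linarith
qed

context continuous_process
begin

text \<open>
  By Markov's inequality the probability that one of the \<open>2\<^sup>n\<close> dyadic increments of order \<open>n\<close> exceeds
  \<open>c (9/10)\<^sup>n\<close> is at most \<open>B / c\<^sup>4\<close> times \<open>(5000/6561)\<^sup>n\<close>, and the sum of this geometric series is less than \<open>5\<close>.
\<close>
lemma dyadic_tightness:
  assumes Y0: "AE \<omega> in M. Y 0 \<omega> = 0" and B: "B \<ge> 0" and c: "c > 0"
    and mom: "\<And>u v. u \<in> {0..1} \<Longrightarrow> v \<in> {0..1} \<Longrightarrow>
      (\<integral>\<^sup>+\<omega>. ennreal ((Y u \<omega> - Y v \<omega>) ^ 4) \<partial>M) \<le> ennreal (B * (u - v)\<^sup>2)"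
  shows "\<exists>E\<in>sets M. prob (space M - E) \<le> 5 * B / c ^ 4 \<and> (\<forall>\<omega>\<in>E. path_C01 Y \<omega> \<in> holder_set (21 * c))"
proof -
  let ?r = "9 / 10 :: real"
  define bad where "bad n k = {\<omega> \<in> space M. \<bar>Y (real (Suc k) / 2 ^ n) \<omega> - Y (real k / 2 ^ n) \<omega>\<bar> > c * ?r ^ n}" for n k :: nat
  have in01: "real (Suc k) / 2 ^ n \<in> {0..1}" "real k / 2 ^ n \<in> {0..1}" if "k < 2 ^ n" for k n :: nat
  proof -
    have "real (Suc k) \<le> real (2 ^ n)" using that by (intro of_nat_mono) simp
    then have "real k + 1 \<le> 2 ^ n" by simp
    moreover from this have "real k \<le> 2 ^ n" by linarith
    ultimately show "real (Suc k) / 2 ^ n \<in> {0..1}" "real k / 2 ^ n \<in> {0..1}"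
      by (simp_all add: divide_le_eq_1_pos add.commute)
  qed
  have bad_sets: "bad n k \<in> sets M" if "k < 2 ^ n" for n k
  proof -
    have [measurable]: "Y (real (Suc k) / 2 ^ n) \<in> borel_measurable M" "Y (real k / 2 ^ n) \<in> borel_measurable M"
      using in01[OF that] by auto
    show ?thesis unfolding bad_def by measurable
  qed
  \<comment> \<open>This is \<open>1 / (2 (9/10)\<^sup>4)\<close>.\<close>
  define q :: real where "q = 5000 / 6561"
  have bad_prob: "emeasure M (bad n k) \<le> ennreal (B / c ^ 4 * (q / 2) ^ n)" if kn: "k < 2 ^ n" for n k
  proof -
    let ?d = "\<lambda>\<omega>. Y (real (Suc k) / 2 ^ n) \<omega> - Y (real k / 2 ^ n) \<omega>"
    let ?a = "(c * ?r ^ n) ^ 4"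
    have [measurable]: "Y (real (Suc k) / 2 ^ n) \<in> borel_measurable M" "Y (real k / 2 ^ n) \<in> borel_measurable M"
      using in01[OF kn] by auto
    have a: "?a > 0" using c by simp
    have "emeasure M (bad n k) = (\<integral>\<^sup>+\<omega>. indicator (bad n k) \<omega> \<partial>M)" using bad_sets[OF kn] by simp
    also have "\<dots> \<le> (\<integral>\<^sup>+\<omega>. ennreal (1 / ?a) * ennreal (?d \<omega> ^ 4) \<partial>M)"
    proof (rule nn_integral_mono)
      fix \<omega> assume "\<omega> \<in> space M"
      show "indicator (bad n k) \<omega> \<le> ennreal (1 / ?a) * ennreal (?d \<omega> ^ 4)"
      proof (cases "\<omega> \<in> bad n k")
        case True
        then have "c * ?r ^ n < \<bar>?d \<omega>\<bar>" by (simp add: bad_def)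
        then have "?a \<le> \<bar>?d \<omega>\<bar> ^ 4" using c by (intro power_mono) auto
        then have "?a \<le> ?d \<omega> ^ 4" by (simp add: power_even_abs)
        then have "1 \<le> 1 / ?a * ?d \<omega> ^ 4" using a by (simp add: field_simps)
        then show ?thesis using True a by (simp add: ennreal_mult'[symmetric] ennreal_1[symmetric] del: ennreal_1 times_divide_eq_left)
      qed simp
    qed
    also have "\<dots> = ennreal (1 / ?a) * (\<integral>\<^sup>+\<omega>. ennreal (?d \<omega> ^ 4) \<partial>M)"
      by (rule nn_integral_cmult) measurable
    also have "\<dots> \<le> ennreal (1 / ?a) * ennreal (B * (real (Suc k) / 2 ^ n - real k / 2 ^ n)\<^sup>2)"
      by (intro mult_left_mono mom in01 kn) simp
    also have "real (Suc k) / 2 ^ n - real k / 2 ^ n = (1 / 2) ^ n"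
      by (simp add: add_divide_distrib power_one_over)
    also have "ennreal (1 / ?a) * ennreal (B * ((1 / 2) ^ n)\<^sup>2) = ennreal (1 / ?a * (B * ((1 / 2) ^ n)\<^sup>2))"
      using a B by (intro ennreal_mult[symmetric]) auto
    also have "1 / ?a * (B * ((1 / 2) ^ n)\<^sup>2) = B / c ^ 4 * (q / 2) ^ n"
    proof -
      have gen: "1 / (c * P) ^ 4 * (B * (Q * P ^ 4)) = B / c ^ 4 * Q" if "P \<noteq> 0" for P Q
        using c that by (simp add: power_mult_distrib)
      have "((1 / 2 :: real) ^ n)\<^sup>2 = ((1 / 2)\<^sup>2) ^ n"
        by (simp only: power_mult[symmetric] mult.commute)
      also have "(1 / 2 :: real)\<^sup>2 = q / 2 * ?r ^ 4"
        by (simp add: q_def power2_eq_square power4_eq_xxxx)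
      also have "(q / 2 * ?r ^ 4) ^ n = (q / 2) ^ n * (?r ^ n) ^ 4"
        by (simp only: power_mult_distrib power_mult[symmetric] mult.commute)
      finally show ?thesis using gen[of "?r ^ n" "(q / 2) ^ n"] by simp
    qed
    finally show ?thesis .
  qed
  define Bad where "Bad n = (\<Union>k\<in>{..<2 ^ n::nat}. bad n k)" for n
  have Bad_sets: "Bad n \<in> sets M" for n unfolding Bad_def using bad_sets by (intro sets.finite_UN) auto
  have Bad_prob: "emeasure M (Bad n) \<le> ennreal (B / c ^ 4 * q ^ n)" for n
  proof -
    have "emeasure M (Bad n) \<le> (\<Sum>k\<in>{..<2 ^ n::nat}. emeasure M (bad n k))"
      unfolding Bad_def by (intro emeasure_subadditive_finite) (use bad_sets in auto)
    also have "\<dots> \<le> (\<Sum>k\<in>{..<2 ^ n::nat}. ennreal (B / c ^ 4 * (q / 2) ^ n))"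
      by (intro sum_mono bad_prob) auto
    also have "\<dots> = ennreal (2 ^ n * (B / c ^ 4 * (q / 2) ^ n))"
      using B by (subst sum_ennreal) (auto simp: q_def)
    also have "2 ^ n * (B / c ^ 4 * (q / 2) ^ n) = B / c ^ 4 * q ^ n" by (simp add: power_divide)
    finally show ?thesis .
  qed
  have "emeasure M (\<Union>n. Bad n) \<le> (\<Sum>n. emeasure M (Bad n))"
    by (rule emeasure_subadditive_countably) (use Bad_sets in auto)
  also have "\<dots> \<le> (\<Sum>n. ennreal (B / c ^ 4 * q ^ n))" by (intro suminf_le Bad_prob) auto
  also have "\<dots> = ennreal (B / c ^ 4 * (1 / (1 - q)))"
    using B geometric_sums[of q] by (intro suminf_ennreal_eq sums_mult) (auto simp: q_def)
  also have "\<dots> \<le> ennreal (5 * B / c ^ 4)"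
  proof (rule ennreal_leI)
    have "B / c ^ 4 * (1 / (1 - q)) \<le> B / c ^ 4 * 5"
      using B c by (intro mult_left_mono) (auto simp: q_def)
    then show "B / c ^ 4 * (1 / (1 - q)) \<le> 5 * B / c ^ 4" by (simp add: mult.commute)
  qed
  finally have U: "emeasure M (\<Union>n. Bad n) \<le> ennreal (5 * B / c ^ 4)" .
  obtain Z where Z: "Z \<in> null_sets M" "{\<omega> \<in> space M. \<not> (continuous_on {0..1} (\<lambda>u. Y u \<omega>) \<and> Y 0 \<omega> = 0)} \<subseteq> Z"
  proof -
    have "AE \<omega> in M. continuous_on {0..1} (\<lambda>u. Y u \<omega>) \<and> Y 0 \<omega> = 0"
      using Y_continuous Y0 by eventually_elim simp
    then show ?thesis using that by (auto simp: eventually_ae_filter)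
  qed
  define E where "E = space M - (\<Union>n. Bad n) - Z"
  have "E \<in> sets M" unfolding E_def using Bad_sets Z by auto
  moreover have "prob (space M - E) \<le> 5 * B / c ^ 4"
  proof -
    have "emeasure M (space M - E) \<le> emeasure M ((\<Union>n. Bad n) \<union> Z)"
      using Bad_sets Z by (intro emeasure_mono) (auto simp: E_def)
    also have "\<dots> = emeasure M (\<Union>n. Bad n)" using Z Bad_sets by (intro emeasure_Un_null_set) auto
    also note U
    finally show ?thesis using B by (simp add: emeasure_eq_measure)
  qed
  moreover have "path_C01 Y \<omega> \<in> holder_set (21 * c)" if w: "\<omega> \<in> E" for \<omega>
  proof -
    have w': "\<omega> \<in> space M" "continuous_on {0..1} (\<lambda>u. Y u \<omega>)" "Y 0 \<omega> = 0" using w Z by (auto simp: E_def)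
    have inc: "\<bar>Y (real (Suc k) / 2 ^ n) \<omega> - Y (real k / 2 ^ n) \<omega>\<bar> \<le> c * ?r ^ n" if "k < 2 ^ n" for n k
      using w that by (auto simp: E_def Bad_def bad_def not_less)
    have "path_C01 Y \<omega> = (\<lambda>u\<in>{0..1}. Y u \<omega>)" using w' by (simp add: path_C01_def)
    then show ?thesis
      using w'(3) dyadic_chaining[OF w'(2) less_imp_le[OF c] inc] by (auto simp: holder_set_def)
  qed
  ultimately show ?thesis by blast
qed

end

text \<open>The linear combination of the values \<open>x u\<close> with coefficients \<open>c\<close>, over the pairs \<open>(c, u)\<close> of a list.\<close>
definition lin_comb :: "(real \<times> real) list \<Rightarrow> (real \<Rightarrow> real) \<Rightarrow> real" where
  "lin_comb cs x = (\<Sum>(c, u)\<leftarrow>cs. c * x u)"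

lemma lin_comb_simps [simp]:
  "lin_comb [] x = 0" "lin_comb (p # cs) x = fst p * x (snd p) + lin_comb cs x"
  "lin_comb (cs @ ds) x = lin_comb cs x + lin_comb ds x"
  by (simp_all add: lin_comb_def split: prod.splits)

lemma lin_comb_uminus: "lin_comb (map (\<lambda>(c, u). (- c, u)) cs) x = - lin_comb cs x"
  by (induction cs) auto

text \<open>
  Trigonometric polynomials in finitely many evaluations at points of the unit interval. The phase \<open>b\<close> covers
  sines and constants.
\<close>
inductive trig_poly :: "((real \<Rightarrow> real) \<Rightarrow> real) \<Rightarrow> bool" where
  cos: "snd ` set cs \<subseteq> {0..1} \<Longrightarrow> trig_poly (\<lambda>x. a * cos (lin_comb cs x + b))"
| add: "trig_poly p \<Longrightarrow> trig_poly q \<Longrightarrow> trig_poly (\<lambda>x. p x + q x)"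

lemma trig_poly_const: "trig_poly (\<lambda>x. c)"
  using trig_poly.cos[of "[]" c 0] by simp

lemma trig_poly_mult:
  assumes p: "trig_poly p" and q: "trig_poly q"
  shows "trig_poly (\<lambda>x. p x * q x)"
  using p
proof induction
  case (cos cs a b)
  show ?case using q
  proof induction
    case (cos ds a' b')
    have "a * cos (lin_comb cs x + b) * (a' * cos (lin_comb ds x + b')) =
        (a * a' / 2) * cos (lin_comb (cs @ map (\<lambda>(c, u). (- c, u)) ds) x + (b - b')) +
        (a * a' / 2) * cos (lin_comb (cs @ ds) x + (b + b'))" for x
    proof -
      let ?w = "lin_comb cs x + b" and ?z = "lin_comb ds x + b'"
      have "lin_comb (cs @ map (\<lambda>(c, u). (- c, u)) ds) x + (b - b') = ?w - ?z" "lin_comb (cs @ ds) x + (b + b') = ?w + ?z"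
        by (simp_all add: lin_comb_uminus)
      moreover have "a * cos ?w * (a' * cos ?z) = a * a' * ((cos (?w - ?z) + cos (?w + ?z)) / 2)"
        unfolding cos_times_cos[symmetric] by (simp only: mult_ac)
      ultimately show ?thesis by (simp only: distrib_left times_divide_eq_right times_divide_eq_left add_divide_distrib)
    qed
    moreover have "snd ` set (cs @ map (\<lambda>(c, u). (- c, u)) ds) \<subseteq> {0..1}" "snd ` set (cs @ ds) \<subseteq> {0..1}"
      using \<open>snd ` set cs \<subseteq> {0..1}\<close> cos by force+
    ultimately show ?case by (simp only:) (intro trig_poly.intros)
  next
    case (add p' q')
    then show ?case unfolding distrib_left by (intro trig_poly.intros)
  qed
next
  case (add p' q')
  then show ?case unfolding distrib_right by (intro trig_poly.intros)
qed

lemma trig_poly_bounded: "trig_poly p \<Longrightarrow> \<exists>B\<ge>0. \<forall>x. \<bar>p x\<bar> \<le> B"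
proof (induction rule: trig_poly.induct)
  case (cos cs a b)
  show ?case by (rule exI[of _ "\<bar>a\<bar>"]) (auto simp: abs_mult mult_left_le)
next
  case (add p q)
  then obtain A B where "A \<ge> 0" "B \<ge> 0" "\<And>x. \<bar>p x\<bar> \<le> A" "\<And>x. \<bar>q x\<bar> \<le> B" by blast
  then show ?case by (intro exI[of _ "A + B"]) (auto intro: order_trans[OF abs_triangle_ineq add_mono])
qed

lemma continuous_on_lin_comb: "continuous_on S (lin_comb cs)"
proof (induction cs)
  case (Cons p cs)
  then show ?case by (simp, intro continuous_intros continuous_on_product_coordinates[THEN continuous_on_subset]) auto
qed simp

lemma trig_poly_continuous: "trig_poly p \<Longrightarrow> continuous_on S p"
  by (induction rule: trig_poly.induct) (auto intro!: continuous_intros continuous_on_lin_comb)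

lemma trig_poly_separates:
  assumes "x \<in> extensional {0..1}" "y \<in> extensional {0..1}" "x \<noteq> y"
  shows "\<exists>p. trig_poly p \<and> p x \<noteq> p y"
proof -
  obtain u where u: "u \<in> {0..1}" "x u \<noteq> y u" using assms by (metis extensionalityI)
  \<comment> \<open>The factor brings both values into the interval on which the sine is injective.\<close>
  define c where "c = 1 / (1 + \<bar>x u\<bar> + \<bar>y u\<bar>)"
  have c: "c > 0" by (simp add: c_def)
  have s: "trig_poly (\<lambda>x. 1 * cos (lin_comb [(c, u)] x + (- (pi / 2))))"
    by (rule trig_poly.cos) (use u in auto)
  have "(\<lambda>x. 1 * cos (lin_comb [(c, u)] x + (- (pi / 2)))) = (\<lambda>x. sin (c * x u))"
    by (simp add: cos_diff)
  with s have "trig_poly (\<lambda>x. sin (c * x u))" by simp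
  moreover have "sin (c * x u) \<noteq> sin (c * y u)"
  proof -
    have "\<bar>c * x u\<bar> \<le> 1" "\<bar>c * y u\<bar> \<le> 1" by (auto simp: c_def abs_mult divide_le_eq)
    moreover have "1 \<le> pi / 2" using pi_ge_two by simp
    ultimately have r: "- (pi / 2) \<le> c * x u" "c * x u \<le> pi / 2" "- (pi / 2) \<le> c * y u" "c * y u \<le> pi / 2" by linarith+
    have "c * x u \<noteq> c * y u" using u c by simp
    then show ?thesis using sin_inj_pi[OF r] by blast
  qed
  ultimately show ?thesis by (intro exI[of _ "\<lambda>x. sin (c * x u)"] conjI)
qed

text \<open>
  The approximation on \<open>H\<close> must not spoil the bound outside of \<open>H\<close>, where the paths lie with small but positive
  probability. Hence an approximation \<open>p\<close> is composed with a polynomial close to the function that cuts values off at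
  \<open>-G\<close> and \<open>G\<close>; this is again a trigonometric polynomial.
\<close>
lemma trig_poly_approximation:
  fixes g :: "(real \<Rightarrow> real) \<Rightarrow> real"
  assumes H: "compact H" "H \<subseteq> extensional {0..1}" and g: "continuous_on H g"
    and G: "\<And>x. x \<in> H \<Longrightarrow> \<bar>g x\<bar> \<le> G" "G \<ge> 0" and d: "d > 0"
  shows "\<exists>q. trig_poly q \<and> (\<forall>x\<in>H. \<bar>g x - q x\<bar> \<le> 2 * d) \<and> (\<forall>x. \<bar>q x\<bar> \<le> G + d)"
proof -
  have "\<exists>p. trig_poly p \<and> (\<forall>x\<in>H. \<bar>g x - p x\<bar> < d)"
  proof (rule Stone_Weierstrass_HOL[where P = trig_poly])
    fix x y assume "x \<in> H \<and> y \<in> H \<and> x \<noteq> y"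
    then show "\<exists>f. trig_poly f \<and> f x \<noteq> f y" using H(2) by (intro trig_poly_separates) auto
  qed (simp_all only: H g d trig_poly_const trig_poly_continuous trig_poly.add trig_poly_mult)
  then obtain p where p: "trig_poly p" "\<And>x. x \<in> H \<Longrightarrow> \<bar>g x - p x\<bar> < d" by blast
  obtain B where B: "\<And>x. \<bar>p x\<bar> \<le> B" using trig_poly_bounded[OF p(1)] by blast
  \<comment> \<open>Polynomials approximate the cut-off function on the range of \<open>p\<close>, and their composition with \<open>p\<close> stays in the algebra.\<close>
  define cl where "cl y = max (- G) (min G y)" for y :: real
  have "\<exists>Q. (continuous_on {-B..B} Q \<and> trig_poly (\<lambda>x. Q (p x))) \<and> (\<forall>y\<in>{-B..B}. \<bar>cl y - Q y\<bar> < d)"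
  proof (rule Stone_Weierstrass_HOL[where P = "\<lambda>Q. continuous_on {-B..B} Q \<and> trig_poly (\<lambda>x. Q (p x))"])
    show "\<exists>Q. (continuous_on {-B..B} Q \<and> trig_poly (\<lambda>x. Q (p x))) \<and> Q y \<noteq> Q z" if "y \<in> {-B..B} \<and> z \<in> {-B..B} \<and> y \<noteq> z" for y z
      by (rule exI[of _ "\<lambda>y. y"]) (use that p in auto)
    show "continuous_on {-B..B} cl" unfolding cl_def by (intro continuous_intros)
    show "continuous_on {-B..B} (\<lambda>x. Q x + R x) \<and> trig_poly (\<lambda>x. Q (p x) + R (p x))"
      if "(continuous_on {-B..B} Q \<and> trig_poly (\<lambda>x. Q (p x))) \<and> continuous_on {-B..B} R \<and> trig_poly (\<lambda>x. R (p x))" for Q R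
      using that trig_poly.add[of "\<lambda>x. Q (p x)" "\<lambda>x. R (p x)"] by (auto intro: continuous_on_add)
    show "continuous_on {-B..B} (\<lambda>x. Q x * R x) \<and> trig_poly (\<lambda>x. Q (p x) * R (p x))"
      if "(continuous_on {-B..B} Q \<and> trig_poly (\<lambda>x. Q (p x))) \<and> continuous_on {-B..B} R \<and> trig_poly (\<lambda>x. R (p x))" for Q R
      using that trig_poly_mult[of "\<lambda>x. Q (p x)" "\<lambda>x. R (p x)"] by (auto intro: continuous_on_mult)
  qed (simp_all add: d trig_poly_const)
  then obtain Q where Q: "trig_poly (\<lambda>x. Q (p x))" "\<And>y. y \<in> {-B..B} \<Longrightarrow> \<bar>cl y - Q y\<bar> < d" by blast
  have q: "\<bar>cl (p x) - Q (p x)\<bar> < d" for x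
  proof -
    have "p x \<in> {-B..B}" using B[of x] by auto
    then show ?thesis by (rule Q(2))
  qed
  show ?thesis
  proof (intro exI[of _ "\<lambda>x. Q (p x)"] conjI ballI allI)
    fix x
    have "\<bar>cl (p x)\<bar> \<le> G" using G(2) by (auto simp: cl_def)
    then show "\<bar>Q (p x)\<bar> \<le> G + d" using q[of x] by linarith
    assume "x \<in> H"
    then have "\<bar>g x - cl (p x)\<bar> < d" using p(2)[of x] G(1)[of x] by (auto simp: cl_def)
    then show "\<bar>g x - Q (p x)\<bar> \<le> 2 * d" using q[of x] by linarith
  qed (rule Q(1))
qed

context continuous_process
begin

lemma lin_comb_measurable:
  "snd ` set cs \<subseteq> {0..1} \<Longrightarrow> (\<lambda>\<omega>. lin_comb cs (\<lambda>u. Y u \<omega>)) \<in> borel_measurable M"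
  by (induction cs) auto

lemma path_eval_measurable:
  assumes "u \<in> {0..1}" shows "(\<lambda>\<omega>. path_C01 Y \<omega> u) \<in> borel_measurable (completion M)"
proof -
  have "AE \<omega> in M. Y u \<omega> = path_C01 Y \<omega> u" using path_eq by eventually_elim (use assms in auto)
  then show ?thesis by (rule borel_measurable_completion_AE[OF Y_measurable[OF assms]])
qed

lemma trig_poly_path_measurable:
  assumes "trig_poly p" shows "(\<lambda>\<omega>. p (path_C01 Y \<omega>)) \<in> borel_measurable (completion M)"
  using assms
proof induction
  case (cos cs a b)
  then have "(\<lambda>\<omega>. lin_comb cs (path_C01 Y \<omega>)) \<in> borel_measurable (completion M)"
    by (induction cs) (auto intro!: borel_measurable_add borel_measurable_times path_eval_measurable)
  then show ?case by measurable
qed simp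

lemma prob_completion: "prob_space (completion M)"
  by (rule prob_spaceI) (simp add: emeasure_space_1)

lemma trig_poly_path_integrable:
  assumes "trig_poly p" shows "integrable (completion M) (\<lambda>\<omega>. p (path_C01 Y \<omega>))"
proof -
  interpret C: prob_space "completion M" by (rule prob_completion)
  obtain B where "\<And>x. \<bar>p x\<bar> \<le> B" using trig_poly_bounded[OF assms] by blast
  then show ?thesis
    by (intro C.integrable_const_bound[of _ B] trig_poly_path_measurable assms) auto
qed

lemma integral_cos_path:
  assumes cs: "snd ` set cs \<subseteq> {0..1}"
  shows "(\<integral>\<omega>. a * cos (lin_comb cs (path_C01 Y \<omega>) + b) \<partial>completion M) =
    a * Re (cis b * (\<integral>\<omega>. cis (lin_comb cs (\<lambda>u. Y u \<omega>)) \<partial>M))"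
proof -
  note m[measurable] = lin_comb_measurable[OF cs]
  have int: "integrable M (\<lambda>\<omega>. cis (lin_comb cs (\<lambda>u. Y u \<omega>)))"
    by (rule integrable_const_bound[of _ 1]) auto
  have "(\<integral>\<omega>. a * cos (lin_comb cs (path_C01 Y \<omega>) + b) \<partial>completion M) =
      (\<integral>\<omega>. a * cos (lin_comb cs (\<lambda>u. Y u \<omega>) + b) \<partial>completion M)"
  proof (rule integral_cong_AE)
    show "(\<lambda>\<omega>. a * cos (lin_comb cs (path_C01 Y \<omega>) + b)) \<in> borel_measurable (completion M)"
      using trig_poly_path_measurable[OF trig_poly.cos[OF cs]] .
    show "(\<lambda>\<omega>. a * cos (lin_comb cs (\<lambda>u. Y u \<omega>) + b)) \<in> borel_measurable (completion M)"
      by (intro measurable_completion) measurable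
    have "AE \<omega> in M. lin_comb cs (path_C01 Y \<omega>) = lin_comb cs (\<lambda>u. Y u \<omega>)"
      using path_eq
    proof eventually_elim
      fix \<omega> assume "\<forall>u\<in>{0..1}. path_C01 Y \<omega> u = Y u \<omega>"
      then show "lin_comb cs (path_C01 Y \<omega>) = lin_comb cs (\<lambda>u. Y u \<omega>)" using cs by (induction cs) auto
    qed
    then have "AE \<omega> in M. a * cos (lin_comb cs (path_C01 Y \<omega>) + b) = a * cos (lin_comb cs (\<lambda>u. Y u \<omega>) + b)"
      by eventually_elim simp
    then show "AE \<omega> in completion M. a * cos (lin_comb cs (path_C01 Y \<omega>) + b) = a * cos (lin_comb cs (\<lambda>u. Y u \<omega>) + b)"
      by (rule AE_completion)
  qed
  also have "\<dots> = (\<integral>\<omega>. a * cos (lin_comb cs (\<lambda>u. Y u \<omega>) + b) \<partial>M)"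
    by (rule integral_completion) measurable
  also have "\<dots> = (\<integral>\<omega>. a * Re (cis b * cis (lin_comb cs (\<lambda>u. Y u \<omega>))) \<partial>M)"
    by (simp add: cis_mult add.commute)
  also have "\<dots> = a * Re (cis b * (\<integral>\<omega>. cis (lin_comb cs (\<lambda>u. Y u \<omega>)) \<partial>M))"
  proof -
    have "(\<integral>\<omega>. a * Re (cis b * cis (lin_comb cs (\<lambda>u. Y u \<omega>))) \<partial>M) = a * (\<integral>\<omega>. Re (cis b * cis (lin_comb cs (\<lambda>u. Y u \<omega>))) \<partial>M)"
      by (rule integral_mult_right_zero)
    also have "(\<integral>\<omega>. Re (cis b * cis (lin_comb cs (\<lambda>u. Y u \<omega>))) \<partial>M) = Re (\<integral>\<omega>. cis b * cis (lin_comb cs (\<lambda>u. Y u \<omega>)) \<partial>M)"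
      by (rule integral_Re) (intro integrable_mult_right int)
    finally show ?thesis by (simp only: integral_mult_right_zero)
  qed
  finally show ?thesis .
qed

text \<open>The error is at most \<open>2 d\<close> on the event \<open>E\<close>, and at most the sum of both bounds on its complement.\<close>
lemma integral_law_approximation:
  assumes g: "continuous_map (mtopology_of C01) euclideanreal g" and G: "\<And>x. x \<in> mspace C01 \<Longrightarrow> \<bar>g x\<bar> \<le> G"
    and q: "trig_poly q" "\<And>x. x \<in> H \<Longrightarrow> \<bar>g x - q x\<bar> \<le> 2 * d" "\<And>x. \<bar>q x\<bar> \<le> G + d" and d: "d > 0"
    and E: "E \<in> sets M" "prob (space M - E) \<le> d" "\<And>\<omega>. \<omega> \<in> E \<Longrightarrow> path_C01 Y \<omega> \<in> H"
  shows "\<bar>(\<integral>x. g x \<partial>law_C01 M Y) - (\<integral>\<omega>. q (path_C01 Y \<omega>) \<partial>completion M)\<bar> \<le> 2 * d + (2 * G + d) * d"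
proof -
  interpret C: prob_space "completion M" by (rule prob_completion)
  have G0: "G \<ge> 0" using G[OF path_C01_in_mspace[of Y undefined]] by linarith
  have gi: "integrable (completion M) (\<lambda>\<omega>. g (path_C01 Y \<omega>))"
    using G by (intro C.integrable_const_bound[of _ G] integral_law(2)[OF g]) auto
  note qi = trig_poly_path_integrable[OF q(1)]
  have Ei: "integrable (completion M) (\<lambda>\<omega>. 2 * d + (2 * G + d) * indicator (space M - E) \<omega>)"
    using E(1) by (intro Bochner_Integration.integrable_add integrable_mult_right C.integrable_const integrable_real_indicator)
      (auto simp: C.emeasure_eq_measure)
  have "\<bar>(\<integral>x. g x \<partial>law_C01 M Y) - (\<integral>\<omega>. q (path_C01 Y \<omega>) \<partial>completion M)\<bar> =
      \<bar>\<integral>\<omega>. g (path_C01 Y \<omega>) - q (path_C01 Y \<omega>) \<partial>completion M\<bar>"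
    unfolding integral_law(1)[OF g] using gi qi by simp
  also have "\<dots> \<le> (\<integral>\<omega>. \<bar>g (path_C01 Y \<omega>) - q (path_C01 Y \<omega>)\<bar> \<partial>completion M)"
    by (rule integral_abs_bound)
  also have "\<dots> \<le> (\<integral>\<omega>. 2 * d + (2 * G + d) * indicator (space M - E) \<omega> \<partial>completion M)"
  proof (rule integral_mono)
    fix \<omega> assume w: "\<omega> \<in> space (completion M)"
    show "\<bar>g (path_C01 Y \<omega>) - q (path_C01 Y \<omega>)\<bar> \<le> 2 * d + (2 * G + d) * indicator (space M - E) \<omega>"
    proof (cases "\<omega> \<in> E")
      case True
      then show ?thesis using q(2)[OF E(3)[OF True]] by simp
    next
      case False
      then show ?thesis using w G[of "path_C01 Y \<omega>"] q(3)[of "path_C01 Y \<omega>"] d by simp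
    qed
  qed (use gi qi Ei in auto)
  also have "\<dots> = 2 * d + (2 * G + d) * prob (space M - E)"
  proof -
    have I: "integrable (completion M) (\<lambda>\<omega>. (2 * G + d) * indicator (space M - E) \<omega>)"
      using E(1) by (intro integrable_mult_right integrable_real_indicator) (auto simp: emeasure_eq_measure)
    have "(\<integral>\<omega>. 2 * d + (2 * G + d) * indicator (space M - E) \<omega> \<partial>completion M) =
        (\<integral>\<omega>. 2 * d \<partial>completion M) + (\<integral>\<omega>. (2 * G + d) * indicator (space M - E) \<omega> \<partial>completion M)"
      by (rule Bochner_Integration.integral_add[OF C.integrable_const I])
    then show ?thesis using E(1) C.prob_space by (simp add: Int_absorb2)
  qed
  also have "\<dots> \<le> 2 * d + (2 * G + d) * d" using E(2) G0 d by (intro add_left_mono mult_left_mono) auto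
  finally show ?thesis .
qed

end

text \<open>
  A criterion for weak convergence: convergence of the characteristic functions of all linear combinations, and a
  common bound on fourth moments of increments.
\<close>
theorem weak_convergence_C01:
  fixes Y :: "'t \<Rightarrow> real \<Rightarrow> 'w \<Rightarrow> real" and L :: "real \<Rightarrow> 'v \<Rightarrow> real"
  assumes Y: "eventually (\<lambda>T. continuous_process M (Y T)) F" and L: "continuous_process N L"
    and Y0: "eventually (\<lambda>T. AE \<omega> in M. Y T 0 \<omega> = 0) F" and L0: "AE \<omega> in N. L 0 \<omega> = 0"
    and B: "B \<ge> 0"
    and Ymom: "eventually (\<lambda>T. \<forall>u\<in>{0..1}. \<forall>v\<in>{0..1}.
       (\<integral>\<^sup>+\<omega>. ennreal ((Y T u \<omega> - Y T v \<omega>) ^ 4) \<partial>M) \<le> ennreal (B * (u - v)\<^sup>2)) F"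
    and Lmom: "\<And>u v. u \<in> {0..1} \<Longrightarrow> v \<in> {0..1} \<Longrightarrow>
       (\<integral>\<^sup>+\<omega>. ennreal ((L u \<omega> - L v \<omega>) ^ 4) \<partial>N) \<le> ennreal (B * (u - v)\<^sup>2)"
    and char: "\<And>cs. snd ` set cs \<subseteq> {0..1} \<Longrightarrow>
       ((\<lambda>T. \<integral>\<omega>. cis (lin_comb cs (\<lambda>u. Y T u \<omega>)) \<partial>M) \<longlongrightarrow> (\<integral>\<omega>. cis (lin_comb cs (\<lambda>u. L u \<omega>)) \<partial>N)) F"
  shows "weakly_converges (mtopology_of C01) (\<lambda>T. law_C01 M (Y T)) (law_C01 N L) F"
  unfolding weakly_converges_def
proof (intro allI impI)
  fix g :: "(real \<Rightarrow> real) \<Rightarrow> real"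
  assume "continuous_map (mtopology_of C01) euclideanreal g \<and> bounded (g ` topspace (mtopology_of C01))"
  then have g: "continuous_map (mtopology_of C01) euclideanreal g" and bd: "bounded (g ` mspace C01)" by auto
  obtain G where G: "\<And>x. x \<in> mspace C01 \<Longrightarrow> \<bar>g x\<bar> \<le> G" and G0: "G > 0"
    using bd unfolding bounded_pos by auto
  interpret L: continuous_process N L by (rule L)
  have trig: "((\<lambda>T. \<integral>\<omega>. p (path_C01 (Y T) \<omega>) \<partial>completion M) \<longlongrightarrow> (\<integral>\<omega>. p (path_C01 L \<omega>) \<partial>completion N)) F"
    if "trig_poly p" for p
    using that
  proof induction
    case (cos cs a b)
    have "((\<lambda>T. a * Re (cis b * (\<integral>\<omega>. cis (lin_comb cs (\<lambda>u. Y T u \<omega>)) \<partial>M))) \<longlongrightarrow>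
        a * Re (cis b * (\<integral>\<omega>. cis (lin_comb cs (\<lambda>u. L u \<omega>)) \<partial>N))) F"
      by (intro tendsto_intros char cos)
    then show ?case
      unfolding L.integral_cos_path[OF cos]
    proof (rule Lim_transform_eventually)
      show "eventually (\<lambda>T. a * Re (cis b * (\<integral>\<omega>. cis (lin_comb cs (\<lambda>u. Y T u \<omega>)) \<partial>M)) =
          (\<integral>\<omega>. a * cos (lin_comb cs (path_C01 (Y T) \<omega>) + b) \<partial>completion M)) F"
        using Y by eventually_elim (rule continuous_process.integral_cos_path[OF _ cos, symmetric])
    qed
  next
    case (add p q)
    have "((\<lambda>T. (\<integral>\<omega>. p (path_C01 (Y T) \<omega>) \<partial>completion M) + (\<integral>\<omega>. q (path_C01 (Y T) \<omega>) \<partial>completion M)) \<longlongrightarrow>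
        (\<integral>\<omega>. p (path_C01 L \<omega>) \<partial>completion N) + (\<integral>\<omega>. q (path_C01 L \<omega>) \<partial>completion N)) F"
      by (intro tendsto_add add)
    moreover have "(\<integral>\<omega>. p (path_C01 L \<omega>) \<partial>completion N) + (\<integral>\<omega>. q (path_C01 L \<omega>) \<partial>completion N) =
        (\<integral>\<omega>. p (path_C01 L \<omega>) + q (path_C01 L \<omega>) \<partial>completion N)"
      using add.hyps by (simp add: L.trig_poly_path_integrable)
    moreover have "eventually (\<lambda>T. (\<integral>\<omega>. p (path_C01 (Y T) \<omega>) \<partial>completion M) + (\<integral>\<omega>. q (path_C01 (Y T) \<omega>) \<partial>completion M) =
        (\<integral>\<omega>. p (path_C01 (Y T) \<omega>) + q (path_C01 (Y T) \<omega>) \<partial>completion M)) F"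
      using Y by eventually_elim (use add.hyps in \<open>simp add: continuous_process.trig_poly_path_integrable\<close>)
    ultimately show ?case by (simp add: Lim_transform_eventually)
  qed
  show "((\<lambda>T. \<integral>x. g x \<partial>law_C01 M (Y T)) \<longlongrightarrow> (\<integral>x. g x \<partial>law_C01 N L)) F"
  proof (rule tendstoI)
    fix e :: real assume e: "e > 0"
    define d where "d = min 1 (e / (4 * G + 8))"
    have d: "d > 0" "d \<le> 1" using e G0 by (auto simp: d_def)
    have "d \<le> e / (4 * G + 8)" by (simp add: d_def)
    then have d3: "(4 * G + 8) * d \<le> e" using G0 by (simp add: pos_le_divide_eq mult.commute)
    \<comment> \<open>The modulus of continuity is chosen so that the exceptional probability \<open>5 B / c\<^sup>4\<close> is at most \<open>d\<close>.\<close>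
    define c where "c = root 4 (5 * B / d + 1)"
    have c: "c > 0" "c ^ 4 = 5 * B / d + 1" using B d by (simp_all add: c_def add_nonneg_pos)
    have cB: "5 * B / c ^ 4 \<le> d" using d B unfolding c(2) by (simp add: field_simps)
    have H: "compact (holder_set (21 * c))" "holder_set (21 * c) \<subseteq> extensional {0..1}" "continuous_on (holder_set (21 * c)) g"
      by (rule compact_holder_set, simp add: holder_set_def Collect_mono_iff, rule continuous_on_holder_set[OF g])
    obtain q where q: "trig_poly q" "\<And>x. x \<in> holder_set (21 * c) \<Longrightarrow> \<bar>g x - q x\<bar> \<le> 2 * d" "\<And>x. \<bar>q x\<bar> \<le> G + d"
      using trig_poly_approximation[OF H, of G d] G G0 d holder_set_subset by (meson less_imp_le subset_iff)
    obtain E where E: "E \<in> sets N" "L.prob (space N - E) \<le> d" "\<And>\<omega>. \<omega> \<in> E \<Longrightarrow> path_C01 L \<omega> \<in> holder_set (21 * c)"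
      using L.dyadic_tightness[OF L0 B c(1) Lmom] cB by (metis order_trans)
    have Lb: "\<bar>(\<integral>x. g x \<partial>law_C01 N L) - (\<integral>\<omega>. q (path_C01 L \<omega>) \<partial>completion N)\<bar> \<le> 2 * d + (2 * G + d) * d"
      by (rule L.integral_law_approximation[OF g G q d(1) E])
    have "eventually (\<lambda>T. \<bar>(\<integral>x. g x \<partial>law_C01 M (Y T)) - (\<integral>\<omega>. q (path_C01 (Y T) \<omega>) \<partial>completion M)\<bar> \<le> 2 * d + (2 * G + d) * d) F"
      using Y Y0 Ymom
    proof eventually_elim
      fix T assume T: "continuous_process M (Y T)" "AE \<omega> in M. Y T 0 \<omega> = 0"
        "\<forall>u\<in>{0..1}. \<forall>v\<in>{0..1}. (\<integral>\<^sup>+\<omega>. ennreal ((Y T u \<omega> - Y T v \<omega>) ^ 4) \<partial>M) \<le> ennreal (B * (u - v)\<^sup>2)"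
      interpret Y: continuous_process M "Y T" by (rule T)
      obtain E where E: "E \<in> sets M" "Y.prob (space M - E) \<le> d" "\<And>\<omega>. \<omega> \<in> E \<Longrightarrow> path_C01 (Y T) \<omega> \<in> holder_set (21 * c)"
        using Y.dyadic_tightness[OF T(2) B c(1) T(3)[rule_format]] cB by (metis order_trans)
      show "\<bar>(\<integral>x. g x \<partial>law_C01 M (Y T)) - (\<integral>\<omega>. q (path_C01 (Y T) \<omega>) \<partial>completion M)\<bar> \<le> 2 * d + (2 * G + d) * d"
        by (rule Y.integral_law_approximation[OF g G q d(1) E])
    qed
    moreover have "eventually (\<lambda>T. dist (\<integral>\<omega>. q (path_C01 (Y T) \<omega>) \<partial>completion M) (\<integral>\<omega>. q (path_C01 L \<omega>) \<partial>completion N) < d) F"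
      by (rule tendstoD[OF trig[OF q(1)] d(1)])
    ultimately show "eventually (\<lambda>T. dist (\<integral>x. g x \<partial>law_C01 M (Y T)) (\<integral>x. g x \<partial>law_C01 N L) < e) F"
    proof eventually_elim
      case (elim T)
      have "d * d \<le> 1 * d" using d by (intro mult_right_mono) auto
      then have "2 * (2 * d + (2 * G + d) * d) + d < (4 * G + 8) * d"
        using d G0 by (simp add: algebra_simps)
      then show ?case using elim Lb d3 by (simp add: dist_real_def)
    qed
  qed
qed

section \<open>Convergence of the finite-dimensional distributions\<close>

lemma nn_integral_powr_add_finite:
  fixes f g :: "'a \<Rightarrow> complex"
  assumes [measurable]: "f \<in> borel_measurable M" "g \<in> borel_measurable M" and s: "s > 0"
    and f: "(\<integral>\<^sup>+x. ennreal (norm (f x) powr s) \<partial>M) < \<infinity>" and g: "(\<integral>\<^sup>+x. ennreal (norm (g x) powr s) \<partial>M) < \<infinity>"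
  shows "(\<integral>\<^sup>+x. ennreal (norm (f x + g x) powr s) \<partial>M) < \<infinity>"
proof -
  have le: "norm (f x + g x) powr s \<le> 2 powr s * (norm (f x) powr s + norm (g x) powr s)" for x
  proof -
    have "norm (f x + g x) powr s \<le> (2 * max (norm (f x)) (norm (g x))) powr s"
      using s norm_triangle_ineq[of "f x" "g x"] by (intro powr_mono2) auto
    also have "\<dots> = 2 powr s * max (norm (f x)) (norm (g x)) powr s" by (simp add: powr_mult)
    also have "max (norm (f x)) (norm (g x)) powr s \<le> norm (f x) powr s + norm (g x) powr s"
      by (cases "norm (f x) \<le> norm (g x)") (simp_all add: max_def)
    finally show ?thesis by simp
  qed
  have "(\<integral>\<^sup>+x. ennreal (norm (f x + g x) powr s) \<partial>M) \<le>
      (\<integral>\<^sup>+x. ennreal (2 powr s) * (ennreal (norm (f x) powr s) + ennreal (norm (g x) powr s)) \<partial>M)"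
    using le by (intro nn_integral_mono) (simp add: ennreal_mult'[symmetric] ennreal_leI flip: ennreal_plus)
  also have "\<dots> = ennreal (2 powr s) * ((\<integral>\<^sup>+x. ennreal (norm (f x) powr s) \<partial>M) + (\<integral>\<^sup>+x. ennreal (norm (g x) powr s) \<partial>M))"
    by (simp add: nn_integral_cmult nn_integral_add)
  also have "\<dots> < \<infinity>" using f g by (simp add: ennreal_mult_less_top)
  finally show ?thesis .
qed

lemma nn_integral_powr_cmult_finite:
  fixes f :: "'a \<Rightarrow> complex"
  assumes [measurable]: "f \<in> borel_measurable M" and f: "(\<integral>\<^sup>+x. ennreal (norm (f x) powr s) \<partial>M) < \<infinity>"
  shows "(\<integral>\<^sup>+x. ennreal (norm (c * f x) powr s) \<partial>M) < \<infinity>"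
proof -
  have "(\<integral>\<^sup>+x. ennreal (norm (c * f x) powr s) \<partial>M) = ennreal (norm c powr s) * (\<integral>\<^sup>+x. ennreal (norm (f x) powr s) \<partial>M)"
    by (subst nn_integral_cmult[symmetric]) (auto simp: norm_mult powr_mult ennreal_mult')
  then show ?thesis using f by (simp add: ennreal_mult_less_top)
qed

lemma fourier_linear:
  assumes "integrable lborel \<psi>" "integrable lborel \<phi>"
  shows "fourier (\<lambda>t. c * \<psi> t + \<phi> t) l = complex_of_real c * fourier \<psi> l + fourier \<phi> l"
proof -
  have "fourier (\<lambda>t. c * \<psi> t + \<phi> t) l = (\<integral>t. complex_of_real c * (complex_of_real (\<psi> t) * cis (t \<bullet> l)) + complex_of_real (\<phi> t) * cis (t \<bullet> l) \<partial>lborel)"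
    by (simp add: fourier_def algebra_simps)
  also have "\<dots> = complex_of_real c * fourier \<psi> l + fourier \<phi> l"
    unfolding fourier_def using integrable_fourier[OF assms(1)] integrable_fourier[OF assms(2)]
    by (subst Bochner_Integration.integral_add) auto
  finally show ?thesis .
qed

context convex_body
begin

text \<open>
  The weight for which the rescaled linear functional is the linear combination of values of \<open>Y T\<close>, and
  the white noise integral is that of values of the limit.
\<close>
definition profile :: "(real \<times> real) list \<Rightarrow> real ^ 'd \<Rightarrow> real" where
  "profile cs t = (\<Sum>(c, u)\<leftarrow>cs. c * ind (root CARD('d) u) t)"

lemma profile_simps [simp]:
  "profile [] t = 0" "profile (p # cs) t = fst p * ind (root CARD('d) (snd p)) t + profile cs t"
  by (simp_all add: profile_def split: prod.splits)

lemma profile_Nil: "profile [] = (\<lambda>t. 0)"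
  and profile_Cons: "profile (p # cs) = (\<lambda>t. fst p * ind (root CARD('d) (snd p)) t + profile cs t)"
  by (simp_all add: fun_eq_iff)

lemma profile_measurable [measurable]: "profile cs \<in> borel_measurable borel"
  by (induction cs) (simp_all add: profile_Nil profile_Cons)

lemma profile_integrable: "integrable lborel (profile cs)"
  by (induction cs) (simp_all add: profile_Nil profile_Cons integrable_ind)

lemma profile_bounded: "\<exists>C. \<forall>t. \<bar>profile cs t\<bar> \<le> C"
proof (induction cs)
  case (Cons p cs)
  then obtain C where C: "\<And>t. \<bar>profile cs t\<bar> \<le> C" by blast
  have "\<bar>profile (p # cs) t\<bar> \<le> \<bar>fst p\<bar> + C" for t
  proof -
    have "\<bar>fst p * ind (root CARD('d) (snd p)) t\<bar> \<le> \<bar>fst p\<bar>"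
      using ind_bounds(3) by (simp add: abs_mult mult_left_le)
    then show ?thesis using C[of t] by simp
  qed
  then show ?case by blast
qed (simp add: exI[of _ 0])

lemma profile_AE_translate:
  assumes "h \<longlonglongrightarrow> 0"
  shows "AE t in lborel. (\<lambda>n. profile cs (t - h n)) \<longlonglongrightarrow> profile cs t"
proof (induction cs)
  case (Cons p cs)
  then show ?case using AE_ind_translate[OF assms, of "root CARD('d) (snd p)"]
    by eventually_elim (simp, intro tendsto_intros)
qed simp

lemma ind_eq_rescaled:
  assumes "\<rho> > 0"
  shows "ind \<rho> t = \<rho> powr (real CARD('d) / 2) * rescaled (ind 1) \<rho> t"
  using ind_scale[OF assms, of 1 t] assms by (simp add: rescaled_def)

lemma nn_integral_fourier_ind:
  assumes "\<rho> > 0"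
  shows "(\<integral>\<^sup>+l. ennreal (norm (fourier (ind \<rho>) l) powr s) \<partial>lborel) =
    ennreal ((\<rho> powr (real CARD('d) / 2)) powr s * \<rho> powr (real CARD('d) * (s / 2 - 1))) *
    (\<integral>\<^sup>+l. ennreal (norm (fourier (ind 1) l) powr s) \<partial>lborel)"
proof -
  let ?a = "\<rho> powr (real CARD('d) / 2)"
  have "fourier (ind \<rho>) l = complex_of_real ?a * fourier (rescaled (ind 1) \<rho>) l" for l
  proof -
    have "ind \<rho> = (\<lambda>t. ?a * rescaled (ind 1) \<rho> t + 0)" using ind_eq_rescaled[OF assms] by (simp add: fun_eq_iff)
    then show ?thesis
      using fourier_linear[OF rescaled_integrable[OF integrable_ind assms], of "\<lambda>_. 0" ?a 1 l] by (simp add: fourier_def)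
  qed
  then have "(\<integral>\<^sup>+l. ennreal (norm (fourier (ind \<rho>) l) powr s) \<partial>lborel) =
     (\<integral>\<^sup>+l. ennreal (?a powr s) * ennreal (norm (fourier (rescaled (ind 1) \<rho>) l) powr s) \<partial>lborel)"
    by (simp add: norm_mult powr_mult ennreal_mult')
  also have "\<dots> = ennreal (?a powr s) * (\<integral>\<^sup>+l. ennreal (norm (fourier (rescaled (ind 1) \<rho>) l) powr s) \<partial>lborel)"
    by (rule nn_integral_cmult) measurable
  finally show ?thesis
    unfolding nn_integral_fourier_rescaled[OF ind_measurable assms] by (simp add: ennreal_mult mult.assoc)
qed

lemma nn_integral_fourier_profile_finite:
  assumes s: "s > 0" and K: "(\<integral>\<^sup>+l. ennreal (norm (fourier_set K l) powr s) \<partial>lborel) < \<infinity>"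
  shows "(\<integral>\<^sup>+l. ennreal (norm (fourier (profile cs) l) powr s) \<partial>lborel) < \<infinity>"
proof (induction cs)
  case Nil
  then show ?case using s by (simp add: profile_Nil fourier_def)
next
  case (Cons p cs)
  let ?\<rho> = "root CARD('d) (snd p)"
  have K1: "fourier_set K l = fourier (ind 1) l" for l
    using fourier_set_dilate[of 1 l] by (simp add: dilate_def)
  have "(\<integral>\<^sup>+l. ennreal (norm (fourier (ind ?\<rho>) l) powr s) \<partial>lborel) < \<infinity>"
  proof (cases "?\<rho> > 0")
    case True
    then show ?thesis unfolding nn_integral_fourier_ind[OF True] using K by (simp add: K1 ennreal_mult_less_top)
  next
    case False
    then show ?thesis using s by (simp add: ind_def[abs_def] fourier_def)
  qed
  moreover have "fourier (profile (p # cs)) l = complex_of_real (fst p) * fourier (ind ?\<rho>) l + fourier (profile cs) l" for l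
    unfolding profile_Cons by (rule fourier_linear[OF integrable_ind profile_integrable])
  ultimately show ?case
    using Cons s by (simp only:) (intro nn_integral_powr_add_finite nn_integral_powr_cmult_finite; simp)
qed

end

text \<open>
  The assumptions on the field, its spectral densities and the convex body under which the limit theorem
  is proved.
\<close>
locale clt_setup = moment_field M X + convex_body K
  for M :: "'w measure" and X :: "real ^ 'd \<Rightarrow> 'w \<Rightarrow> real" and K :: "(real ^ 'd) set" +
  fixes f :: "nat \<Rightarrow> (nat \<Rightarrow> real ^ 'd) \<Rightarrow> complex" and p_star :: real
  assumes spectral: "cumulant_spectral_densities M X f"
    and vol_pos: "0 < measure lebesgue K"
    and p_star: "p_star < 2" and fourier_Lp: "\<And>p. p > p_star \<Longrightarrow> in_Lp p lborel (fourier_set K)"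
    and covar_integrable: "integrable lborel covar"
    and f_Lp: "\<And>k. k \<ge> 3 \<Longrightarrow> in_Lp (2 * (real k - 1) / (real k - 2)) (freq_space k) (f k)"
    and kernel: "kernel_properties K"
begin

abbreviation Y :: "real \<Rightarrow> real \<Rightarrow> 'w \<Rightarrow> real" where "Y \<equiv> Y_process X K"

lemma root_unit: "u \<in> {0..1} \<Longrightarrow> 0 \<le> root CARD('d) u \<and> root CARD('d) u \<le> 1"
  using real_root_le_mono[of "CARD('d)" u 1] by simp

lemma root_power: "u \<in> {0..1} \<Longrightarrow> root CARD('d) u ^ CARD('d) = u"
  by (rule real_root_pow_pos2) auto

lemma X_section_measurable: "\<omega> \<in> space M \<Longrightarrow> (\<lambda>t. X t \<omega>) \<in> borel_measurable borel"
  by (rule X_compose) auto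

lemma Y_eq:
  assumes "\<omega> \<in> space M" "T > 0" "u \<in> {0..1}"
  shows "Y T u \<omega> = lin_fun (rescaled (ind (root CARD('d) u)) T) \<omega>"
proof -
  let ?\<rho> = "root CARD('d) u"
  have "dilate ?\<rho> (dilate T K) = dilate (?\<rho> * T) K" by (auto simp: dilate_def image_image)
  moreover have "(LINT t:dilate (?\<rho> * T) K|lebesgue. X t \<omega>) = (\<integral>t. ind (?\<rho> * T) t *\<^sub>R X t \<omega> \<partial>lborel)"
    using root_unit[OF assms(3)] assms by (intro set_integral_dilate X_section_measurable) auto
  ultimately have "Y T u \<omega> = 1 / T powr (real CARD('d) / 2) * (\<integral>t. ind ?\<rho> (t /\<^sub>R T) * X t \<omega> \<partial>lborel)"
    using assms by (simp add: Y_process_def ind_scale)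
  also have "\<dots> = (\<integral>t. 1 / T powr (real CARD('d) / 2) * (ind ?\<rho> (t /\<^sub>R T) * X t \<omega>) \<partial>lborel)"
    by (rule integral_mult_right_zero[symmetric])
  also have "\<dots> = lin_fun (rescaled (ind ?\<rho>) T) \<omega>"
    by (simp add: lin_fun_def rescaled_def)
  finally show ?thesis .
qed

lemma AE_integrable_ind: "AE \<omega> in M. integrable lborel (\<lambda>t. ind R t * X t \<omega>)"
  by (rule AE_integrable_weighted[OF ind_measurable integrable_ind])

lemma Y_continuous_process:
  assumes T: "T > 0"
  shows "continuous_process M (Y T)"
proof (intro continuous_process.intro continuous_process_axioms.intro prob_space_axioms)
  fix u :: real assume u: "u \<in> {0..1}"
  have "lin_fun (rescaled (ind (root CARD('d) u)) T) \<in> borel_measurable M" by measurable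
  then show "Y T u \<in> borel_measurable M"
    using Y_eq[OF _ T u] by (simp cong: measurable_cong)
next
  show "AE \<omega> in M. continuous_on {0..1} (\<lambda>u. Y T u \<omega>)"
    using AE_integrable_ind[of T] AE_space
  proof eventually_elim
    fix \<omega> assume i: "integrable lborel (\<lambda>t. ind T t * X t \<omega>)" and w: "\<omega> \<in> space M"
    have "continuous_on {0..1} (\<lambda>u. \<integral>t. ind (root CARD('d) u * T) t * X t \<omega> \<partial>lborel)"
    proof (rule continuous_on_ind_integral[OF i X_section_measurable[OF w]])
      show "continuous_on {0..1} (\<lambda>u. root CARD('d) u * T)" by (intro continuous_intros)
      show "0 \<le> root CARD('d) u * T \<and> root CARD('d) u * T \<le> T" if "u \<in> {0..1}" for u
        using root_unit[OF that] T by (simp add: mult_left_le_one_le)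
    qed
    then have "continuous_on {0..1} (\<lambda>u. 1 / T powr (real CARD('d) / 2) * (\<integral>t. ind (root CARD('d) u * T) t * X t \<omega> \<partial>lborel))"
      by (intro continuous_intros)
    then show "continuous_on {0..1} (\<lambda>u. Y T u \<omega>)"
    proof (rule continuous_on_eq)
      fix u :: real assume u: "u \<in> {0..1}"
      have "(\<integral>t. 1 / T powr (real CARD('d) / 2) * (ind (root CARD('d) u * T) t * X t \<omega>) \<partial>lborel) = Y T u \<omega>"
        unfolding Y_eq[OF w T u] lin_fun_def rescaled_def using T by (simp add: ind_scale)
      then show "1 / T powr (real CARD('d) / 2) * (\<integral>t. ind (root CARD('d) u * T) t * X t \<omega> \<partial>lborel) = Y T u \<omega>"
        by (simp only: integral_mult_right_zero)
    qed
  qed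
qed

lemma Y_zero:
  assumes "T > 0" shows "AE \<omega> in M. Y T 0 \<omega> = 0"
  using AE_space by eventually_elim (simp add: Y_eq[OF _ assms] lin_fun_def rescaled_def ind_def)

lemma lin_fun_linear:
  assumes "integrable lborel (\<lambda>t. \<psi> t * X t \<omega>)" "integrable lborel (\<lambda>t. \<phi> t * X t \<omega>)"
  shows "lin_fun (\<lambda>t. c * \<psi> t + \<phi> t) \<omega> = c * lin_fun \<psi> \<omega> + lin_fun \<phi> \<omega>"
proof -
  have "lin_fun (\<lambda>t. c * \<psi> t + \<phi> t) \<omega> = (\<integral>t. c * (\<psi> t * X t \<omega>) + \<phi> t * X t \<omega> \<partial>lborel)"
    by (simp add: lin_fun_def algebra_simps)
  also have "\<dots> = c * lin_fun \<psi> \<omega> + lin_fun \<phi> \<omega>"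
    unfolding lin_fun_def using assms by (subst Bochner_Integration.integral_add) auto
  finally show ?thesis .
qed

lemma AE_integrable_rescaled:
  assumes "T > 0" "\<Psi> \<in> borel_measurable borel" "integrable lborel \<Psi>"
  shows "AE \<omega> in M. integrable lborel (\<lambda>t. rescaled \<Psi> T t * X t \<omega>)"
  using assms by (intro AE_integrable_weighted rescaled_measurable rescaled_integrable)

text \<open>
  The points of the combination must not be negative: \<^const>\<open>root\<close> takes negative values there, for which
  \<open>ind\<close> vanishes while the integral over the dilate need not.
\<close>
lemma lin_comb_Y:
  assumes T: "T > 0"
  shows "snd ` set cs \<subseteq> {0..1} \<Longrightarrow> AE \<omega> in M. lin_comb cs (\<lambda>u. Y T u \<omega>) = lin_fun (rescaled (profile cs) T) \<omega>"
proof (induction cs)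
  case Nil
  then show ?case by (simp add: lin_fun_def rescaled_def)
next
  case (Cons p cs)
  then have p: "snd p \<in> {0..1}" and cs: "snd ` set cs \<subseteq> {0..1}" by auto
  have "rescaled (profile (p # cs)) T t = fst p * rescaled (ind (root CARD('d) (snd p))) T t + rescaled (profile cs) T t" for t
    by (simp add: rescaled_def add_divide_distrib)
  then have r: "rescaled (profile (p # cs)) T = (\<lambda>t. fst p * rescaled (ind (root CARD('d) (snd p))) T t + rescaled (profile cs) T t)"
    by (simp add: fun_eq_iff)
  show ?case
    using Cons.IH[OF cs] AE_space AE_integrable_rescaled[OF T ind_measurable integrable_ind[of "root CARD('d) (snd p)"]]
      AE_integrable_rescaled[OF T profile_measurable profile_integrable, of cs]
  proof eventually_elim
    case (elim \<omega>)
    then show ?case unfolding r lin_fun_linear[OF elim(3,4)] by (simp add: Y_eq[OF _ T p])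
  qed
qed

lemma fourier_Ls:
  assumes "s > p_star" "s > 0"
  shows "(\<integral>\<^sup>+l. ennreal (norm (fourier (profile cs) l) powr s) \<partial>lborel) < \<infinity>"
proof (rule nn_integral_fourier_profile_finite[OF assms(2)])
  have "integrable lborel (\<lambda>l. norm (fourier_set K l) powr s)" using fourier_Lp[OF assms(1)] by (simp add: in_Lp_def)
  then show "(\<integral>\<^sup>+l. ennreal (norm (fourier_set K l) powr s) \<partial>lborel) < \<infinity>"
    by (simp add: integrable_iff_bounded)
qed

lemma moment_tendsto:
  "((\<lambda>T. moment (rescaled (profile cs) T) n) \<longlongrightarrow>
     gaussian_moment ((\<integral>h. covar h \<partial>lborel) * (\<integral>t. profile cs t * profile cs t \<partial>lborel)) n) at_top"
proof (cases "n = 0")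
  case True
  have "moment \<psi> 0 = 1" for \<psi> by (simp add: moment_def prob_space)
  then show ?thesis using True by simp
next
  case False
  let ?v = "(\<integral>h. covar h \<partial>lborel) * (\<integral>t. profile cs t * profile cs t \<partial>lborel)"
  let ?m = "\<lambda>T. moment (rescaled (profile cs) T)"
  obtain C where C: "\<And>t. \<bar>profile cs t\<bar> \<le> C" using profile_bounded[of cs] by blast
  have pos: "eventually (\<lambda>T::real. T > 0) at_top" by (rule eventually_gt_at_top)
  have m1: "eventually (\<lambda>T. ?m T 1 = 0) at_top"
    using pos by eventually_elim (intro moment_1 rescaled_measurable rescaled_integrable profile_measurable profile_integrable)
  have m2: "((\<lambda>T. ?m T 2) \<longlongrightarrow> ?v) at_top"
    by (rule moment_2_tendsto[OF profile_measurable profile_integrable C covar_integrable profile_AE_translate])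
  show ?thesis
  proof (rule moments_tendsto_from_cumulants)
    fix k :: nat assume k: "k \<ge> 1"
    consider "k = 1" | "k = 2" | "k \<ge> 3" using k by linarith
    then show "((\<lambda>T. partition_cumulant (?m T) k) \<longlongrightarrow> partition_cumulant (gaussian_moment ?v) k) at_top"
    proof cases
      case 1
      have "((\<lambda>T. ?m T 1) \<longlongrightarrow> 0) at_top" by (rule tendsto_eventually[OF m1])
      then show ?thesis by (simp only: 1 partition_cumulant_1 gaussian_moment_simps)
    next
      case 2
      have "((\<lambda>T. ?m T 2 - (?m T 1)\<^sup>2) \<longlongrightarrow> ?v - 0\<^sup>2) at_top"
        by (intro tendsto_intros m2 tendsto_eventually[OF m1])
      then show ?thesis using partition_cumulant_gaussian[of 2 ?v] unfolding 2 partition_cumulant_2 by simp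
    next
      case 3
      \<comment> \<open>Any exponent below \<open>2\<close> and above both \<open>p_star\<close> and \<open>3 / 2\<close> serves.\<close>
      define s where "s = (max p_star (3 / 2) + 2) / 2"
      have s: "3 / 2 < s" "s < 2" "s > p_star" using p_star by (auto simp: s_def)
      have "((\<lambda>T. partition_cumulant (?m T) k) \<longlongrightarrow> 0) at_top"
        using s p_star by (intro partition_cumulant_tendsto_0[OF profile_measurable profile_integrable spectral 3 f_Lp[OF 3] s(1,2)]
            fourier_Ls) auto
      then show ?thesis using 3 partition_cumulant_gaussian[OF k, of ?v] by simp
    qed
  qed (use False in simp)
qed

lemma char_tendsto:
  assumes cs: "snd ` set cs \<subseteq> {0..1}"
  shows "((\<lambda>T. \<integral>\<omega>. cis (lin_comb cs (\<lambda>u. Y T u \<omega>)) \<partial>M) \<longlongrightarrow>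
    complex_of_real (exp (- ((\<integral>h. covar h \<partial>lborel) * (\<integral>t. profile cs t * profile cs t \<partial>lborel)) / 2))) at_top"
proof -
  have pos: "eventually (\<lambda>T::real. T > 0) at_top" by (rule eventually_gt_at_top)
  have "((\<lambda>T. \<integral>\<omega>. cis (lin_fun (rescaled (profile cs) T) \<omega>) \<partial>M) \<longlongrightarrow>
    complex_of_real (exp (- ((\<integral>h. covar h \<partial>lborel) * (\<integral>t. profile cs t * profile cs t \<partial>lborel)) / 2))) at_top"
  proof (rule char_tendsto_gaussian)
    show "eventually (\<lambda>T. lin_fun (rescaled (profile cs) T) \<in> borel_measurable M \<and>
        (\<forall>n. integrable M (\<lambda>\<omega>. lin_fun (rescaled (profile cs) T) \<omega> ^ n))) at_top"
      using pos
    proof eventually_elim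
      fix T :: real assume "T > 0"
      then show "lin_fun (rescaled (profile cs) T) \<in> borel_measurable M \<and>
        (\<forall>n. integrable M (\<lambda>\<omega>. lin_fun (rescaled (profile cs) T) \<omega> ^ n))"
        by (intro conjI allI lin_fun_measurable integrable_lin_fun_power rescaled_measurable rescaled_integrable profile_measurable profile_integrable)
    qed
    show "((\<lambda>T. \<integral>\<omega>. lin_fun (rescaled (profile cs) T) \<omega> ^ n \<partial>M) \<longlongrightarrow>
        gaussian_moment ((\<integral>h. covar h \<partial>lborel) * (\<integral>t. profile cs t * profile cs t \<partial>lborel)) n) at_top" for n
      using moment_tendsto[of cs n] by (simp only: moment_def)
  qed
  moreover have "eventually (\<lambda>T. (\<integral>\<omega>. cis (lin_fun (rescaled (profile cs) T) \<omega>) \<partial>M) = (\<integral>\<omega>. cis (lin_comb cs (\<lambda>u. Y T u \<omega>)) \<partial>M)) at_top"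
    using pos
  proof eventually_elim
    fix T :: real assume T: "T > 0"
    interpret YT: continuous_process M "Y T" by (rule Y_continuous_process[OF T])
    note [measurable] = YT.lin_comb_measurable[OF cs]
    show "(\<integral>\<omega>. cis (lin_fun (rescaled (profile cs) T) \<omega>) \<partial>M) = (\<integral>\<omega>. cis (lin_comb cs (\<lambda>u. Y T u \<omega>)) \<partial>M)"
    proof (rule integral_cong_AE)
      show "AE \<omega> in M. cis (lin_fun (rescaled (profile cs) T) \<omega>) = cis (lin_comb cs (\<lambda>u. Y T u \<omega>))"
        using lin_comb_Y[OF T cs] by eventually_elim simp
    qed measurable
  qed
  ultimately show ?thesis by (rule Lim_transform_eventually)
qed

end

section \<open>Fourth moments of increments\<close>

context clt_setup
begin

text \<open>
  The bound \<open>A V\<^sup>2\<close> is of second order in the squared \<open>L\<^sup>2\<close> norm \<open>V\<close> of the Fourier transform, like the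
  contribution of the variance to the fourth moment.
\<close>
lemma fourth_cumulant_bound:
  "\<exists>A\<ge>0. \<forall>\<psi> V. \<psi> \<in> borel_measurable borel \<longrightarrow> integrable lborel \<psi> \<longrightarrow> V > 0 \<longrightarrow>
     (\<integral>\<^sup>+l. ennreal (norm (fourier \<psi> l) powr 2) \<partial>lborel) \<le> ennreal V \<longrightarrow>
     \<bar>partition_cumulant (moment \<psi>) 4\<bar> \<le> A * V\<^sup>2"
proof -
  let ?L = "freq_space 4 :: (nat \<Rightarrow> real ^ 'd) measure"
  define A where "A = (\<integral>l. norm (f 4 l) powr 3 \<partial>?L) + 1"
  have f3: "integrable ?L (\<lambda>l. norm (f 4 l) powr 3)" and fm: "f 4 \<in> borel_measurable ?L"
    using f_Lp[of 4] by (simp_all add: in_Lp_def)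
  have I0: "(\<integral>l. norm (f 4 l) powr 3 \<partial>?L) \<ge> 0" by (intro integral_nonneg_AE) simp
  show ?thesis
  proof (intro exI[of _ A] conjI allI impI)
    show "A \<ge> 0" using I0 by (simp add: A_def)
    fix \<psi> :: "real ^ 'd \<Rightarrow> real" and V :: real
    assume psi_m[measurable]: "\<psi> \<in> borel_measurable borel" and psi: "integrable lborel \<psi>" and V: "V > 0"
      and le: "(\<integral>\<^sup>+l. ennreal (norm (fourier \<psi> l) powr 2) \<partial>lborel) \<le> ennreal V"
    define G where "G l = (\<Prod>j\<in>{1..4}. norm (fourier \<psi> (last_freq 4 l j)))" for l
    have h: "(\<lambda>x. norm (fourier \<psi> x)) \<in> borel_measurable borel" by measurable
    have Gm: "G \<in> borel_measurable ?L"
      unfolding G_def by (intro borel_measurable_prod measurable_compose[OF measurable_last_freq h]) simp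
    have G0: "G l \<ge> 0" for l unfolding G_def by (intro prod_nonneg) simp
    have G: "(\<integral>\<^sup>+l. ennreal (G l powr (3 / 2)) \<partial>?L) \<le> ennreal (V ^ 3)"
    proof -
      have "(\<integral>\<^sup>+l. ennreal (G l powr (3 / 2)) \<partial>?L) \<le> (\<integral>\<^sup>+l. ennreal (norm (fourier \<psi> l) powr 2) \<partial>lborel) ^ 3"
        using nn_integral_freq_prod_le[OF h, of 4 2] unfolding G_def by simp
      also have "\<dots> \<le> ennreal V ^ 3" by (intro power_mono le) simp
      finally show ?thesis using V by (simp add: ennreal_power)
    qed
    \<comment> \<open>Balances the two terms of the Young bound: both become \<open>V\<^sup>2\<close> times a constant.\<close>
    let ?\<eta> = "V powr (- 2 / 3)"
    have "ennreal \<bar>partition_cumulant (moment \<psi>) 4\<bar> \<le> (\<integral>\<^sup>+l. ennreal (norm (f 4 l) * G l) \<partial>?L)"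
      unfolding G_def by (rule abs_partition_cumulant_le[OF psi_m psi spectral]) simp
    also have "\<dots> \<le> ennreal (?\<eta> powr - 3) * (\<integral>\<^sup>+l. ennreal (norm (f 4 l) powr 3) \<partial>?L)
        + ennreal (?\<eta> powr (3 / 2)) * (\<integral>\<^sup>+l. ennreal (G l powr (3 / 2)) \<partial>?L)"
      by (rule nn_integral_mult_bound[OF _ Gm _ G0]) (use fm V in auto)
    also have "\<dots> \<le> ennreal (?\<eta> powr - 3) * ennreal (\<integral>l. norm (f 4 l) powr 3 \<partial>?L) + ennreal (?\<eta> powr (3 / 2)) * ennreal (V ^ 3)"
      using f3 by (intro add_mono mult_left_mono G) (simp_all add: nn_integral_eq_integral)
    also have "\<dots> = ennreal (?\<eta> powr - 3 * (\<integral>l. norm (f 4 l) powr 3 \<partial>?L) + ?\<eta> powr (3 / 2) * V ^ 3)"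
      using V I0 by (simp add: ennreal_mult)
    also have "?\<eta> powr - 3 = V\<^sup>2" using V by (simp add: powr_powr powr_numeral)
    also have "?\<eta> powr (3 / 2) * V ^ 3 = V\<^sup>2"
    proof -
      have "?\<eta> powr (3 / 2) = inverse V"
        by (simp only: powr_powr) (use V in \<open>simp add: powr_minus\<close>)
      then show ?thesis using V by (simp add: power2_eq_square power3_eq_cube)
    qed
    also have "V\<^sup>2 * (\<integral>l. norm (f 4 l) powr 3 \<partial>?L) + V\<^sup>2 = A * V\<^sup>2" by (simp add: A_def algebra_simps)
    finally show "\<bar>partition_cumulant (moment \<psi>) 4\<bar> \<le> A * V\<^sup>2"
      using I0 by (subst (asm) ennreal_le_iff) (auto simp: A_def)
  qed
qed

text \<open>The weight of an increment of the process.\<close>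
definition step :: "real \<Rightarrow> real \<Rightarrow> real ^ 'd \<Rightarrow> real" where
  "step u v t = ind (root CARD('d) u) t - ind (root CARD('d) v) t"

lemma step_measurable [measurable]: "step u v \<in> borel_measurable borel"
  unfolding step_def[abs_def] by measurable

lemma step_integrable: "integrable lborel (step u v)"
  unfolding step_def[abs_def] by (intro Bochner_Integration.integrable_diff integrable_ind)

lemma step_bounded: "\<bar>step u v t\<bar> \<le> 1"
  using ind_bounds(1,2)[of "root CARD('d) u" t] ind_bounds(1,2)[of "root CARD('d) v" t] by (simp add: step_def)

lemma integral_abs_step:
  assumes "v \<in> {0..1}" "u \<in> {0..1}" "v \<le> u"
  shows "(\<integral>t. \<bar>step u v t\<bar> \<partial>lborel) = (u - v) * measure lebesgue K"
  using integral_abs_ind_diff[of "root CARD('d) v" "root CARD('d) u"] assms root_unit root_power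
  by (simp add: step_def)

text \<open>
  For \<open>v > 0\<close> this is the normalisation of the kernel. It concerns differences of two proper dilates only;
  for \<open>v = 0\<close> the weight is the indicator of one dilate, and the bound holds by scaling.
\<close>
lemma nn_integral_fourier_step:
  "\<exists>D>0. \<forall>u\<in>{0..1}. \<forall>v\<in>{0..1}. v < u \<longrightarrow>
     (\<integral>\<^sup>+l. ennreal (norm (fourier (step u v) l) powr 2) \<partial>lborel) \<le> ennreal (D * (u - v))"
proof -
  define c where "c = (2 * pi) ^ CARD('d) * measure lebesgue K"
  let ?V1 = "\<integral>\<^sup>+l. ennreal (norm (fourier (ind 1) l) powr 2) \<partial>lborel"
  have c: "c > 0" using vol_pos by (simp add: c_def)
  have V1: "?V1 < \<infinity>"
    using fourier_Ls[of 2 "[(1, 1)]"] p_star by (simp add: profile_Cons profile_Nil)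
  show ?thesis
  proof (intro exI[of _ "c + enn2real ?V1"] conjI ballI impI)
    show "c + enn2real ?V1 > 0" using c by (simp add: add_pos_nonneg)
    fix u v :: real assume uv: "u \<in> {0..1}" "v \<in> {0..1}" "v < u"
    let ?\<rho>u = "root CARD('d) u" and ?\<rho>v = "root CARD('d) v"
    show "(\<integral>\<^sup>+l. ennreal (norm (fourier (step u v) l) powr 2) \<partial>lborel) \<le> ennreal ((c + enn2real ?V1) * (u - v))"
    proof (cases "v = 0")
      case True
      then have s: "step u v = ind ?\<rho>u" by (simp add: step_def[abs_def] ind_def[abs_def])
      have r: "?\<rho>u > 0" using uv by simp
      have "(?\<rho>u powr (real CARD('d) / 2)) powr 2 * ?\<rho>u powr (real CARD('d) * (2 / 2 - 1)) = u"
        using r root_power[OF uv(1)] by (simp add: powr_powr powr_realpow)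
      then have "(\<integral>\<^sup>+l. ennreal (norm (fourier (step u v) l) powr 2) \<partial>lborel) = ennreal u * ?V1"
        unfolding s nn_integral_fourier_ind[OF r] by (simp only:)
      also have "\<dots> = ennreal (u * enn2real ?V1)" using V1 uv by (simp add: ennreal_mult')
      also have "\<dots> \<le> ennreal ((c + enn2real ?V1) * (u - v))"
        using c uv True by (intro ennreal_leI) (simp add: algebra_simps)
      finally show ?thesis .
    next
      case False
      then have v: "0 < v" using uv by simp
      have r: "0 < ?\<rho>v" "?\<rho>v < ?\<rho>u" using v uv by simp_all
      have k: "integrable lebesgue (Phi2 K ?\<rho>v ?\<rho>u)" "(\<integral>l. Phi2 K ?\<rho>v ?\<rho>u l \<partial>lebesgue) = 1"
        using kernel r by (auto simp: kernel_properties_def)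
      have P: "Phi2 K ?\<rho>v ?\<rho>u l = (norm (fourier (step u v) l))\<^sup>2 / (c * (u - v))" for l
        using r root_power uv unfolding Phi2_def c_def step_def[abs_def]
        by (subst fourier_set_dilate_diff) auto
      have m: "Phi2 K ?\<rho>v ?\<rho>u \<in> borel_measurable lborel" unfolding P[abs_def] by measurable
      have kl: "integrable lborel (Phi2 K ?\<rho>v ?\<rho>u)" "(\<integral>l. Phi2 K ?\<rho>v ?\<rho>u l \<partial>lborel) = 1"
        using k integrable_completion[OF m] integral_completion[OF m] by auto
      have cp: "c * (u - v) > 0" using c uv by simp
      have "(\<integral>\<^sup>+l. ennreal (norm (fourier (step u v) l) powr 2) \<partial>lborel) =
          (\<integral>\<^sup>+l. ennreal (c * (u - v)) * ennreal (Phi2 K ?\<rho>v ?\<rho>u l) \<partial>lborel)"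
        using cp c uv(3) by (intro nn_integral_cong) (simp add: P ennreal_mult'[symmetric] powr_numeral)
      also have "\<dots> = ennreal (c * (u - v)) * (\<integral>\<^sup>+l. ennreal (Phi2 K ?\<rho>v ?\<rho>u l) \<partial>lborel)"
        by (rule nn_integral_cmult) (use m in simp)
      also have "(\<integral>\<^sup>+l. ennreal (Phi2 K ?\<rho>v ?\<rho>u l) \<partial>lborel) = ennreal (\<integral>l. Phi2 K ?\<rho>v ?\<rho>u l \<partial>lborel)"
        using cp by (intro nn_integral_eq_integral kl AE_I2) (simp add: P)
      also have "ennreal (c * (u - v)) * \<dots> \<le> ennreal ((c + enn2real ?V1) * (u - v))"
        using uv by (simp add: kl ennreal_leI distrib_right)
      finally show ?thesis .
    qed
  qed
qed

lemma Y_increment: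
  assumes T: "T > 0" and uv: "u \<in> {0..1}" "v \<in> {0..1}"
  shows "AE \<omega> in M. Y T u \<omega> - Y T v \<omega> = lin_fun (rescaled (step u v) T) \<omega>"
proof -
  have r: "rescaled (step u v) T = (\<lambda>t. (- 1) * rescaled (ind (root CARD('d) v)) T t + rescaled (ind (root CARD('d) u)) T t)"
    by (simp add: fun_eq_iff rescaled_def step_def diff_divide_distrib)
  show ?thesis
    using AE_space AE_integrable_rescaled[OF T ind_measurable integrable_ind[of "root CARD('d) v"]]
      AE_integrable_rescaled[OF T ind_measurable integrable_ind[of "root CARD('d) u"]]
  proof eventually_elim
    case (elim \<omega>)
    show ?case unfolding r lin_fun_linear[OF elim(2,3)] by (simp add: Y_eq[OF elim(1) T uv(1)] Y_eq[OF elim(1) T uv(2)])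
  qed
qed

lemma Y_fourth_moment:
  "\<exists>B\<ge>0. \<forall>T>0. \<forall>u\<in>{0..1}. \<forall>v\<in>{0..1}.
     (\<integral>\<^sup>+\<omega>. ennreal ((Y T u \<omega> - Y T v \<omega>) ^ 4) \<partial>M) \<le> ennreal (B * (u - v)\<^sup>2)"
proof -
  obtain A where A: "A \<ge> 0" "\<And>\<psi> V. \<psi> \<in> borel_measurable borel \<Longrightarrow> integrable lborel \<psi> \<Longrightarrow> V > 0 \<Longrightarrow>
     (\<integral>\<^sup>+l. ennreal (norm (fourier \<psi> l) powr 2) \<partial>lborel) \<le> ennreal V \<Longrightarrow>
     \<bar>partition_cumulant (moment \<psi>) 4\<bar> \<le> A * V\<^sup>2" using fourth_cumulant_bound by blast
  obtain D where D: "D > 0" "\<And>u v. u \<in> {0..1} \<Longrightarrow> v \<in> {0..1} \<Longrightarrow> v < u \<Longrightarrow>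
     (\<integral>\<^sup>+l. ennreal (norm (fourier (step u v) l) powr 2) \<partial>lborel) \<le> ennreal (D * (u - v))"
    using nn_integral_fourier_step by blast
  define R where "R = (\<integral>h. \<bar>covar h\<bar> \<partial>lborel) * measure lebesgue K"
  define B where "B = A * D\<^sup>2 + 3 * R\<^sup>2"
  have main: "(\<integral>\<^sup>+\<omega>. ennreal ((Y T u \<omega> - Y T v \<omega>) ^ 4) \<partial>M) \<le> ennreal (B * (u - v)\<^sup>2)"
    if T: "T > 0" and uv: "u \<in> {0..1}" "v \<in> {0..1}" "v < u" for T u v
  proof -
    let ?\<psi> = "rescaled (step u v) T" and ?a = "T powr (real CARD('d) / 2)"
    have m: "?\<psi> \<in> borel_measurable borel" and i: "integrable lborel ?\<psi>"
      using T by (auto intro: rescaled_integrable step_integrable)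
    have "(\<integral>\<^sup>+l. ennreal (norm (fourier ?\<psi> l) powr 2) \<partial>lborel) = (\<integral>\<^sup>+l. ennreal (norm (fourier (step u v) l) powr 2) \<partial>lborel)"
      unfolding nn_integral_fourier_rescaled[OF step_measurable T] using T by simp
    then have "\<bar>partition_cumulant (moment ?\<psi>) 4\<bar> \<le> A * (D * (u - v))\<^sup>2"
      using D uv by (intro A(2) m i) auto
    moreover have "partition_cumulant (moment ?\<psi>) 4 = moment ?\<psi> 4 - 3 * (moment ?\<psi> 2)\<^sup>2"
      by (rule partition_cumulant_4[of "moment ?\<psi>", OF moment_1[OF m i]])
    moreover have "\<bar>moment ?\<psi> 2\<bar> \<le> R * (u - v)"
    proof -
      have "\<bar>?\<psi> t\<bar> \<le> 1 / ?a" for t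
        using step_bounded[of u v "t /\<^sub>R T"] T by (simp add: rescaled_def abs_divide divide_right_mono)
      from abs_moment_2_le[OF m i this covar_integrable]
      have "\<bar>moment ?\<psi> 2\<bar> \<le> (\<integral>h. \<bar>covar h\<bar> \<partial>lborel) * (1 / ?a * (\<integral>t. \<bar>?\<psi> t\<bar> \<partial>lborel))" .
      also have "(\<integral>t. \<bar>?\<psi> t\<bar> \<partial>lborel) = (\<integral>t. (\<lambda>x. \<bar>step u v x\<bar> / ?a) (t /\<^sub>R T) \<partial>lborel)"
        using T by (simp add: rescaled_def abs_divide)
      also have "\<dots> = T ^ CARD('d) * ((\<integral>t. \<bar>step u v t\<bar> \<partial>lborel) / ?a)"
        using T by (subst integral_scale) auto
      also have "1 / ?a * \<dots> = (u - v) * measure lebesgue K"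
        using T uv by (simp add: integral_abs_step powr_half_square[OF T, symmetric] del: powr_half_square)
      finally show ?thesis by (simp add: R_def mult_ac)
    qed
    then have "(moment ?\<psi> 2)\<^sup>2 \<le> (R * (u - v))\<^sup>2" by (metis abs_ge_zero power2_abs power_mono)
    moreover have "B * (u - v)\<^sup>2 = A * (D * (u - v))\<^sup>2 + 3 * (R * (u - v))\<^sup>2"
      by (simp add: B_def power_mult_distrib distrib_right)
    ultimately have le: "moment ?\<psi> 4 \<le> B * (u - v)\<^sup>2" by linarith
    have "(\<integral>\<^sup>+\<omega>. ennreal ((Y T u \<omega> - Y T v \<omega>) ^ 4) \<partial>M) = (\<integral>\<^sup>+\<omega>. ennreal (lin_fun ?\<psi> \<omega> ^ 4) \<partial>M)"
      by (rule nn_integral_cong_AE) (use Y_increment[OF T uv(1,2)] in eventually_elim, simp)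
    also have "\<dots> = ennreal (moment ?\<psi> 4)"
      unfolding moment_def by (intro nn_integral_eq_integral integrable_lin_fun_power m i) auto
    also have "\<dots> \<le> ennreal (B * (u - v)\<^sup>2)" by (rule ennreal_leI[OF le])
    finally show ?thesis .
  qed
  show ?thesis
  proof (intro exI[of _ B] conjI allI impI ballI)
    show "B \<ge> 0" using A by (simp add: B_def)
    fix T u v :: real assume T: "T > 0" "u \<in> {0..1}" "v \<in> {0..1}"
    consider "u = v" | "v < u" | "u < v" by linarith
    then show "(\<integral>\<^sup>+\<omega>. ennreal ((Y T u \<omega> - Y T v \<omega>) ^ 4) \<partial>M) \<le> ennreal (B * (u - v)\<^sup>2)"
    proof cases
      case 3
      have "(Y T u \<omega> - Y T v \<omega>) ^ 4 = (Y T v \<omega> - Y T u \<omega>) ^ 4" for \<omega>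
        by (simp add: power4_eq_xxxx algebra_simps)
      then show ?thesis using main[OF T(1,3,2) 3] by (simp add: power2_commute)
    qed (use main T in auto)
  qed
qed

end

section \<open>The Gaussian limit process\<close>

text \<open>Gaussian white noise together with a convex body; \<open>\<sigma>\<close> is the factor in front of the stochastic integral.\<close>
locale white_noise_setup = prob_space N + convex_body K
  for N :: "'v measure" and K :: "(real ^ 'd) set" +
  fixes W :: "(real ^ 'd) set \<Rightarrow> 'v \<Rightarrow> real" and \<sigma> :: real
  assumes noise: "gaussian_white_noise N W"
begin

text \<open>The limit process, with a free factor \<open>\<sigma>\<close>.\<close>
definition L :: "real \<Rightarrow> 'v \<Rightarrow> real" where
  "L u \<omega> = \<sigma> * W (dilate (root CARD('d) u) K) \<omega>"

lemma W_gaussian: "finite J \<Longrightarrow> J \<subseteq> lmeasurable \<Longrightarrow> gaussian_rv N (\<lambda>\<omega>. \<Sum>A\<in>J. a A * W A \<omega>)"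
  using noise by (simp add: gaussian_white_noise_def centred_gaussian_family_def)

lemma W_mean: "A \<in> lmeasurable \<Longrightarrow> (\<integral>\<omega>. W A \<omega> \<partial>N) = 0"
  using noise by (simp add: gaussian_white_noise_def centred_gaussian_family_def)

lemma W_cov: "A \<in> lmeasurable \<Longrightarrow> A' \<in> lmeasurable \<Longrightarrow> (\<integral>\<omega>. W A \<omega> * W A' \<omega> \<partial>N) = measure lebesgue (A \<inter> A')"
  using noise by (simp add: gaussian_white_noise_def)

lemma W_single_gaussian: "A \<in> lmeasurable \<Longrightarrow> gaussian_rv N (W A)"
  using W_gaussian[of "{A}" "\<lambda>_. 1"] by simp

lemma W_integrable_power: "A \<in> lmeasurable \<Longrightarrow> integrable N (\<lambda>\<omega>. W A \<omega> ^ n)"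
  using centred_gaussian_moments[OF W_single_gaussian W_mean] by blast

lemma W_measurable [measurable]: "A \<in> lmeasurable \<Longrightarrow> W A \<in> borel_measurable N"
  using W_single_gaussian by (simp add: gaussian_rv_def)

lemma L_measurable: "L u \<in> borel_measurable N"
  unfolding L_def[abs_def] using W_measurable[OF dilate_lmeasurable] by measurable

lemma L_integrable_power: "integrable N (\<lambda>\<omega>. L u \<omega> ^ n)"
  unfolding L_def power_mult_distrib by (intro integrable_mult_right W_integrable_power dilate_lmeasurable)

lemma L_mean: "(\<integral>\<omega>. L u \<omega> \<partial>N) = 0"
  by (simp add: L_def W_mean[OF dilate_lmeasurable])

lemma L_cov:
  assumes "u \<in> {0..1}" "v \<in> {0..1}"
  shows "(\<integral>\<omega>. L u \<omega> * L v \<omega> \<partial>N) = \<sigma>\<^sup>2 * (\<integral>t. ind (root CARD('d) u) t * ind (root CARD('d) v) t \<partial>lborel)"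
proof -
  have "L u \<omega> * L v \<omega> = \<sigma>\<^sup>2 * (W (dilate (root CARD('d) u) K) \<omega> * W (dilate (root CARD('d) v) K) \<omega>)" for \<omega>
    by (simp add: L_def power2_eq_square mult_ac)
  then show ?thesis
    using assms by (simp add: W_cov[OF dilate_lmeasurable dilate_lmeasurable] integral_ind_mult)
qed

lemma L_integrable_mult: "integrable N (\<lambda>\<omega>. L u \<omega> * L v \<omega>)"
proof (rule Bochner_Integration.integrable_bound)
  show "integrable N (\<lambda>\<omega>. L u \<omega> ^ 2 + L v \<omega> ^ 2)" by (intro Bochner_Integration.integrable_add L_integrable_power)
  show "(\<lambda>\<omega>. L u \<omega> * L v \<omega>) \<in> borel_measurable N" by (intro borel_measurable_times L_measurable)
  show "AE \<omega> in N. norm (L u \<omega> * L v \<omega>) \<le> norm (L u \<omega> ^ 2 + L v \<omega> ^ 2)"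
  proof (rule AE_I2)
    fix \<omega>
    have "2 * \<bar>L u \<omega>\<bar> * \<bar>L v \<omega>\<bar> \<le> (L u \<omega>)\<^sup>2 + (L v \<omega>)\<^sup>2"
      using sum_squares_bound[of "\<bar>L u \<omega>\<bar>" "\<bar>L v \<omega>\<bar>"] by simp
    moreover have "0 \<le> \<bar>L u \<omega>\<bar> * \<bar>L v \<omega>\<bar>" by simp
    ultimately have "\<bar>L u \<omega>\<bar> * \<bar>L v \<omega>\<bar> \<le> (L u \<omega>)\<^sup>2 + (L v \<omega>)\<^sup>2" by linarith
    then show "norm (L u \<omega> * L v \<omega>) \<le> norm (L u \<omega> ^ 2 + L v \<omega> ^ 2)" by (simp add: abs_mult)
  qed
qed

lemma lin_comb_L_measurable: "(\<lambda>\<omega>. lin_comb cs (\<lambda>u. L u \<omega>)) \<in> borel_measurable N"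
proof (induction cs)
  case (Cons p cs)
  show ?case unfolding lin_comb_simps
    by (intro borel_measurable_add borel_measurable_times borel_measurable_const L_measurable Cons.IH)
qed simp

text \<open>
  Joint normality is available for sums over finite sets of regions, so terms with the same dilate are
  collected.
\<close>
lemma lin_comb_L_as_noise:
  "\<exists>J a. finite J \<and> J \<subseteq> lmeasurable \<and> (\<forall>\<omega>. lin_comb cs (\<lambda>u. L u \<omega>) = (\<Sum>A\<in>J. a A * W A \<omega>))"
proof (induction cs)
  case Nil
  show ?case by (intro exI[of _ "{}"]) simp
next
  case (Cons p cs)
  then obtain J a where J: "finite J" "J \<subseteq> lmeasurable"
    "\<And>\<omega>. lin_comb cs (\<lambda>u. L u \<omega>) = (\<Sum>A\<in>J. a A * W A \<omega>)" by blast
  let ?D = "dilate (root CARD('d) (snd p)) K"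
  let ?b = "\<lambda>A. (if A \<in> J then a A else 0) + (if A = ?D then fst p * \<sigma> else 0)"
  have "lin_comb (p # cs) (\<lambda>u. L u \<omega>) = (\<Sum>A\<in>insert ?D J. ?b A * W A \<omega>)" for \<omega>
  proof -
    have "(\<Sum>A\<in>insert ?D J. ?b A * W A \<omega>) =
        (\<Sum>A\<in>insert ?D J. (if A \<in> J then a A * W A \<omega> else 0)) + (\<Sum>A\<in>insert ?D J. (if A = ?D then fst p * \<sigma> * W A \<omega> else 0))"
      unfolding sum.distrib[symmetric] by (intro sum.cong) (auto simp: distrib_right)
    also have "(\<Sum>A\<in>insert ?D J. (if A \<in> J then a A * W A \<omega> else 0)) = (\<Sum>A\<in>J. a A * W A \<omega>)"
      using J(1) by (intro sum.mono_neutral_cong_right) auto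
    also have "(\<Sum>A\<in>insert ?D J. (if A = ?D then fst p * \<sigma> * W A \<omega> else 0)) = fst p * \<sigma> * W ?D \<omega>"
      using J(1) by (simp add: sum.delta)
    finally have S: "(\<Sum>A\<in>insert ?D J. ?b A * W A \<omega>) = (\<Sum>A\<in>J. a A * W A \<omega>) + fst p * \<sigma> * W ?D \<omega>" .
    have "L (snd p) \<omega> = \<sigma> * W ?D \<omega>" by (simp add: L_def)
    then show ?thesis unfolding S lin_comb_simps J(3) by simp
  qed
  then show ?case using J dilate_lmeasurable[of "root CARD('d) (snd p)"]
    by (intro exI[of _ "insert ?D J"] exI[of _ ?b]) auto
qed

lemma lin_comb_L_integrable: "integrable N (\<lambda>\<omega>. lin_comb cs (\<lambda>u. L u \<omega>))"
proof (induction cs)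
  case (Cons p cs)
  have "integrable N (L (snd p))" using L_integrable_power[of "snd p" 1] by simp
  then show ?case unfolding lin_comb_simps
    by (intro Bochner_Integration.integrable_add integrable_mult_right Cons.IH)
qed simp

lemma lin_comb_L_mean: "(\<integral>\<omega>. lin_comb cs (\<lambda>u. L u \<omega>) \<partial>N) = 0"
proof (induction cs)
  case (Cons p cs)
  have "integrable N (\<lambda>\<omega>. fst p * L (snd p) \<omega>)" using L_integrable_power[of "snd p" 1] by simp
  then show ?case unfolding lin_comb_simps
    by (subst Bochner_Integration.integral_add) (simp_all add: lin_comb_L_integrable Cons.IH L_mean)
qed simp

lemma L_lin_comb_cov:
  assumes u: "u \<in> {0..1}"
  shows "snd ` set cs \<subseteq> {0..1} \<Longrightarrow> integrable N (\<lambda>\<omega>. L u \<omega> * lin_comb cs (\<lambda>u. L u \<omega>)) \<and>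
    (\<integral>\<omega>. L u \<omega> * lin_comb cs (\<lambda>u. L u \<omega>) \<partial>N) = \<sigma>\<^sup>2 * (\<integral>t. ind (root CARD('d) u) t * profile cs t \<partial>lborel) \<and>
    integrable lborel (\<lambda>t. ind (root CARD('d) u) t * profile cs t)"
proof (induction cs)
  case (Cons p cs)
  then have p: "snd p \<in> {0..1}" by auto
  note IH = Cons.IH[THEN conjunct1] Cons.IH[THEN conjunct2, THEN conjunct1] Cons.IH[THEN conjunct2, THEN conjunct2]
  have i: "integrable lborel (\<lambda>t. ind (root CARD('d) u) t * ind (root CARD('d) (snd p)) t)"
    using u p by (intro integral_ind_mult(2)) auto
  have e1: "L u \<omega> * lin_comb (p # cs) (\<lambda>u. L u \<omega>) = fst p * (L u \<omega> * L (snd p) \<omega>) + L u \<omega> * lin_comb cs (\<lambda>u. L u \<omega>)" for \<omega>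
    by (simp add: algebra_simps)
  have e2: "ind (root CARD('d) u) t * profile (p # cs) t = fst p * (ind (root CARD('d) u) t * ind (root CARD('d) (snd p)) t)
      + ind (root CARD('d) u) t * profile cs t" for t
    by (simp add: algebra_simps)
  show ?case unfolding e1 e2
    using IH Cons.prems L_integrable_mult[of u "snd p"] L_cov[OF u p] i by (simp add: distrib_left)
qed simp

lemma lin_comb_cov:
  assumes ds: "snd ` set ds \<subseteq> {0..1}"
  shows "snd ` set cs \<subseteq> {0..1} \<Longrightarrow> integrable N (\<lambda>\<omega>. lin_comb cs (\<lambda>u. L u \<omega>) * lin_comb ds (\<lambda>u. L u \<omega>)) \<and>
    (\<integral>\<omega>. lin_comb cs (\<lambda>u. L u \<omega>) * lin_comb ds (\<lambda>u. L u \<omega>) \<partial>N) = \<sigma>\<^sup>2 * (\<integral>t. profile cs t * profile ds t \<partial>lborel) \<and>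
    integrable lborel (\<lambda>t. profile cs t * profile ds t)"
proof (induction cs)
  case (Cons p cs)
  then have p: "snd p \<in> {0..1}" by auto
  note IH = Cons.IH[THEN conjunct1] Cons.IH[THEN conjunct2, THEN conjunct1] Cons.IH[THEN conjunct2, THEN conjunct2]
  note c = L_lin_comb_cov[OF p ds]
  have e1: "lin_comb (p # cs) (\<lambda>u. L u \<omega>) * lin_comb ds (\<lambda>u. L u \<omega>) =
      fst p * (L (snd p) \<omega> * lin_comb ds (\<lambda>u. L u \<omega>)) + lin_comb cs (\<lambda>u. L u \<omega>) * lin_comb ds (\<lambda>u. L u \<omega>)" for \<omega>
    by (simp add: algebra_simps)
  have e2: "profile (p # cs) t * profile ds t = fst p * (ind (root CARD('d) (snd p)) t * profile ds t) + profile cs t * profile ds t" for t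
    by (simp add: algebra_simps)
  show ?case unfolding e1 e2
    using IH Cons.prems c by (simp add: distrib_left)
qed simp

lemma lin_comb_L_gaussian:
  assumes cs: "snd ` set cs \<subseteq> {0..1}"
  defines "v \<equiv> \<sigma>\<^sup>2 * (\<integral>t. profile cs t * profile cs t \<partial>lborel)"
  shows "integrable N (\<lambda>\<omega>. lin_comb cs (\<lambda>u. L u \<omega>) ^ n)"
    and "(\<integral>\<omega>. lin_comb cs (\<lambda>u. L u \<omega>) ^ n \<partial>N) = gaussian_moment v n"
proof -
  obtain J a where J: "finite J" "J \<subseteq> lmeasurable" "\<And>\<omega>. lin_comb cs (\<lambda>u. L u \<omega>) = (\<Sum>A\<in>J. a A * W A \<omega>)"
    using lin_comb_L_as_noise[of cs] by blast
  have "gaussian_rv N (\<lambda>\<omega>. lin_comb cs (\<lambda>u. L u \<omega>))" unfolding J(3) by (rule W_gaussian[OF J(1,2)])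
  from centred_gaussian_moments[OF this lin_comb_L_mean] obtain w where
    w: "\<And>n. integrable N (\<lambda>\<omega>. lin_comb cs (\<lambda>u. L u \<omega>) ^ n)"
      "\<And>n. (\<integral>\<omega>. lin_comb cs (\<lambda>u. L u \<omega>) ^ n \<partial>N) = gaussian_moment w n"
    by (elim exE) (auto simp only:)
  have "w = (\<integral>\<omega>. lin_comb cs (\<lambda>u. L u \<omega>) ^ 2 \<partial>N)" unfolding w(2) by (simp only: gaussian_moment_simps)
  also have "\<dots> = v"
    using lin_comb_cov[OF cs cs, THEN conjunct2, THEN conjunct1] unfolding v_def
    by (simp only: power2_eq_square[of "lin_comb _ _"])
  finally have wv: "w = v" .
  show "integrable N (\<lambda>\<omega>. lin_comb cs (\<lambda>u. L u \<omega>) ^ n)" by (rule w(1))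
  show "(\<integral>\<omega>. lin_comb cs (\<lambda>u. L u \<omega>) ^ n \<partial>N) = gaussian_moment v n" unfolding w(2) wv ..
qed

lemma char_L:
  assumes "snd ` set cs \<subseteq> {0..1}"
  shows "(\<integral>\<omega>. cis (lin_comb cs (\<lambda>u. L u \<omega>)) \<partial>N) =
    complex_of_real (exp (- (\<sigma>\<^sup>2 * (\<integral>t. profile cs t * profile cs t \<partial>lborel)) / 2))"
  by (rule char_gaussian[OF lin_comb_L_measurable lin_comb_L_gaussian[OF assms]])

lemma L_zero: "AE \<omega> in N. L 0 \<omega> = 0"
proof -
  have "(\<integral>\<omega>. L 0 \<omega> * L 0 \<omega> \<partial>N) = 0" using L_cov[of 0 0] by (simp add: ind_def)
  then have "AE \<omega> in N. L 0 \<omega> * L 0 \<omega> = 0"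
    by (subst (asm) integral_nonneg_eq_0_iff_AE[OF L_integrable_mult]) auto
  then show ?thesis by eventually_elim simp
qed

lemma L_fourth_moment:
  assumes uv: "u \<in> {0..1}" "v \<in> {0..1}"
  shows "(\<integral>\<^sup>+\<omega>. ennreal ((L u \<omega> - L v \<omega>) ^ 4) \<partial>N) \<le> ennreal (3 * (\<sigma>\<^sup>2 * measure lebesgue K)\<^sup>2 * (u - v)\<^sup>2)"
proof -
  let ?cs = "[(1, u), (- 1, v)]"
  let ?\<rho>u = "root CARD('d) u" and ?\<rho>v = "root CARD('d) v"
  have cs: "snd ` set ?cs \<subseteq> {0..1}" using uv by simp
  have r: "0 \<le> ?\<rho>u" "0 \<le> ?\<rho>v" "?\<rho>u ^ CARD('d) = u" "?\<rho>v ^ CARD('d) = v"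
    using uv by (auto intro: real_root_pow_pos2)
  have e: "L u \<omega> - L v \<omega> = lin_comb ?cs (\<lambda>u. L u \<omega>)" for \<omega> by simp
  have "(\<integral>t. \<bar>ind ?\<rho>u t - ind ?\<rho>v t\<bar> \<partial>lborel) = \<bar>u - v\<bar> * measure lebesgue K"
  proof (cases "v \<le> u")
    case True
    then show ?thesis using integral_abs_ind_diff[of ?\<rho>v ?\<rho>u] r by simp
  next
    case False
    then show ?thesis using integral_abs_ind_diff[of ?\<rho>u ?\<rho>v] r by (simp add: abs_minus_commute)
  qed
  moreover have "profile ?cs t * profile ?cs t = \<bar>ind ?\<rho>u t - ind ?\<rho>v t\<bar>" for t
    by (simp add: ind_def indicator_def)
  ultimately have p: "(\<integral>t. profile ?cs t * profile ?cs t \<partial>lborel) = \<bar>u - v\<bar> * measure lebesgue K"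
    by simp
  have "(\<integral>\<^sup>+\<omega>. ennreal ((L u \<omega> - L v \<omega>) ^ 4) \<partial>N) = ennreal (\<integral>\<omega>. lin_comb ?cs (\<lambda>u. L u \<omega>) ^ 4 \<partial>N)"
    unfolding e by (intro nn_integral_eq_integral lin_comb_L_gaussian[OF cs]) simp
  also have "\<dots> = ennreal (3 * (\<sigma>\<^sup>2 * (\<bar>u - v\<bar> * measure lebesgue K))\<^sup>2)"
    unfolding lin_comb_L_gaussian(2)[OF cs] gaussian_moment_simps p ..
  also have "3 * (\<sigma>\<^sup>2 * (\<bar>u - v\<bar> * measure lebesgue K))\<^sup>2 = 3 * (\<sigma>\<^sup>2 * measure lebesgue K)\<^sup>2 * (u - v)\<^sup>2"
    by (simp add: power_mult_distrib mult_ac)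
  finally show ?thesis by simp
qed

end

theorem theorem3:
  fixes M :: "'w measure" and X :: "real ^ 'd \<Rightarrow> 'w \<Rightarrow> real"
    and f :: "nat \<Rightarrow> (nat \<Rightarrow> real ^ 'd) \<Rightarrow> complex"
    and K :: "(real ^ 'd) set" and p_star :: real
    and N :: "'v measure" and b :: "real ^ 'd \<Rightarrow> 'v \<Rightarrow> real"
    and W :: "(real ^ 'd) set \<Rightarrow> 'v \<Rightarrow> real"
  assumes "prob_space M"
    and "(\<lambda>(t, \<omega>). X t \<omega>) \<in> borel_measurable (borel \<Otimes>\<^sub>M M)"
    and "strictly_stationary M X"
    and "\<And>t. (\<integral>\<omega>. X t \<omega> \<partial>M) = 0"
    and "\<And>t k. k \<ge> (2::nat) \<Longrightarrow> integrable M (\<lambda>\<omega>. \<bar>X t \<omega>\<bar> ^ k)"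
    and "cumulant_spectral_densities M X f"
    and "bounded K" and "convex K" and "0 < measure lebesgue K" and "0 \<in> K"
    and i: "1 \<le> p_star" "p_star < 2" "\<And>p. p > p_star \<Longrightarrow> in_Lp p lborel (fourier_set K)"
    and ii: "bounded (range (second_order f))" "continuous_on UNIV (second_order f)"
      "integrable lborel (\<lambda>t. \<integral>\<omega>. X t \<omega> * X 0 \<omega> \<partial>M)"
      "second_order f 0 =
         complex_of_real (1 / (2 * pi) ^ CARD('d) * (\<integral>t. (\<integral>\<omega>. X t \<omega> * X 0 \<omega> \<partial>M) \<partial>lborel))"
      "second_order f 0 \<noteq> 0"
    and iii: "\<And>k. k \<ge> 3 \<Longrightarrow> in_Lp (2 * (real k - 1) / (real k - 2)) (freq_space k) (f k)"
    and iv: "kernel_properties K"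
    and "prob_space N" and "chentsov_bm N b" and "noise_of N b W"
    and L_continuous:
      "AE \<omega> in N. continuous_on {0..1} (\<lambda>u. L_process W (Re (second_order f 0)) K u \<omega>)"
  shows "weakly_converges (mtopology_of C01)
           (\<lambda>T. law_C01 M (Y_process X K T))
           (law_C01 N (L_process W (Re (second_order f 0)) K)) at_top"
proof -
  interpret moment_field M X
    using assms(1-5) by (intro moment_field.intro moment_field_axioms.intro) auto
  interpret clt_setup M X K f p_star
    using assms(6-10) i iii iv ii(3) by unfold_locales (auto simp: covar_def[abs_def])
  let ?c = "\<integral>h. covar h \<partial>lborel"
  let ?f0 = "Re (second_order f 0)"
  have v0: "(2 * pi) ^ CARD('d) * ?f0 = ?c"
    unfolding ii(4) by (simp add: covar_def[abs_def])
  \<comment> \<open>The integral of the covariance function is a positive multiple of a limit of second moments.\<close>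
  have "?c \<ge> 0"
  proof -
    have "((\<lambda>T. moment (rescaled (profile [(1, 1)]) T) 2) \<longlongrightarrow>
        gaussian_moment (?c * (\<integral>t. profile [(1, 1)] t * profile [(1, 1)] t \<partial>lborel)) 2) at_top"
      by (rule moment_tendsto)
    then have "0 \<le> gaussian_moment (?c * (\<integral>t. profile [(1, 1)] t * profile [(1, 1)] t \<partial>lborel)) 2"
      by (rule tendsto_lowerbound) (auto simp: moment_def intro!: always_eventually integral_nonneg_AE)
    then show ?thesis
      using vol_pos unfolding gaussian_moment_simps by (simp add: ind_square integral_ind zero_le_mult_iff)
  qed
  then have v0: "(sqrt ((2 * pi) ^ CARD('d) * ?f0))\<^sup>2 = ?c" using v0 by simp
  interpret NW: white_noise_setup N K W "sqrt ((2 * pi) ^ CARD('d) * ?f0)"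
    using assms(7,8,10) \<open>prob_space N\<close> \<open>noise_of N b W\<close>
    by (intro white_noise_setup.intro white_noise_setup_axioms.intro convex_body.intro) (auto simp: noise_of_def)
  have L: "L_process W ?f0 K = NW.L" by (intro ext) (simp only: L_process_def NW.L_def)
  obtain B where B: "B \<ge> 0" "\<And>T u v. T > 0 \<Longrightarrow> u \<in> {0..1} \<Longrightarrow> v \<in> {0..1} \<Longrightarrow>
     (\<integral>\<^sup>+\<omega>. ennreal ((Y T u \<omega> - Y T v \<omega>) ^ 4) \<partial>M) \<le> ennreal (B * (u - v)\<^sup>2)"
    using Y_fourth_moment by blast
  let ?B = "max B (3 * (?c * measure lebesgue K)\<^sup>2)"
  have le: "ennreal (B * (u - v)\<^sup>2) \<le> ennreal (?B * (u - v)\<^sup>2)"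
    "ennreal (3 * (?c * measure lebesgue K)\<^sup>2 * (u - v)\<^sup>2) \<le> ennreal (?B * (u - v)\<^sup>2)" for u v :: real
    by (intro ennreal_leI mult_right_mono; simp)+
  have pos: "eventually (\<lambda>T::real. T > 0) at_top" by (rule eventually_gt_at_top)
  show ?thesis
    unfolding L
  proof (rule weak_convergence_C01[where B = ?B])
    show "eventually (\<lambda>T. continuous_process M (Y T)) at_top"
      using pos by eventually_elim (rule Y_continuous_process)
    show "continuous_process N NW.L"
      using NW.L_measurable L_continuous[unfolded L] \<open>prob_space N\<close>
      by (intro continuous_process.intro continuous_process_axioms.intro) auto
    show "eventually (\<lambda>T. AE \<omega> in M. Y T 0 \<omega> = 0) at_top"
      using pos by eventually_elim (rule Y_zero)
    show "AE \<omega> in N. NW.L 0 \<omega> = 0" by (rule NW.L_zero)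
    show "?B \<ge> 0" using B by simp
    show "eventually (\<lambda>T. \<forall>u\<in>{0..1}. \<forall>v\<in>{0..1}.
       (\<integral>\<^sup>+\<omega>. ennreal ((Y T u \<omega> - Y T v \<omega>) ^ 4) \<partial>M) \<le> ennreal (?B * (u - v)\<^sup>2)) at_top"
      using pos
    proof eventually_elim
      fix T :: real assume "T > 0"
      then show "\<forall>u\<in>{0..1}. \<forall>v\<in>{0..1}. (\<integral>\<^sup>+\<omega>. ennreal ((Y T u \<omega> - Y T v \<omega>) ^ 4) \<partial>M) \<le> ennreal (?B * (u - v)\<^sup>2)"
        by (intro ballI order_trans[OF B(2) le(1)])
    qed
    show "(\<integral>\<^sup>+\<omega>. ennreal ((NW.L u \<omega> - NW.L v \<omega>) ^ 4) \<partial>N) \<le> ennreal (?B * (u - v)\<^sup>2)"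
      if "u \<in> {0..1}" "v \<in> {0..1}" for u v
      using NW.L_fourth_moment[OF that] le(2)[of u v] unfolding v0 by (rule order_trans)
    show "((\<lambda>T. \<integral>\<omega>. cis (lin_comb cs (\<lambda>u. Y T u \<omega>)) \<partial>M) \<longlongrightarrow> (\<integral>\<omega>. cis (lin_comb cs (\<lambda>u. NW.L u \<omega>)) \<partial>N)) at_top"
      if "snd ` set cs \<subseteq> {0..1}" for cs
      using char_tendsto[OF that] unfolding NW.char_L[OF that] v0 .
  qed
qed

end
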